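(* Let $G$ be a Garside group and $r$ a natural number. The Lexicographic Super Summit Set is a complete, finite, effectively computable invariant of simultaneous conjugacy classes in $G^r$. That is: (i) for each $a\in G^r$ the set $\mathrm{LSSS}(a)$ is finite and nonempty; (ii) for all $a,c\in G^r$, there is $x\in G$ with $a^x=c$ if and only if $\mathrm{LSSS}(a)=\mathrm{LSSS}(c)$; (iii) there is an algorithm that, given $a\in G^r$, computes the finite set $\mathrm{LSSS}(a)$.
   Context: Garside groups. A monoid $M$ is Noetherian if for each $a\in M$ there is $n\in\mathbb N$ such that $a$ is not a product of more than $n$ nonidentity elements. In a monoid, $a$ is a left divisor of $b$ ($a\preceq b$) if $b\in aM$, and a right divisor of $b$ ($b\succeq a$) if $b\in Ma$. $M$ is Gaussian if it is Noetherian, cancellative, and every pair of elements has a right lcm (least upper bound for $\preceq$) and a left lcm (the analogous notion for right divisibility). A Garside group is a group $G$ with a finite subset $S$ (the simple elements) and an element $\Delta$ (the Garside element) such that the monoid $G^+$ generated by $S$ is Gaussian with group of fractions $G$, $\Delta\in G^+$ is balanced (its left and right divisors coincide), and $S$ is the set of divisors of $\Delta$ in $G^+$. Elements of $G$ are given to algorithms as words in $S$ and inverses of elements of $S$; the finite Garside structure is fixed and known. For $a,b\in G$, $a\le b$ means $b=cac'$ for some $c,c'\in G^+$. For $a\in G$, $\inf a$ and $\sup a$ are the maximal $m\in\mathbb Z$ and minimal $n\in\mathbb Z$ with $\Delta^m\le a\le\Delta^n$. For $a\in G^r$ and $g\in G$: $a^g=(g^{-1}a_1g,\dotsc,g^{-1}a_rg)$,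 $a^G=\{a^g:g\in G\}$, and $\inf a$, $\sup a\in\mathbb Z^r$ are taken coordinatewise. For $p\le q$ in $\mathbb Z^r$ (coordinatewise order), $[p,q]=\{a\in G^r: p\le\inf a,\ \sup a\le q\}$; entries of $q$ may also be $\infty$, imposing no upper bound in that coordinate. The summit infimum (respectively, summit supremum) of $a_1\in G$ is the maximal infimum (respectively, minimal supremum) of an element of the conjugacy class of $a_1$. The lexicographically minimal interval for $a^G$, $a\in G^r$, is the unique interval $[p,q]$ such that: (1) $p_1$ and $q_1$ are the summit infimum and summit supremum of $a_1$, respectively; (2) for $i=2,3,\dotsc,r$, in this order, $p_i$ is maximal with $(a_1,\dotsc,a_i)^G\cap[(p_1,\dotsc,p_i),(q_1,\dotsc,q_{i-1},\infty)]\ne\emptyset$, and then $q_i$ is minimal (given $p_i$) with $(a_1,\dotsc,a_i)^G\cap[(p_1,\dotsc,p_i),(q_1,\dotsc,q_i)]\ne\emptyset$. The Lexicographic Super Summit Set $\mathrm{LSSS}(a)$ is the intersection of $a^G$ with its lexicographically minimal interval. *)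

theory Defs
  imports
    "HOL-Algebra.Divisibility"
    "HOL-Library.Extended"
    "HOL-Library.Nat_Bijection"
begin

definition left_divisor :: "('a, 'b) monoid_scheme \<Rightarrow> 'a \<Rightarrow> 'a \<Rightarrow> bool" where
  "left_divisor M a b \<longleftrightarrow> (\<exists>c\<in>carrier M. b = a \<otimes>\<^bsub>M\<^esub> c)"

definition right_divisor :: "('a, 'b) monoid_scheme \<Rightarrow> 'a \<Rightarrow> 'a \<Rightarrow> bool" where
  "right_divisor M a b \<longleftrightarrow> (\<exists>c\<in>carrier M. b = c \<otimes>\<^bsub>M\<^esub> a)"

definition noetherian_monoid :: "('a, 'b) monoid_scheme \<Rightarrow> bool" where
  "noetherian_monoid M \<longleftrightarrow>
    (\<forall>a\<in>carrier M. \<exists>n::nat. \<forall>xs. set xs \<subseteq> carrier M - {\<one>\<^bsub>M\<^esub>} \<longrightarrow>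
       foldr (\<otimes>\<^bsub>M\<^esub>) xs \<one>\<^bsub>M\<^esub> = a \<longrightarrow> length xs \<le> n)"

definition is_right_lcm :: "('a, 'b) monoid_scheme \<Rightarrow> 'a \<Rightarrow> 'a \<Rightarrow> 'a \<Rightarrow> bool" where
  "is_right_lcm M a b m \<longleftrightarrow> m \<in> carrier M \<and> left_divisor M a m \<and> left_divisor M b m \<and>
    (\<forall>m'\<in>carrier M. left_divisor M a m' \<and> left_divisor M b m' \<longrightarrow> left_divisor M m m')"

definition is_left_lcm :: "('a, 'b) monoid_scheme \<Rightarrow> 'a \<Rightarrow> 'a \<Rightarrow> 'a \<Rightarrow> bool" where
  "is_left_lcm M a b m \<longleftrightarrow> m \<in> carrier M \<and> right_divisor M a m \<and> right_divisor M b m \<and>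
    (\<forall>m'\<in>carrier M. right_divisor M a m' \<and> right_divisor M b m' \<longrightarrow> right_divisor M m m')"

locale gaussian_monoid = monoid_cancel M for M (structure) +
  assumes noetherian: "noetherian_monoid M"
    and right_lcm_ex: "\<lbrakk>a \<in> carrier M; b \<in> carrier M\<rbrakk> \<Longrightarrow> \<exists>m. is_right_lcm M a b m"
    and left_lcm_ex: "\<lbrakk>a \<in> carrier M; b \<in> carrier M\<rbrakk> \<Longrightarrow> \<exists>m. is_left_lcm M a b m"

inductive_set submonoid_gen :: "('a, 'b) monoid_scheme \<Rightarrow> 'a set \<Rightarrow> 'a set"
  for G (structure) and S where
  one: "\<one> \<in> submonoid_gen G S"
| mult: "\<lbrakk>s \<in> S; x \<in> submonoid_gen G S\<rbrakk> \<Longrightarrow> s \<otimes> x \<in> submonoid_gen G S"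

abbreviation pos_monoid :: "('a, 'b) monoid_scheme \<Rightarrow> 'a set \<Rightarrow> ('a, 'b) monoid_scheme" where
  "pos_monoid G S \<equiv> G\<lparr>carrier := submonoid_gen G S\<rparr>"

locale garside_group = group G for G (structure) +
  fixes S :: "'a set" and \<Delta> :: 'a
  assumes simples_subset: "S \<subseteq> carrier G"
    and simples_finite: "finite S"
    and gaussian: "gaussian_monoid (pos_monoid G S)"
    and fractions: "carrier G = {a \<otimes> inv b | a b. a \<in> submonoid_gen G S \<and> b \<in> submonoid_gen G S}"
    and Delta_pos: "\<Delta> \<in> submonoid_gen G S"
    and Delta_balanced:
      "{a \<in> submonoid_gen G S. left_divisor (pos_monoid G S) a \<Delta>} =
       {a \<in> submonoid_gen G S. right_divisor (pos_monoid G S) a \<Delta>}"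
    and simples_divisors: "S = {a \<in> submonoid_gen G S. left_divisor (pos_monoid G S) a \<Delta>}"

definition garside_le :: "('a, 'b) monoid_scheme \<Rightarrow> 'a set \<Rightarrow> 'a \<Rightarrow> 'a \<Rightarrow> bool" where
  "garside_le G S a b \<longleftrightarrow>
    (\<exists>c\<in>submonoid_gen G S. \<exists>c'\<in>submonoid_gen G S. b = c \<otimes>\<^bsub>G\<^esub> a \<otimes>\<^bsub>G\<^esub> c')"

text \<open>The extrema below exist unless \<open>\<Delta>\<close> is the identity. In that case the group is trivial and
  both functions are constant (with unspecified values), so nothing built on them is affected.\<close>

definition garside_inf :: "('a, 'b) monoid_scheme \<Rightarrow> 'a set \<Rightarrow> 'a \<Rightarrow> 'a \<Rightarrow> int" where
  "garside_inf G S \<Delta> a = (GREATEST m. garside_le G S (\<Delta> [^]\<^bsub>G\<^esub> m) a)"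

definition garside_sup :: "('a, 'b) monoid_scheme \<Rightarrow> 'a set \<Rightarrow> 'a \<Rightarrow> 'a \<Rightarrow> int" where
  "garside_sup G S \<Delta> a = (LEAST n. garside_le G S a (\<Delta> [^]\<^bsub>G\<^esub> n))"

text \<open>Tuples in \<open>G\<^sup>r\<close> are lists of length \<open>r\<close>; positions are counted from 0.\<close>

definition tuples :: "('a, 'b) monoid_scheme \<Rightarrow> nat \<Rightarrow> 'a list set" where
  "tuples G r = {a. set a \<subseteq> carrier G \<and> length a = r}"

definition conj_tuple :: "('a, 'b) monoid_scheme \<Rightarrow> 'a list \<Rightarrow> 'a \<Rightarrow> 'a list" where
  "conj_tuple G a g = map (\<lambda>x. inv\<^bsub>G\<^esub> g \<otimes>\<^bsub>G\<^esub> x \<otimes>\<^bsub>G\<^esub> g) a"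

definition conj_class :: "('a, 'b) monoid_scheme \<Rightarrow> 'a list \<Rightarrow> 'a list set" where
  "conj_class G a = conj_tuple G a ` carrier G"

definition garside_interval ::
  "('a, 'b) monoid_scheme \<Rightarrow> 'a set \<Rightarrow> 'a \<Rightarrow> int list \<Rightarrow> int extended list \<Rightarrow> 'a list set" where
  "garside_interval G S \<Delta> p q =
    {a. set a \<subseteq> carrier G \<and> length a = length p \<and> length a = length q \<and>
        (\<forall>i<length a. p ! i \<le> garside_inf G S \<Delta> (a ! i) \<and>
                      Fin (garside_sup G S \<Delta> (a ! i)) \<le> q ! i)}"

definition is_maximal_such :: "(int \<Rightarrow> bool) \<Rightarrow> int \<Rightarrow> bool" where
  "is_maximal_such P m \<longleftrightarrow> P m \<and> (\<forall>k. P k \<longrightarrow> k \<le> m)"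

definition is_minimal_such :: "(int \<Rightarrow> bool) \<Rightarrow> int \<Rightarrow> bool" where
  "is_minimal_such P m \<longleftrightarrow> P m \<and> (\<forall>k. P k \<longrightarrow> m \<le> k)"

definition is_summit_inf :: "('a, 'b) monoid_scheme \<Rightarrow> 'a set \<Rightarrow> 'a \<Rightarrow> 'a \<Rightarrow> int \<Rightarrow> bool" where
  "is_summit_inf G S \<Delta> x =
    is_maximal_such (\<lambda>m. \<exists>g\<in>carrier G. m = garside_inf G S \<Delta> (inv\<^bsub>G\<^esub> g \<otimes>\<^bsub>G\<^esub> x \<otimes>\<^bsub>G\<^esub> g))"

definition is_summit_sup :: "('a, 'b) monoid_scheme \<Rightarrow> 'a set \<Rightarrow> 'a \<Rightarrow> 'a \<Rightarrow> int \<Rightarrow> bool" where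
  "is_summit_sup G S \<Delta> x =
    is_minimal_such (\<lambda>n. \<exists>g\<in>carrier G. n = garside_sup G S \<Delta> (inv\<^bsub>G\<^esub> g \<otimes>\<^bsub>G\<^esub> x \<otimes>\<^bsub>G\<^esub> g))"

definition is_lex_min_interval ::
  "('a, 'b) monoid_scheme \<Rightarrow> 'a set \<Rightarrow> 'a \<Rightarrow> 'a list \<Rightarrow> int list \<Rightarrow> int list \<Rightarrow> bool" where
  "is_lex_min_interval G S \<Delta> a p q \<longleftrightarrow>
    length p = length a \<and> length q = length a \<and>
    (a \<noteq> [] \<longrightarrow> is_summit_inf G S \<Delta> (a ! 0) (p ! 0) \<and> is_summit_sup G S \<Delta> (a ! 0) (q ! 0)) \<and>
    (\<forall>i. 1 \<le> i \<and> i < length a \<longrightarrow>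
       is_maximal_such
         (\<lambda>m. conj_class G (take (Suc i) a) \<inter>
              garside_interval G S \<Delta> (take i p @ [m]) (map Fin (take i q) @ [\<infinity>]) \<noteq> {})
         (p ! i) \<and>
       is_minimal_such
         (\<lambda>n. conj_class G (take (Suc i) a) \<inter>
              garside_interval G S \<Delta> (take (Suc i) p) (map Fin (take i q @ [n])) \<noteq> {})
         (q ! i))"

definition lex_min_interval ::
  "('a, 'b) monoid_scheme \<Rightarrow> 'a set \<Rightarrow> 'a \<Rightarrow> 'a list \<Rightarrow> int list \<times> int list" where
  "lex_min_interval G S \<Delta> a = (THE (p, q). is_lex_min_interval G S \<Delta> a p q)"

definition LSSS :: "('a, 'b) monoid_scheme \<Rightarrow> 'a set \<Rightarrow> 'a \<Rightarrow> 'a list \<Rightarrow> 'a list set" where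
  "LSSS G S \<Delta> a = conj_class G a \<inter>
    (case lex_min_interval G S \<Delta> a of (p, q) \<Rightarrow> garside_interval G S \<Delta> p (map Fin q))"

text \<open>Algorithms are programs for Kleene's partial recursive functions; \<open>recf_eval f xs y\<close>
  says that the program \<open>f\<close> halts on the argument list \<open>xs\<close> with output \<open>y\<close>.\<close>

datatype recf =
    Zero
  | Succ
  | Proj nat
  | Comp recf "recf list"
  | PrimRec recf recf
  | Mu recf

inductive recf_eval :: "recf \<Rightarrow> nat list \<Rightarrow> nat \<Rightarrow> bool" where
  zero: "recf_eval Zero xs 0"
| succ: "recf_eval Succ [x] (Suc x)"
| proj: "i < length xs \<Longrightarrow> recf_eval (Proj i) xs (xs ! i)"
| comp: "\<lbrakk>list_all2 (\<lambda>g y. recf_eval g xs y) gs ys; recf_eval f ys z\<rbrakk>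
    \<Longrightarrow> recf_eval (Comp f gs) xs z"
| primrec_0: "recf_eval f xs y \<Longrightarrow> recf_eval (PrimRec f g) (0 # xs) y"
| primrec_Suc: "\<lbrakk>recf_eval (PrimRec f g) (n # xs) y; recf_eval g (n # y # xs) z\<rbrakk>
    \<Longrightarrow> recf_eval (PrimRec f g) (Suc n # xs) z"
| mu: "\<lbrakk>recf_eval f (n # xs) 0; \<forall>m<n. \<exists>y. recf_eval f (m # xs) (Suc y)\<rbrakk>
    \<Longrightarrow> recf_eval (Mu f) xs n"

lemma recf_eval_deterministic:
  "recf_eval f xs y \<Longrightarrow> recf_eval f xs y' \<Longrightarrow> y' = y"
proof (induction arbitrary: y' rule: recf_eval.induct)
  case (zero xs)
  then show ?case by (auto elim: recf_eval.cases)
next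
  case (succ x)
  then show ?case by (auto elim: recf_eval.cases)
next
  case (proj i xs)
  from proj(2) show ?case by cases auto
next
  case (comp xs gs ys f z)
  from comp.prems obtain ys' where ys': "list_all2 (\<lambda>g y. recf_eval g xs y) gs ys'"
      "recf_eval f ys' y'"
    by cases auto
  have "ys' = ys"
    using comp.IH(1) ys'(1) by (auto simp: list_all2_conv_all_nth intro!: nth_equalityI)
  with ys'(2) comp.IH(2) show ?case by simp
next
  case (primrec_0 f xs y g)
  from primrec_0.prems show ?case by cases (auto dest: primrec_0.IH)
next
  case (primrec_Suc f g n xs y z)
  from primrec_Suc.prems show ?case by cases (use primrec_Suc.IH in blast)
next
  case (mu f n xs)
  from mu.prems show ?case
  proof cases
    case mu': mu
    show ?thesis
    proof (rule linorder_cases[of y' n])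
      assume "y' < n"
      with mu.IH(2) mu'(1) show ?thesis by blast
    next
      assume "n < y'"
      with mu'(2) obtain y where "recf_eval f (n # xs) (Suc y)" by blast
      with mu.IH(1) show ?thesis by blast
    qed
  qed
qed

text \<open>Relative to a numbering \<open>ss\<close> of the simple elements, the letter \<open>Inl i\<close> stands for \<open>ss ! i\<close>
  and \<open>Inr i\<close> for its inverse.\<close>

type_synonym gword = "(nat + nat) list"

definition gwords :: "'a list \<Rightarrow> gword set" where
  "gwords ss = lists ({..<length ss} <+> {..<length ss})"

definition letter_val :: "('a, 'b) monoid_scheme \<Rightarrow> 'a list \<Rightarrow> nat + nat \<Rightarrow> 'a" where
  "letter_val G ss = case_sum (\<lambda>i. ss ! i) (\<lambda>i. inv\<^bsub>G\<^esub> (ss ! i))"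

definition word_val :: "('a, 'b) monoid_scheme \<Rightarrow> 'a list \<Rightarrow> gword \<Rightarrow> 'a" where
  "word_val G ss w = foldr (\<lambda>l x. letter_val G ss l \<otimes>\<^bsub>G\<^esub> x) w \<one>\<^bsub>G\<^esub>"

definition word_tuples :: "'a list \<Rightarrow> nat \<Rightarrow> gword list set" where
  "word_tuples ss r = {ws. set ws \<subseteq> gwords ss \<and> length ws = r}"

definition word_tuple_code :: "gword list \<Rightarrow> nat" where
  "word_tuple_code ws = list_encode (map (\<lambda>w. list_encode (map sum_encode w)) ws)"

definition word_tuple_list_code :: "gword list list \<Rightarrow> nat" where
  "word_tuple_list_code us = list_encode (map word_tuple_code us)"

text \<open>A finite set of tuples is output as a list of word tuples representing its elements;
  an element may be listed more than once, by equal or by different words.\<close>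

definition computes_finite_sets ::
  "('a, 'b) monoid_scheme \<Rightarrow> 'a list \<Rightarrow> nat \<Rightarrow> recf \<Rightarrow> ('a list \<Rightarrow> 'a list set) \<Rightarrow> bool" where
  "computes_finite_sets G ss r f F \<longleftrightarrow>
    (\<forall>ws\<in>word_tuples ss r. \<exists>us. set us \<subseteq> word_tuples ss r \<and>
       recf_eval f [word_tuple_code ws] (word_tuple_list_code us) \<and>
       map (word_val G ss) ` set us = F (map (word_val G ss) ws))"

end

theory Submission
  imports Defs
begin

text \<open>Since \<open>sup a = - inf (inv a)\<close>, the lexicographic super summit set consists of the conjugates
  for which the vector of the infima of the entries and of their inverses is lexicographically
  maximal. The condition \<open>p \<le> inf (inv x a x)\<close> says that \<open>x\<close> lies above its twist \<open>inv a x \<Delta>\<^sup>p\<close>,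
  and twisting is an automorphism of the left divisibility order commuting with right multiplication
  by \<open>\<Delta>\<close>. So the conjugators satisfying finitely many such conditions are closed under joins.

  Three consequences are used. If the twists of the identity lie below \<open>\<Delta>\<close> and some conjugator
  satisfies all conditions, then one below \<open>\<Delta>\<^sup>N\<close> does, where \<open>N\<close> bounds the length of divisor chains of
  \<open>\<Delta>\<close>; hence lexicographic optimality can be tested against a fixed finite set of conjugators, although
  the intermediate intervals are unbounded in their last coordinate. Optimal conjugates are connected
  through conjugations by simple elements. Finally, the summit infimum and the summit supremum are
  attained simultaneously.

  An unbounded search therefore finds a finite list of optimal conjugators that is closed under these
  moves, and any such list enumerates the whole set.\<close>

section \<open>The left divisibility order of a Garside group\<close>

text \<open>A lower bound on the infimum of a conjugate makes the conjugator a pre-fixed point of an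
  order automorphism, its twist. Below a solution one can therefore climb towards a possibly smaller
  one by joining an element with any twist that is not below it, and Noetherianity stops the climb.
  The obstacle is to bound the climb independently of the tuple and of the conjugator. It is
  squeezed between \<open>y \<otimes> D (- 1)\<close> and \<open>y\<close>, whose quotient is
  \<open>\<Delta>\<close> whatever \<open>y\<close> is; hence the constant \<open>N\<close> depends
  only on the Garside structure, and the divisors of \<open>D (int N)\<close> can be built into a
  program once and for all. Computability carries no bound on running time, so it is enough to
  decide whether a candidate list is complete and to know that a complete list exists; neither the
  length of the list nor that of the conjugators needs an estimate.\<close>

lemma (in group) inv_mult_cancel [simp]:
  "x \<in> carrier G \<Longrightarrow> y \<in> carrier G \<Longrightarrow> inv x \<otimes> (x \<otimes> y) = y"
  "x \<in> carrier G \<Longrightarrow> y \<in> carrier G \<Longrightarrow> x \<otimes> (inv x \<otimes> y) = y"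
  by (simp_all flip: m_assoc)

context garside_group
begin

abbreviation P :: "'a set" where "P \<equiv> submonoid_gen G S"

definition prec :: "'a \<Rightarrow> 'a \<Rightarrow> bool" (infix "\<preceq>" 50) where
  "x \<preceq> y \<longleftrightarrow> inv x \<otimes> y \<in> P"

abbreviation D :: "int \<Rightarrow> 'a" where "D m \<equiv> \<Delta> [^] m"

lemma pos_carrier [simp]: "x \<in> P \<Longrightarrow> x \<in> carrier G"
  by (induction rule: submonoid_gen.induct) (use simples_subset in auto)

lemma one_pos [simp]: "\<one> \<in> P"
  by (rule submonoid_gen.one)

lemma pos_mult [simp]: "x \<in> P \<Longrightarrow> y \<in> P \<Longrightarrow> x \<otimes> y \<in> P"
proof (induction rule: submonoid_gen.induct)
  case (mult s x)
  then show ?case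
    using submonoid_gen.mult[of s S "x \<otimes> y"] simples_subset by (simp add: m_assoc subset_iff)
qed simp

lemma simple_pos: "s \<in> S \<Longrightarrow> s \<in> P"
  using simples_divisors by blast

lemma simple_iff: "s \<in> S \<longleftrightarrow> s \<in> P \<and> (\<exists>c\<in>P. \<Delta> = s \<otimes> c)"
  by (subst simples_divisors) (simp add: left_divisor_def)

lemma simple_iff_right: "s \<in> S \<longleftrightarrow> s \<in> P \<and> (\<exists>c\<in>P. \<Delta> = c \<otimes> s)"
  by (subst simples_divisors, subst Delta_balanced) (simp add: right_divisor_def)

lemma Delta_carrier [simp]: "\<Delta> \<in> carrier G"
  using Delta_pos by simp

lemma Delta_simple: "\<Delta> \<in> S"
  unfolding simple_iff using Delta_pos by (auto intro!: bexI[of _ \<one>])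

definition chain_bound :: "'a \<Rightarrow> nat \<Rightarrow> bool" where
  "chain_bound a n \<longleftrightarrow> (\<forall>xs. set xs \<subseteq> P - {\<one>} \<longrightarrow> foldr (\<otimes>) xs \<one> = a \<longrightarrow> length xs \<le> n)"

lemma chain_bound_ex: "a \<in> P \<Longrightarrow> \<exists>n. chain_bound a n"
  using gaussian_monoid.noetherian[OF gaussian]
  unfolding noetherian_monoid_def chain_bound_def by simp

text \<open>Otherwise alternating \<open>x\<close> and \<open>inv x\<close> would give arbitrarily
  long products of nonidentity positive elements with value \<open>\<one>\<close>. This makes
  \<open>\<preceq>\<close> antisymmetric.\<close>

lemma pos_antisym:
  assumes "x \<in> P" "inv x \<in> P"
  shows "x = \<one>"
proof (rule ccontr)
  assume x: "x \<noteq> \<one>"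
  with assms have ix: "inv x \<noteq> \<one>"
    by (metis inv_one inv_inv pos_carrier)
  obtain n where n: "chain_bound \<one> n" using chain_bound_ex one_pos by blast
  define xs where "xs = concat (replicate (Suc n) [x, inv x])"
  have "foldr (\<otimes>) (concat (replicate k [x, inv x])) \<one> = \<one>" for k
    using assms by (induction k) auto
  moreover have "set xs \<subseteq> P - {\<one>}" using assms x ix by (auto simp: xs_def split: if_splits)
  ultimately have "length xs \<le> n" using n unfolding chain_bound_def xs_def by blast
  moreover have "length xs = 2 * Suc n" by (simp add: xs_def length_concat sum_list_replicate)
  ultimately show False by simp
qed

lemma prec_refl [simp]: "x \<in> carrier G \<Longrightarrow> x \<preceq> x"
  by (simp add: prec_def)

lemma prec_trans [trans]:
  assumes "x \<preceq> y" "y \<preceq> z" and c: "x \<in> carrier G" "y \<in> carrier G" "z \<in> carrier G"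
  shows "x \<preceq> z"
proof -
  have "(inv x \<otimes> y) \<otimes> (inv y \<otimes> z) \<in> P" using assms(1,2) unfolding prec_def by (rule pos_mult)
  then show ?thesis using c by (simp add: prec_def m_assoc)
qed

lemma prec_antisym: "x \<preceq> y \<Longrightarrow> y \<preceq> x \<Longrightarrow> x \<in> carrier G \<Longrightarrow> y \<in> carrier G \<Longrightarrow> x = y"
  using pos_antisym[of "inv x \<otimes> y"] unfolding prec_def
  by (metis inv_closed inv_inv inv_mult_group inv_equality m_closed)

lemma prec_mult_left [simp]:
  assumes "x \<in> carrier G" "y \<in> carrier G" "z \<in> carrier G"
  shows "z \<otimes> x \<preceq> z \<otimes> y \<longleftrightarrow> x \<preceq> y"
  using assms by (simp add: prec_def inv_mult_group m_assoc)

lemma one_prec: "x \<in> carrier G \<Longrightarrow> \<one> \<preceq> x \<longleftrightarrow> x \<in> P"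
  by (simp add: prec_def)

lemma prec_mult_pos: "x \<in> carrier G \<Longrightarrow> p \<in> P \<Longrightarrow> x \<preceq> x \<otimes> p"
  by (simp add: prec_def)

lemma prec_obtain:
  assumes "x \<preceq> y" "x \<in> carrier G" "y \<in> carrier G"
  obtains p where "p \<in> P" "y = x \<otimes> p"
  using assms that[of "inv x \<otimes> y"] by (simp add: prec_def)

lemma simple_iff_prec: "s \<in> carrier G \<Longrightarrow> s \<in> S \<longleftrightarrow> \<one> \<preceq> s \<and> s \<preceq> \<Delta>"
  unfolding simple_iff one_prec
  by (metis Delta_carrier one_prec prec_mult_pos prec_obtain)

text \<open>Balancedness makes complements of simple elements simple. From
  \<open>\<Delta> = s \<otimes> c\<close> and \<open>\<Delta> = c \<otimes> d\<close> follows
  \<open>s \<otimes> \<Delta> = \<Delta> \<otimes> d\<close>, so conjugation sends \<open>s\<close>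
  to the simple element \<open>d\<close>; the second claim is the mirror image.\<close>

lemma simple_conj_Delta:
  assumes "s \<in> S"
  shows "inv \<Delta> \<otimes> s \<otimes> \<Delta> \<in> S" "\<Delta> \<otimes> s \<otimes> inv \<Delta> \<in> S"
proof -
  obtain c where c: "c \<in> P" "\<Delta> = s \<otimes> c" using assms simple_iff by blast
  then have "c \<in> S" using simple_iff_right assms simple_pos by blast
  then obtain d where d: "d \<in> P" "\<Delta> = c \<otimes> d" using simple_iff by blast
  then have "d \<in> S" using simple_iff_right c by blast
  have s: "s \<in> carrier G" using assms simple_pos by simp
  have "s \<otimes> \<Delta> = s \<otimes> (c \<otimes> d)" using d by simp
  also have "\<dots> = \<Delta> \<otimes> d" using c d s by (simp add: m_assoc)
  finally have "inv \<Delta> \<otimes> (s \<otimes> \<Delta>) = d" using pos_carrier[OF d(1)] by (metis Delta_carrier inv_mult_cancel(1))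
  then have "inv \<Delta> \<otimes> s \<otimes> \<Delta> = d" using s by (metis Delta_carrier inv_closed m_assoc)
  with \<open>d \<in> S\<close> show "inv \<Delta> \<otimes> s \<otimes> \<Delta> \<in> S" by simp
  obtain c where c: "c \<in> P" "\<Delta> = c \<otimes> s" using assms simple_iff_right by blast
  then have "c \<in> S" using simple_iff assms simple_pos by blast
  then obtain d where d: "d \<in> P" "\<Delta> = d \<otimes> c" using simple_iff_right by blast
  then have "d \<in> S" using simple_iff c by blast
  have "\<Delta> \<otimes> s = (d \<otimes> c) \<otimes> s" using d by simp
  also have "\<dots> = d \<otimes> \<Delta>" using c(1) d(1) s by (subst c(2)) (simp add: m_assoc)
  finally have "\<Delta> \<otimes> s = d \<otimes> \<Delta>" .
  then have "\<Delta> \<otimes> s \<otimes> inv \<Delta> = d" using pos_carrier[OF d(1)] Delta_carrier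
    by (metis inv_closed m_assoc r_inv r_one)
  with \<open>d \<in> S\<close> show "\<Delta> \<otimes> s \<otimes> inv \<Delta> \<in> S" by simp
qed

lemma pos_conj:
  assumes z: "z \<in> carrier G" and s: "\<And>s. s \<in> S \<Longrightarrow> inv z \<otimes> s \<otimes> z \<in> S" and x: "x \<in> P"
  shows "inv z \<otimes> x \<otimes> z \<in> P"
  using x
proof (induction rule: submonoid_gen.induct)
  case (mult t x)
  have t: "t \<in> carrier G" using mult(1) simple_pos by simp
  have "(inv z \<otimes> t \<otimes> z) \<otimes> (inv z \<otimes> x \<otimes> z) \<in> P"
    using mult s simple_pos by auto
  then show ?case using z t mult(2) by (simp add: m_assoc)
qed (use z in simp)

lemma simple_conj_D: "s \<in> S \<Longrightarrow> inv (D m) \<otimes> s \<otimes> D m \<in> S"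
proof (induction m rule: int_induct[where k = 0])
  case base
  then show ?case using simples_subset by auto
next
  case (step1 i)
  have s: "s \<in> carrier G" using step1(3) simples_subset by auto
  from simple_conj_Delta(1)[OF step1(2)[OF step1(3)]] s show ?case
    by (simp add: int_pow_mult inv_mult_group m_assoc)
next
  case (step2 i)
  have s: "s \<in> carrier G" using step2(3) simples_subset by auto
  from simple_conj_Delta(2)[OF step2(2)[OF step2(3)]] s show ?case
    by (simp add: int_pow_diff inv_mult_group m_assoc)
qed

lemma pos_conj_D: "x \<in> P \<Longrightarrow> inv (D m) \<otimes> x \<otimes> D m \<in> P"
  by (rule pos_conj) (auto intro: simple_conj_D)

lemma D_mult: "D (m + n) = D m \<otimes> D n"
  by (simp add: int_pow_mult)

lemma pos_conj_D_iff:
  assumes "x \<in> carrier G"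
  shows "inv (D m) \<otimes> x \<otimes> D m \<in> P \<longleftrightarrow> x \<in> P"
proof
  assume "inv (D m) \<otimes> x \<otimes> D m \<in> P"
  from pos_conj_D[OF this, of "- m"] show "x \<in> P"
    using assms by (simp add: int_pow_neg m_assoc)
qed (rule pos_conj_D)

text \<open>Left invariance is built into \<open>\<preceq>\<close>; on the right it holds for powers
  of \<open>\<Delta>\<close> because conjugation by them preserves \<open>P\<close> in both
  directions.\<close>

lemma prec_mult_D [simp]:
  assumes "x \<in> carrier G" "y \<in> carrier G"
  shows "x \<otimes> D m \<preceq> y \<otimes> D m \<longleftrightarrow> x \<preceq> y"
  using pos_conj_D_iff[of "inv x \<otimes> y" m] assms by (simp add: prec_def inv_mult_group m_assoc)

lemma D_pos: "0 \<le> m \<Longrightarrow> D m \<in> P"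
proof (induction m rule: int_ge_induct)
  case (step i)
  then show ?case using Delta_pos by (simp add: D_mult)
qed simp

lemma prec_D_mono: "m \<le> n \<Longrightarrow> x \<in> carrier G \<Longrightarrow> x \<otimes> D m \<preceq> x \<otimes> D n"
  using D_pos[of "n - m"] prec_mult_pos[of "D m" "D (n - m)"] by (simp flip: D_mult)

lemma D_mono: "m \<le> n \<Longrightarrow> D m \<preceq> D n"
  using prec_D_mono[of m n \<one>] by simp

lemma D_prec_inv_iff:
  assumes "x \<in> carrier G"
  shows "D (- n) \<preceq> inv x \<longleftrightarrow> x \<preceq> D n"
proof -
  have "x \<preceq> D n \<longleftrightarrow> inv (D (- n)) \<otimes> (inv x \<otimes> D n) \<otimes> D (- n) \<in> P"
    using assms by (simp add: prec_def pos_conj_D_iff del: int_pow_neg)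
  also have "\<dots> \<longleftrightarrow> D (- n) \<preceq> inv x"
    using assms by (simp add: prec_def m_assoc int_pow_neg)
  finally show ?thesis by simp
qed

lemma pos_bounded: "x \<in> P \<Longrightarrow> \<exists>n. x \<preceq> D n"
proof (induction rule: submonoid_gen.induct)
  case one
  show ?case by (rule exI[of _ 0]) simp
next
  case (mult s x)
  then obtain n where n: "x \<preceq> D n" by blast
  have s: "s \<in> carrier G" using mult(1) simple_pos by simp
  have "inv (D n) \<otimes> s \<otimes> D n \<in> S" using mult(1) by (rule simple_conj_D)
  then have "inv (D n) \<otimes> s \<otimes> D n \<preceq> \<Delta>"
    using s simple_iff_prec by auto
  then have "D n \<otimes> (inv (D n) \<otimes> s \<otimes> D n) \<preceq> D n \<otimes> \<Delta>"
    using s by simp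
  then have "s \<otimes> D n \<preceq> D (n + 1)" using s by (simp add: m_assoc D_mult)
  moreover have "s \<otimes> x \<preceq> s \<otimes> D n" using s n mult(2) by simp
  ultimately have "s \<otimes> x \<preceq> D (n + 1)" using s mult(2) prec_trans[of "s \<otimes> x" "s \<otimes> D n" "D (n + 1)"] by simp
  then show ?case by blast
qed

text \<open>In a fraction \<open>a \<otimes> inv b\<close>, completing \<open>b\<close> to
  \<open>D n = b \<otimes> c\<close> turns \<open>inv b\<close> into
  \<open>c \<otimes> D (- n)\<close>, and this power can be moved to the left end.\<close>

lemma bounded_below:
  assumes "x \<in> carrier G"
  shows "\<exists>m. D m \<preceq> x"
proof -
  obtain a b where ab: "a \<in> P" "b \<in> P" "x = a \<otimes> inv b" using assms fractions by auto
  obtain n where n: "b \<preceq> D n" using pos_bounded ab by blast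
  then obtain c where c: "c \<in> P" "D n = b \<otimes> c" using ab by (auto elim: prec_obtain)
  then have "inv b = c \<otimes> inv (D n)" using ab by (simp add: m_assoc inv_mult_group)
  then have x: "x = (a \<otimes> c) \<otimes> D (- n)" using ab c by (simp add: int_pow_neg m_assoc)
  have "inv (D (- n)) \<otimes> (a \<otimes> c) \<otimes> D (- n) \<in> P" using ab c by (intro pos_conj_D) simp
  then have "D (- n) \<preceq> x" using ab c by (simp add: x prec_def m_assoc)
  then show ?thesis by blast
qed

lemma bounded_above: "x \<in> carrier G \<Longrightarrow> \<exists>n. x \<preceq> D n"
  using bounded_below[of "inv x"] D_prec_inv_iff[of x "- m" for m] by (metis inv_closed minus_minus)

lemma prec_D_shift:
  assumes "x \<in> carrier G" "y \<in> carrier G"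
  shows "\<exists>k\<ge>0. x \<preceq> y \<otimes> D k"
proof -
  obtain m where m: "D m \<preceq> y" using bounded_below assms by blast
  obtain n where n: "x \<preceq> D n" using bounded_above assms by blast
  have "D m \<otimes> D (max 0 (n - m)) \<preceq> y \<otimes> D (max 0 (n - m))" using m assms by simp
  moreover have "D n \<preceq> D m \<otimes> D (max 0 (n - m))" using D_mono[of n "m + max 0 (n - m)"] by (simp add: D_mult)
  ultimately have "x \<preceq> y \<otimes> D (max 0 (n - m))"
    using n assms by (meson prec_trans int_pow_closed m_closed Delta_carrier)
  then show ?thesis by (intro exI[of _ "max 0 (n - m)"]) simp
qed

definition is_lub :: "'a \<Rightarrow> 'a \<Rightarrow> 'a \<Rightarrow> bool" where
  "is_lub x y z \<longleftrightarrow> z \<in> carrier G \<and> x \<preceq> z \<and> y \<preceq> z \<and> (\<forall>u\<in>carrier G. x \<preceq> u \<longrightarrow> y \<preceq> u \<longrightarrow> z \<preceq> u)"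

lemma left_divisor_iff_prec: "a \<in> P \<Longrightarrow> b \<in> P \<Longrightarrow> left_divisor (pos_monoid G S) a b \<longleftrightarrow> a \<preceq> b"
  by (auto simp: left_divisor_def prec_mult_pos elim: prec_obtain)

text \<open>Lcms are given only inside the monoid. A power of \<open>\<Delta>\<close> below both
  elements translates them into it, and left invariance carries the lcm back.\<close>

lemma lub_ex:
  assumes x: "x \<in> carrier G" and y: "y \<in> carrier G"
  shows "\<exists>z. is_lub x y z"
proof -
  obtain m n where m: "D m \<preceq> x" and n: "D n \<preceq> y" using bounded_below assms by meson
  let ?w = "D (min m n)"
  have w: "?w \<preceq> x" "?w \<preceq> y"
    using m n prec_trans[OF D_mono[of "min m n" m]] prec_trans[OF D_mono[of "min m n" n]] assms by simp_all
  obtain a where a: "a \<in> P" "x = ?w \<otimes> a" using w(1) x by (auto elim: prec_obtain)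
  obtain b where b: "b \<in> P" "y = ?w \<otimes> b" using w(2) y by (auto elim: prec_obtain)
  obtain c where "is_right_lcm (pos_monoid G S) a b c"
    using gaussian_monoid.right_lcm_ex[OF gaussian] a b by auto
  then have c: "c \<in> P" "a \<preceq> c" "b \<preceq> c" "\<And>u. u \<in> P \<Longrightarrow> a \<preceq> u \<Longrightarrow> b \<preceq> u \<Longrightarrow> c \<preceq> u"
    using a b by (auto simp: is_right_lcm_def left_divisor_iff_prec)
  have "is_lub x y (?w \<otimes> c)"
    unfolding is_lub_def
  proof (intro conjI ballI impI)
    fix u assume u: "u \<in> carrier G" "x \<preceq> u" "y \<preceq> u"
    then have "?w \<preceq> u" using w x prec_trans[of ?w x u] by simp
    then obtain v where v: "v \<in> P" "u = ?w \<otimes> v" using u by (auto elim: prec_obtain)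
    with u a b c show "?w \<otimes> c \<preceq> u" by simp
  qed (use a b c in simp_all)
  then show ?thesis by blast
qed

end

section \<open>Conjugation and the infimum\<close>

context garside_group
begin

text \<open>A positive left factor passes a power of \<open>\<Delta>\<close> as a conjugate, which
  is again positive, so the two-sided relation collapses to left divisibility.\<close>

lemma garside_le_D_left:
  assumes a: "a \<in> carrier G"
  shows "garside_le G S (D m) a \<longleftrightarrow> D m \<preceq> a"
proof
  assume "garside_le G S (D m) a"
  then obtain c c' where c: "c \<in> P" "c' \<in> P" "a = c \<otimes> D m \<otimes> c'" unfolding garside_le_def by blast
  then have "inv (D m) \<otimes> c \<otimes> D m \<otimes> c' \<in> P" using pos_conj_D by simp
  then show "D m \<preceq> a" using c by (simp add: prec_def m_assoc)
next
  assume "D m \<preceq> a"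
  then obtain p where "p \<in> P" "a = D m \<otimes> p" using a by (auto elim: prec_obtain)
  then show "garside_le G S (D m) a" unfolding garside_le_def by (intro bexI[of _ \<one>] bexI[of _ p]) simp_all
qed

lemma garside_le_D_right:
  assumes a: "a \<in> carrier G"
  shows "garside_le G S a (D n) \<longleftrightarrow> a \<preceq> D n"
proof
  assume "garside_le G S a (D n)"
  then obtain c c' where c: "c \<in> P" "c' \<in> P" "D n = c \<otimes> a \<otimes> c'" unfolding garside_le_def by blast
  then have "inv a \<otimes> D n = c' \<otimes> (inv (D n) \<otimes> c \<otimes> D n)"
    using a by (simp add: m_assoc inv_mult_group)
  also have "\<dots> \<in> P" using c(2) pos_conj_D[OF c(1)] by (rule pos_mult)
  finally show "a \<preceq> D n" by (simp add: prec_def)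
next
  assume "a \<preceq> D n"
  then obtain p where "p \<in> P" "D n = a \<otimes> p" using a by (auto elim: prec_obtain)
  then show "garside_le G S a (D n)" using a unfolding garside_le_def
    by (intro bexI[of _ \<one>] bexI[of _ p]) simp_all
qed

section \<open>Conjugators as common pre-fixed points of twists\<close>

lemma D_prec_conj_iff:
  assumes "x \<in> carrier G" "a \<in> carrier G"
  shows "D p \<preceq> inv x \<otimes> a \<otimes> x \<longleftrightarrow> inv a \<otimes> x \<otimes> D p \<preceq> x"
  using assms by (simp add: prec_def inv_mult_group m_assoc)

lemma twist_prec_iff:
  assumes "x \<in> carrier G" "a \<in> carrier G" "u \<in> carrier G"
  shows "inv a \<otimes> x \<otimes> D p \<preceq> u \<longleftrightarrow> x \<preceq> a \<otimes> u \<otimes> D (- p)"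
proof -
  have "x \<preceq> a \<otimes> u \<otimes> D (- p) \<longleftrightarrow> inv a \<otimes> (x \<otimes> D p) \<preceq> inv a \<otimes> (a \<otimes> u \<otimes> D (- p) \<otimes> D p)"
    using assms by (simp del: inv_mult_cancel)
  then show ?thesis using assms by (simp add: m_assoc int_pow_neg)
qed



text \<open>A pair \<open>(a, p)\<close> is the demand that the conjugate of \<open>a\<close> have
  infimum at least \<open>p\<close>. It is phrased by divisibility, so that it has its meaning also
  for trivial \<open>\<Delta>\<close>, where \<open>garside_inf\<close> is unspecified.\<close>

definition lifts :: "('a \<times> int) set \<Rightarrow> 'a set" where
  "lifts Q = {x \<in> carrier G. \<forall>(a, p)\<in>Q. D p \<preceq> inv x \<otimes> a \<otimes> x}"

lemma lifts_iff:
  assumes "Q \<subseteq> carrier G \<times> UNIV"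
  shows "x \<in> lifts Q \<longleftrightarrow> x \<in> carrier G \<and> (\<forall>(a, p)\<in>Q. inv a \<otimes> x \<otimes> D p \<preceq> x)"
  using assms D_prec_conj_iff unfolding lifts_def by blast

lemma is_lub_lifts:
  assumes Q: "Q \<subseteq> carrier G \<times> UNIV" and x: "x \<in> lifts Q" and y: "y \<in> lifts Q" and z: "is_lub x y z"
  shows "z \<in> lifts Q"
  unfolding lifts_iff[OF Q]
proof (intro conjI ballI, safe)
  show zc: "z \<in> carrier G" using z by (simp add: is_lub_def)
  fix a p assume ap: "(a, p) \<in> Q"
  then have c: "a \<in> carrier G" "x \<in> carrier G" "y \<in> carrier G" using Q x y by (auto simp: lifts_def)
  have "inv a \<otimes> x \<otimes> D p \<preceq> x" "inv a \<otimes> y \<otimes> D p \<preceq> y" "x \<preceq> z" "y \<preceq> z"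
    using x y z ap unfolding lifts_iff[OF Q] by (auto simp: is_lub_def)
  then have "inv a \<otimes> x \<otimes> D p \<preceq> z" "inv a \<otimes> y \<otimes> D p \<preceq> z"
    using c zc prec_trans[of "inv a \<otimes> x \<otimes> D p" x z] prec_trans[of "inv a \<otimes> y \<otimes> D p" y z] by simp_all
  \<comment> \<open>The inverse twist of \<open>z\<close> is an upper bound of \<open>x\<close> and
    \<open>y\<close>, hence lies above their join \<open>z\<close>.\<close>
  then have "x \<preceq> a \<otimes> z \<otimes> D (- p)" "y \<preceq> a \<otimes> z \<otimes> D (- p)"
    using c zc twist_prec_iff by simp_all
  then have "z \<preceq> a \<otimes> z \<otimes> D (- p)" using z c zc by (simp add: is_lub_def)
  then show "inv a \<otimes> z \<otimes> D p \<preceq> z" using twist_prec_iff c zc by simp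
qed

lemma D_commute: "D m \<otimes> D n = D n \<otimes> D m"
  by (simp add: add.commute flip: D_mult)

lemma lifts_shift:
  assumes Q: "Q \<subseteq> carrier G \<times> UNIV" and x: "x \<in> lifts Q"
  shows "x \<otimes> D k \<in> lifts Q"
  unfolding lifts_iff[OF Q]
proof (intro conjI ballI, safe)
  have c: "x \<in> carrier G" using x by (simp add: lifts_def)
  then show "x \<otimes> D k \<in> carrier G" by simp
  fix a p assume ap: "(a, p) \<in> Q"
  then have a: "a \<in> carrier G" using Q by blast
  have "inv a \<otimes> x \<otimes> D p \<preceq> x" using x ap unfolding lifts_iff[OF Q] by blast
  then have "(inv a \<otimes> x \<otimes> D p) \<otimes> D k \<preceq> x \<otimes> D k" using a c by simp
  then show "inv a \<otimes> (x \<otimes> D k) \<otimes> D p \<preceq> x \<otimes> D k" using a c D_commute[of k p] by (simp add: m_assoc)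
qed

lemma foldr_mult: "set xs \<subseteq> carrier G \<Longrightarrow> z \<in> carrier G \<Longrightarrow> foldr (\<otimes>) xs z = foldr (\<otimes>) xs \<one> \<otimes> z
    \<and> foldr (\<otimes>) xs z \<in> carrier G"
proof (induction xs)
  case (Cons x xs)
  have "foldr (\<otimes>) xs \<one> \<in> carrier G" using Cons(2) by (induction xs) auto
  with Cons show ?case by (simp add: m_assoc)
qed simp

text \<open>A factorisation of the middle factor extends to one of the whole product. Outer factors
  equal to \<open>\<one>\<close> are dropped, since only nonidentity factors are counted.\<close>

lemma chain_bound_factor:
  assumes "chain_bound (b \<otimes> c \<otimes> d) n" "b \<in> P" "c \<in> P" "d \<in> P"
  shows "chain_bound c n"
  unfolding chain_bound_def
proof (intro allI impI)
  fix xs assume xs: "set xs \<subseteq> P - {\<one>}" "foldr (\<otimes>) xs \<one> = c"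
  let ?l = "\<lambda>b. if b = \<one> then [] else [b]"
  have 1: "set xs \<subseteq> carrier G" using xs(1) pos_carrier by blast
  have "foldr (\<otimes>) xs d = c \<otimes> d"
    using foldr_mult[OF 1, of d] xs(2) assms(4) by simp
  then have "foldr (\<otimes>) (?l b @ xs @ ?l d) \<one> = b \<otimes> c \<otimes> d"
    using assms xs(2) by (auto simp: m_assoc)
  moreover have "set (?l b @ xs @ ?l d) \<subseteq> P - {\<one>}" using assms xs by auto
  ultimately have "length (?l b @ xs @ ?l d) \<le> n"
    using assms(1) unfolding chain_bound_def by blast
  then show "length xs \<le> n" by simp
qed

text \<open>Quotients of successive elements are nonidentity factors of
  \<open>inv u \<otimes> y\<close>, so at most \<open>N\<close> strict increases fit between
  \<open>u\<close> and \<open>y\<close>. The invariant carries the step number because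
  \<open>lifts_shorten\<close> maintains a bound that grows with it.\<close>

lemma ascending_chain_stops:
  assumes bound: "chain_bound (inv u \<otimes> y) N" and u: "u \<in> carrier G" and y: "y \<in> carrier G"
    and start: "I 0 q0"
    and inv: "\<And>n q. I n q \<Longrightarrow> q \<in> carrier G \<and> u \<preceq> q \<and> q \<preceq> y"
    and step: "\<And>n q. I n q \<Longrightarrow> q \<notin> A \<Longrightarrow> \<exists>q'. I (Suc n) q' \<and> q \<preceq> q' \<and> q \<noteq> q'"
  shows "\<exists>n\<le>N. \<exists>q. I n q \<and> q \<in> A"
proof (rule ccontr)
  assume none: "\<not> ?thesis"
  have q0: "q0 \<in> carrier G" "u \<preceq> q0" using inv[OF start] by auto
  have "\<exists>q xs. I n q \<and> q0 \<preceq> q \<and> set xs \<subseteq> P - {\<one>} \<and> length xs = n \<and> foldr (\<otimes>) xs \<one> = inv q0 \<otimes> q"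
    if "n \<le> Suc N" for n
    using that
  proof (induction n)
    case 0
    show ?case using start q0 by (intro exI[of _ q0] exI[of _ "[]"]) simp
  next
    case (Suc n)
    then obtain q xs where q: "I n q" "q0 \<preceq> q" "set xs \<subseteq> P - {\<one>}" "length xs = n"
        "foldr (\<otimes>) xs \<one> = inv q0 \<otimes> q" by auto
    with none Suc have "q \<notin> A" by auto
    with q step obtain q' where q': "I (Suc n) q'" "q \<preceq> q'" "q \<noteq> q'" by blast
    have c: "q \<in> carrier G" "q' \<in> carrier G" using q q' inv by blast+
    have p: "inv q \<otimes> q' \<in> P" "inv q \<otimes> q' \<noteq> \<one>" using q' c
      by (auto simp: prec_def) (metis inv_closed inv_equality inv_inv l_inv r_one m_closed inv_mult_cancel(2))
    have "set xs \<subseteq> carrier G" using q(3) pos_carrier by blast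
    then have "foldr (\<otimes>) (xs @ [inv q \<otimes> q']) \<one> = inv q0 \<otimes> q'"
      using foldr_mult[of xs "inv q \<otimes> q'"] q c q0 by (simp add: m_assoc)
    moreover have "q0 \<preceq> q'" using q q' c q0 prec_trans[of q0 q q'] by simp
    ultimately show ?case using q q' p by (intro exI[of _ q'] exI[of _ "xs @ [inv q \<otimes> q']"]) simp
  qed
  from this[of "Suc N"] obtain q xs where q: "I (Suc N) q" "q0 \<preceq> q" "set xs \<subseteq> P - {\<one>}"
    "length xs = Suc N" "foldr (\<otimes>) xs \<one> = inv q0 \<otimes> q" by auto
  have c: "q \<in> carrier G" "q \<preceq> y" using inv[OF q(1)] by auto
  have "(inv u \<otimes> q0) \<otimes> (inv q0 \<otimes> q) \<otimes> (inv q \<otimes> y) = inv u \<otimes> y"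
    using c q0 u y by (simp add: m_assoc)
  then have "chain_bound (inv q0 \<otimes> q) N"
    using bound c q q0 chain_bound_factor[of "inv u \<otimes> q0" "inv q0 \<otimes> q" "inv q \<otimes> y"]
    by (simp add: prec_def)
  with q show False unfolding chain_bound_def by fastforce
qed

lemma lub_prec:
  "is_lub x y z \<Longrightarrow> u \<in> carrier G \<Longrightarrow> x \<preceq> u \<Longrightarrow> y \<preceq> u \<Longrightarrow> z \<preceq> u"
  by (simp add: is_lub_def)

text \<open>The twists by \<open>a\<close> and by \<open>inv a\<close> commute, so repeatedly joining an element that lifts
  \<open>inv a\<close> with its twist by \<open>a\<close> does not leave the lifts of \<open>inv a\<close>.\<close>

lemma lifts_inv_meet:
  assumes a: "a \<in> carrier G" and x: "x \<in> lifts {(a, p)}" and y: "y \<in> lifts {(inv a, r)}"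
  shows "lifts {(a, p), (inv a, r)} \<noteq> {}"
proof -
  have Q: "{(a, p)} \<subseteq> carrier G \<times> UNIV" "{(inv a, r)} \<subseteq> carrier G \<times> UNIV" using a by auto
  have c: "x \<in> carrier G" "y \<in> carrier G" using x y by (auto simp: lifts_def)
  \<comment> \<open>A shifted copy of \<open>x\<close> above \<open>y\<close> is the ceiling of the
    climb: it meets the demand on \<open>a\<close>, so the joins stay below it.\<close>
  then obtain k where k: "y \<preceq> x \<otimes> D k" using prec_D_shift by blast
  define x' where "x' = x \<otimes> D k"
  have x': "x' \<in> lifts {(a, p)}" "x' \<in> carrier G" "y \<preceq> x'"
    using k lifts_shift[OF Q(1) x] c by (auto simp: x'_def)
  obtain N where N: "chain_bound (inv y \<otimes> x') N"
    using chain_bound_ex x' by (auto simp: prec_def)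
  let ?I = "\<lambda>n::nat. \<lambda>q. q \<in> lifts {(inv a, r)} \<and> y \<preceq> q \<and> q \<preceq> x'"
  have "\<exists>n\<le>N. \<exists>q. ?I n q \<and> q \<in> lifts {(a, p)}"
  proof (rule ascending_chain_stops[OF N c(2) x'(2)])
    show "?I 0 y" using y x' c by simp
  next
    fix n q assume "?I n q"
    then show "q \<in> carrier G \<and> y \<preceq> q \<and> q \<preceq> x'" by (auto simp: lifts_def)
  next
    fix n q assume q: "?I n q" and nq: "q \<notin> lifts {(a, p)}"
    then have qc: "q \<in> carrier G" by (auto simp: lifts_def)
    let ?t = "inv a \<otimes> q \<otimes> D p"
    have nt: "\<not> ?t \<preceq> q" using nq qc by (auto simp: lifts_iff[OF Q(1)])
    obtain z where z: "is_lub q ?t z" using lub_ex qc a by (meson inv_closed int_pow_closed m_closed Delta_carrier)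
    have zc: "z \<in> carrier G" "q \<preceq> z" "?t \<preceq> z" using z by (auto simp: is_lub_def)
    have "inv (inv a) \<otimes> q \<otimes> D r \<preceq> q" using q by (auto simp: lifts_iff[OF Q(2)])
    then have "inv a \<otimes> (inv (inv a) \<otimes> q \<otimes> D r) \<otimes> D p \<preceq> ?t" using a qc by (simp del: inv_inv inv_mult_cancel)
    then have "inv (inv a) \<otimes> ?t \<otimes> D r \<preceq> ?t" using a qc D_commute[of r p] by (simp add: m_assoc)
    then have "?t \<in> lifts {(inv a, r)}" using a qc by (simp add: lifts_iff[OF Q(2)])
    then have 1: "z \<in> lifts {(inv a, r)}" using is_lub_lifts[OF Q(2)] q z by blast
    have "?t \<preceq> inv a \<otimes> x' \<otimes> D p" using q a qc x'(2) by (simp add: m_assoc)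
    moreover have "inv a \<otimes> x' \<otimes> D p \<preceq> x'" using x' by (auto simp: lifts_iff[OF Q(1)])
    ultimately have "?t \<preceq> x'" using prec_trans[of ?t "inv a \<otimes> x' \<otimes> D p" x'] a qc x' by simp
    then have 2: "z \<preceq> x'" using lub_prec[OF z] q x' by blast
    have "y \<preceq> z" using q zc c qc prec_trans[of y q z] by simp
    with 1 2 zc nt show "\<exists>q'. ?I (Suc n) q' \<and> q \<preceq> q' \<and> q \<noteq> q'" by blast
  qed
  then show ?thesis by (auto simp: lifts_def)
qed

text \<open>The climb starts at the join of \<open>\<one>\<close> and
  \<open>y \<otimes> D (- 1)\<close> and stays below \<open>y\<close>; the quotient of these bounds
  is \<open>\<Delta>\<close>, so \<open>N\<close> joins suffice however long \<open>y\<close> is.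
  The hypothesis \<open>small\<close> means that a twist raises a power of \<open>\<Delta>\<close>
  by at most one, which keeps the result below \<open>D k\<close>.\<close>

lemma lifts_shorten:
  assumes Q: "Q \<subseteq> carrier G \<times> UNIV" and small: "\<And>a p. (a, p) \<in> Q \<Longrightarrow> D (p - 1) \<preceq> a"
    and N: "chain_bound \<Delta> N" and Nk: "int N \<le> k"
    and y: "y \<in> lifts Q" "y \<in> P" "y \<preceq> D (k + 1)"
  shows "\<exists>x\<in>lifts Q. x \<in> P \<and> x \<preceq> D k"
proof -
  let ?u = "y \<otimes> D (- 1)"
  have yc: "y \<in> carrier G" "?u \<in> carrier G" using y by auto
  have uy: "inv ?u \<otimes> y = \<Delta>" using yc by (simp add: inv_mult_group m_assoc int_pow_neg)
  obtain q0 where q0: "is_lub \<one> ?u q0" using lub_ex yc one_closed by blast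
  \<comment> \<open>The last clause says that \<open>q\<close> lies below the join of
    \<open>D (int n)\<close> and \<open>?u\<close>, without naming that join.\<close>
  let ?I = "\<lambda>n. \<lambda>q. q \<in> carrier G \<and> \<one> \<preceq> q \<and> ?u \<preceq> q \<and> q \<preceq> y \<and>
    (\<forall>z\<in>carrier G. D (int n) \<preceq> z \<longrightarrow> ?u \<preceq> z \<longrightarrow> q \<preceq> z)"
  have "?u \<preceq> y" using prec_D_mono[of "- 1" 0 y] yc by simp
  have "\<exists>n\<le>N. \<exists>q. ?I n q \<and> q \<in> lifts Q"
  proof (rule ascending_chain_stops[where u = ?u and y = y])
    show "?I 0 q0" using q0 y yc \<open>?u \<preceq> y\<close> by (simp add: is_lub_def one_prec)
  next
    fix n q assume I: "?I n q" and nq: "q \<notin> lifts Q"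
    then obtain a p where ap: "(a, p) \<in> Q" and nt: "\<not> inv a \<otimes> q \<otimes> D p \<preceq> q"
      unfolding lifts_iff[OF Q] by auto
    let ?t = "\<lambda>q. inv a \<otimes> q \<otimes> D p"
    have a: "a \<in> carrier G" using Q ap by blast
    have qc: "q \<in> carrier G" using I by simp
    obtain z where z: "is_lub q (?t q) z" using lub_ex qc a by (meson inv_closed int_pow_closed m_closed Delta_carrier)
    have zc: "z \<in> carrier G" "q \<preceq> z" "?t q \<preceq> z" using z by (auto simp: is_lub_def)
    have ty: "?t y \<preceq> y" using y(1) ap unfolding lifts_iff[OF Q] by auto
    have "?t q \<preceq> ?t y" using I a yc by (simp add: m_assoc)
    then have "?t q \<preceq> y" using ty prec_trans[of "?t q" "?t y" y] a qc yc by simp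
    then have "z \<preceq> y" using lub_prec[OF z] I yc by blast
    moreover have "\<one> \<preceq> z" "?u \<preceq> z"
      using I zc yc prec_trans[of \<one> q z] prec_trans[of ?u q z] by simp_all
    moreover have "z \<preceq> v" if v: "v \<in> carrier G" "D (int (Suc n)) \<preceq> v" "?u \<preceq> v" for v
    proof (rule lub_prec[OF z v(1)])
      have "D (int n) \<preceq> v" using D_mono[of "int n" "int (Suc n)"] v prec_trans[of "D (int n)" "D (int (Suc n))" v] by simp
      then show "q \<preceq> v" using I v by blast
      \<comment> \<open>\<open>?v\<close> is the inverse twist of \<open>v\<close>, so bounding the
        twist of \<open>q\<close> by \<open>v\<close> amounts to bounding \<open>q\<close> by
        \<open>?v\<close>. By the invariant it suffices that \<open>D (int n)\<close> and
        \<open>?u\<close> lie below \<open>?v\<close>.\<close>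
      let ?v = "a \<otimes> v \<otimes> D (- p)"
      have vc: "?v \<in> carrier G" using a v by simp
      have "D (p - 1) \<preceq> a" using small ap by blast
      then have *: "D (p - 1) \<otimes> D (1 - p) \<preceq> a \<otimes> D (1 - p)" using a by simp
      have eq: "D (p - 1) \<otimes> D (1 - p) = \<one>" "D (1 - p) = D 1 \<otimes> D (- p)"
        using D_mult[of "p - 1" "1 - p"] D_mult[of 1 "- p"] by simp_all
      have "\<one> \<preceq> a \<otimes> D (1 - p)" using * unfolding eq(1) .
      then have "\<one> \<preceq> a \<otimes> D 1 \<otimes> D (- p)" unfolding eq(2) using a by (simp add: m_assoc)
      \<comment> \<open>The twist of \<open>\<one>\<close> lies below \<open>\<Delta>\<close>; right
        multiplication by \<open>D (int n)\<close> then gives the passage from \<open>n\<close> to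
        \<open>Suc n\<close>.\<close>
      then have "inv a \<otimes> D p \<preceq> D 1" using twist_prec_iff[of \<one> a "D 1" p] a by simp
      then have "(inv a \<otimes> D p) \<otimes> D (int n) \<preceq> D 1 \<otimes> D (int n)" using a by simp
      then have "?t (D (int n)) \<preceq> D (int (Suc n))" using a D_commute[of "int n" p] D_mult[of 1 "int n"]
        by (simp add: m_assoc)
      then have "?t (D (int n)) \<preceq> v" using a v prec_trans[of "?t (D (int n))" "D (int (Suc n))" v] by simp
      then have 1: "D (int n) \<preceq> ?v" using twist_prec_iff a v by simp
      have "?t y \<otimes> D (- 1) \<preceq> y \<otimes> D (- 1)" using ty a yc by simp
      then have "?t ?u \<preceq> ?u" using a yc D_commute[of "- 1" p] y(2) by (simp add: m_assoc)
      then have "?t ?u \<preceq> v" using a v yc prec_trans[of "?t ?u" ?u v] by simp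
      then have "?u \<preceq> ?v" using twist_prec_iff a v yc by simp
      with 1 I vc have "q \<preceq> ?v" by blast
      then show "?t q \<preceq> v" using twist_prec_iff a v qc by simp
    qed
    ultimately show "\<exists>q'. ?I (Suc n) q' \<and> q \<preceq> q' \<and> q \<noteq> q'" using zc nt by blast
  qed (use N uy yc in auto)
  then obtain n q where n: "n \<le> N" and q: "?I n q" "q \<in> lifts Q" by blast
  have "y \<otimes> D (- 1) \<preceq> D (k + 1) \<otimes> D (- 1)" using y yc by simp
  then have "?u \<preceq> D k" by (simp flip: D_mult)
  moreover have "D (int n) \<preceq> D k" using n Nk by (intro D_mono) simp
  ultimately have "q \<preceq> D k" using q by simp
  with q show ?thesis using one_prec by blast
qed

text \<open>A power of \<open>\<Delta>\<close> moves any solution into \<open>P\<close>, and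
  repeated shortening brings it below \<open>D (int N)\<close>. The bound depends neither on
  \<open>Q\<close> nor on \<open>y\<close>.\<close>

lemma lifts_bounded_witness:
  assumes Q: "Q \<subseteq> carrier G \<times> UNIV" and small: "\<And>a p. (a, p) \<in> Q \<Longrightarrow> D (p - 1) \<preceq> a"
    and N: "chain_bound \<Delta> N" and y: "y \<in> lifts Q"
  shows "\<exists>x\<in>lifts Q. x \<in> P \<and> x \<preceq> D (int N)"
proof -
  have yc: "y \<in> carrier G" using y by (simp add: lifts_def)
  obtain j where "\<one> \<preceq> y \<otimes> D j" using prec_D_shift yc one_closed by blast
  then have y': "y \<otimes> D j \<in> P" "y \<otimes> D j \<in> lifts Q" using yc lifts_shift[OF Q y] by (simp_all add: one_prec)
  obtain m where m: "y \<otimes> D j \<preceq> D m" using bounded_above yc by force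
  \<comment> \<open>Induction on the excess over \<open>N\<close>, as \<open>lifts_shorten\<close>
    applies only from \<open>N\<close> upwards.\<close>
  have "\<exists>x\<in>lifts Q. x \<in> P \<and> x \<preceq> D (int N)" if "y \<in> lifts Q" "y \<in> P" "y \<preceq> D (int (N + k))" for k y
    using that
  proof (induction k arbitrary: y)
    case (Suc k)
    then have "y \<preceq> D (int (N + k) + 1)" by (simp add: add.commute)
    then obtain x where "x \<in> lifts Q" "x \<in> P" "x \<preceq> D (int (N + k))"
      using lifts_shorten[OF Q small N _ Suc(2,3), of "int (N + k)"] by auto
    then show ?case using Suc(1) by blast
  qed auto
  moreover have "y \<otimes> D j \<preceq> D (int (N + nat m))"
    using m D_mono[of m "int (N + nat m)"] prec_trans[of "y \<otimes> D j" "D m" "D (int (N + nat m))"] yc by simp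
  ultimately show ?thesis using y' by blast
qed

text \<open>The witness is the join of \<open>\<one>\<close> and \<open>x \<otimes> D (- k)\<close>.
  Both meet the demands, so the join does; both lie below \<open>\<Delta>\<close> and below
  \<open>x\<close>, so it is a simple divisor of \<open>x\<close>; and as it dominates
  \<open>x \<otimes> D (- k)\<close>, the cofactor lies below \<open>D k\<close>.\<close>

lemma lifts_split:
  assumes Q: "Q \<subseteq> carrier G \<times> UNIV" and one: "\<one> \<in> lifts Q"
    and x: "x \<in> lifts Q" "x \<in> P" "x \<preceq> D (k + 1)" and k: "0 \<le> k"
  shows "\<exists>s\<in>S. s \<in> lifts Q \<and> (\<exists>x'\<in>P. x = s \<otimes> x' \<and> x' \<preceq> D k)"
proof -
  let ?u = "x \<otimes> D (- k)"
  have xc: "x \<in> carrier G" "?u \<in> carrier G" using x by auto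
  obtain s where s: "is_lub \<one> ?u s" using lub_ex xc one_closed by blast
  have sc: "s \<in> carrier G" "\<one> \<preceq> s" "?u \<preceq> s" using s by (auto simp: is_lub_def)
  have "?u \<preceq> x" using prec_D_mono[of "- k" 0 x] xc k by simp
  then have "s \<preceq> x" using lub_prec[OF s] x xc by (simp add: one_prec)
  have "?u \<preceq> D (k + 1) \<otimes> D (- k)" using x xc by simp
  then have "?u \<preceq> \<Delta>" by (simp flip: D_mult)
  then have "s \<preceq> \<Delta>" using lub_prec[OF s] Delta_pos by (simp add: one_prec)
  then have "s \<in> S" using sc simple_iff_prec by blast
  moreover have "s \<in> lifts Q" using is_lub_lifts[OF Q one lifts_shift[OF Q x(1)] s] .
  moreover have "?u \<otimes> D k \<preceq> s \<otimes> D k" using sc xc by simp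
  then have "x \<preceq> s \<otimes> D k" using xc by (simp add: m_assoc int_pow_neg)
  then have "s \<otimes> (inv s \<otimes> x) \<preceq> s \<otimes> D k" using sc xc by simp
  then have "inv s \<otimes> x \<preceq> D k" using sc xc by (simp del: inv_mult_cancel)
  moreover have "inv s \<otimes> x \<in> P" "x = s \<otimes> (inv s \<otimes> x)" using \<open>s \<preceq> x\<close> sc xc by (simp_all add: prec_def)
  ultimately show ?thesis by blast
qed

lemma lifts_empty: "lifts {} = carrier G"
  by (simp add: lifts_def)

lemma finite_divisors: "finite {x \<in> P. x \<preceq> D (int k)}"
proof (induction k)
  case 0
  have "{x \<in> P. x \<preceq> D (int 0)} \<subseteq> {\<one>}"
    using prec_antisym one_prec by auto
  then show ?case using finite_subset by blast
next
  case (Suc k)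
  have "{x \<in> P. x \<preceq> D (int (Suc k))} \<subseteq> (\<lambda>(s, x). s \<otimes> x) ` (S \<times> {x \<in> P. x \<preceq> D (int k)})"
  proof
    fix x assume "x \<in> {x \<in> P. x \<preceq> D (int (Suc k))}"
    \<comment> \<open>With no demands, \<open>lifts_split\<close> merely peels off a simple
      factor.\<close>
    then have "\<exists>s\<in>S. s \<in> lifts {} \<and> (\<exists>x'\<in>P. x = s \<otimes> x' \<and> x' \<preceq> D (int k))"
      by (intro lifts_split) (auto simp: lifts_empty add.commute)
    then show "x \<in> (\<lambda>(s, x). s \<otimes> x) ` (S \<times> {x \<in> P. x \<preceq> D (int k)})" by force
  qed
  then show ?case using Suc simples_finite finite_subset by blast
qed

lemma finite_interval: "finite {x \<in> carrier G. D m \<preceq> x \<and> x \<preceq> D n}"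
proof -
  have "{x \<in> carrier G. D m \<preceq> x \<and> x \<preceq> D n} \<subseteq> (\<otimes>) (D m) ` {x \<in> P. x \<preceq> D (int (nat (n - m)))}"
  proof
    fix x assume x: "x \<in> {x \<in> carrier G. D m \<preceq> x \<and> x \<preceq> D n}"
    then obtain p where p: "p \<in> P" "x = D m \<otimes> p" by (auto elim: prec_obtain)
    have "D n = D m \<otimes> D (n - m)" by (simp flip: D_mult)
    then have "p \<preceq> D (n - m)" using x p by simp
    then have "p \<preceq> D (int (nat (n - m)))"
      using p D_mono[of "n - m" "int (nat (n - m))"] prec_trans[of p "D (n - m)" "D (int (nat (n - m)))"] by simp
    with p show "x \<in> (\<otimes>) (D m) ` {x \<in> P. x \<preceq> D (int (nat (n - m)))}" by blast
  qed
  then show ?thesis using finite_divisors finite_subset by blast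
qed

end

section \<open>Lexicographic optimality\<close>

definition lexless :: "int list \<Rightarrow> int list \<Rightarrow> bool" where
  "lexless v w \<longleftrightarrow> (\<exists>i<length v. v ! i < w ! i \<and> (\<forall>j<i. v ! j = w ! j))"

text \<open>The first differing position is at most \<open>i\<close>, and there the weak inequality
  is strict. Interval membership yields only weak inequalities, hence this form.\<close>

lemma lexless_pointwise:
  assumes "i < length v" "v ! i < w ! i" "\<And>j. j < i \<Longrightarrow> v ! j \<le> w ! j"
  shows "lexless v w"
proof -
  define k where "k = (LEAST k. v ! k \<noteq> w ! k)"
  have k: "v ! k \<noteq> w ! k" unfolding k_def by (rule LeastI[of _ i]) (use assms in simp)
  have "k \<le> i" unfolding k_def by (rule Least_le) (use assms in simp)
  moreover have "v ! k < w ! k"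
    using k assms(2) assms(3)[of k] \<open>k \<le> i\<close> by (cases "k = i") auto
  moreover have "v ! j = w ! j" if "j < k" for j
    using not_less_Least[of j "\<lambda>k. v ! k \<noteq> w ! k"] that by (auto simp: k_def)
  ultimately show ?thesis unfolding lexless_def using assms(1) by (intro exI[of _ k]) auto
qed

lemma lexless_linear: "length v = length w \<Longrightarrow> lexless v w \<or> v = w \<or> lexless w v"
proof (rule ccontr)
  assume l: "length v = length w" and n: "\<not> (lexless v w \<or> v = w \<or> lexless w v)"
  define k where "k = (LEAST k. v ! k \<noteq> w ! k)"
  from l n obtain i where i: "i < length v" "v ! i \<noteq> w ! i" using nth_equalityI by blast
  have k: "v ! k \<noteq> w ! k" unfolding k_def by (rule LeastI[of _ i]) (use i in simp)
  have kl: "k < length v" using i Least_le[of "\<lambda>k. v ! k \<noteq> w ! k" i] unfolding k_def by simp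
  have "v ! j = w ! j" if "j < k" for j
    using not_less_Least[of j "\<lambda>k. v ! k \<noteq> w ! k"] that by (auto simp: k_def)
  with k kl l n show False unfolding lexless_def
    by (metis linorder_neqE)
qed

lemma lexless_eq_if_le:
  assumes "length v = length w" "\<not> lexless v w" "\<And>i. i < length v \<Longrightarrow> v ! i \<le> w ! i"
  shows "v = w"
proof -
  have "\<not> lexless w v" unfolding lexless_def using assms(1,3) by (metis not_le)
  then show ?thesis using lexless_linear assms by blast
qed

lemma lexless_Cons: "lexless (x # v) (y # w) \<longleftrightarrow> x < y \<or> x = y \<and> lexless v w"
proof
  assume "lexless (x # v) (y # w)"
  then obtain i where i: "i < Suc (length v)" "(x # v) ! i < (y # w) ! i" "\<forall>j<i. (x # v) ! j = (y # w) ! j"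
    unfolding lexless_def by auto
  show "x < y \<or> x = y \<and> lexless v w"
  proof (cases i)
    case (Suc k)
    have "v ! j = w ! j" if "j < k" for j using i(3)[rule_format, of "Suc j"] that Suc by simp
    then have "lexless v w" unfolding lexless_def using i Suc by (intro exI[of _ k]) simp
    moreover have "x = y" using i(3)[rule_format, of 0] Suc by simp
    ultimately show ?thesis by blast
  qed (use i in simp)
next
  assume "x < y \<or> x = y \<and> lexless v w"
  then show "lexless (x # v) (y # w)"
  proof
    assume "x = y \<and> lexless v w"
    then obtain i where "i < length v" "v ! i < w ! i" "\<forall>j<i. v ! j = w ! j" "x = y"
      unfolding lexless_def by auto
    then show ?thesis unfolding lexless_def by (intro exI[of _ "Suc i"]) (auto simp: nth_Cons split: nat.split)
  qed (auto simp: lexless_def)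
qed

lemma int_bounded_max:
  fixes A :: "int set"
  assumes "A \<noteq> {}" "\<And>a. a \<in> A \<Longrightarrow> a \<le> B"
  shows "\<exists>m\<in>A. \<forall>a\<in>A. a \<le> m"
proof -
  obtain a where a: "a \<in> A" using assms by blast
  have fin: "finite (A \<inter> {a..B})" by simp
  have "Max (A \<inter> {a..B}) \<in> A \<inter> {a..B}" using a assms by (intro Max_in) auto
  moreover have "b \<le> Max (A \<inter> {a..B})" if "b \<in> A" for b
  proof (cases "a \<le> b")
    case True
    then show ?thesis using fin that assms by (intro Max_ge) auto
  qed (use calculation in auto)
  ultimately show ?thesis by blast
qed

text \<open>Maximise the head, then recurse on the tails of the vectors with that head; a nonempty
  set of integers that is bounded above has a maximum.\<close>

lemma lexless_maximal_ex:
  assumes "V \<noteq> {}" "\<And>v. v \<in> V \<Longrightarrow> length v = n" "\<And>v i. v \<in> V \<Longrightarrow> i < n \<Longrightarrow> v ! i \<le> B"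
  shows "\<exists>v\<in>V. \<forall>w\<in>V. \<not> lexless v w"
  using assms
proof (induction n arbitrary: V)
  case 0
  then show ?case by (auto simp: lexless_def)
next
  case (Suc n)
  have Cons: "\<exists>x w. v = x # w" if "v \<in> V" for v using Suc(3)[OF that] by (cases v) auto
  have "\<exists>m\<in>hd ` V. \<forall>a\<in>hd ` V. a \<le> m"
  proof (rule int_bounded_max)
    fix a assume "a \<in> hd ` V"
    then show "a \<le> B" using Suc(4)[of _ 0] Cons by fastforce
  qed (use Suc(2) in simp)
  then obtain m where m: "m \<in> hd ` V" "\<And>v. v \<in> V \<Longrightarrow> hd v \<le> m" by auto
  let ?V = "{w. m # w \<in> V}"
  have "\<exists>v\<in>?V. \<forall>w\<in>?V. \<not> lexless v w"
  proof (rule Suc(1))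
    show "?V \<noteq> {}" using m(1) Cons by fastforce
    show "length v = n" if "v \<in> ?V" for v using Suc(3) that by fastforce
    show "v ! i \<le> B" if "v \<in> ?V" "i < n" for v i using Suc(4)[of "m # v" "Suc i"] that by simp
  qed
  then obtain v where v: "m # v \<in> V" "\<And>w. m # w \<in> V \<Longrightarrow> \<not> lexless v w" by blast
  have "\<not> lexless (m # v) w" if "w \<in> V" for w
    using Cons[OF that] m(2)[OF that] v(2) that by (auto simp: lexless_Cons)
  with v(1) show ?case by blast
qed

section \<open>The minimal interval as a single lexicographic maximisation\<close>

context garside_group
begin

abbreviation ginf :: "'a \<Rightarrow> int" where "ginf \<equiv> garside_inf G S \<Delta>"
abbreviation gsup :: "'a \<Rightarrow> int" where "gsup \<equiv> garside_sup G S \<Delta>"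

lemma conj_tuple_one: "set c \<subseteq> carrier G \<Longrightarrow> conj_tuple G c \<one> = c"
  by (induction c) (auto simp: conj_tuple_def)

lemma conj_tuple_mult:
  assumes "set c \<subseteq> carrier G" "x \<in> carrier G" "y \<in> carrier G"
  shows "conj_tuple G (conj_tuple G c x) y = conj_tuple G c (x \<otimes> y)"
  using assms by (auto simp: conj_tuple_def m_assoc inv_mult_group)

lemma length_conj_tuple [simp]: "length (conj_tuple G c x) = length c"
  by (simp add: conj_tuple_def)

lemma nth_conj_tuple [simp]: "i < length c \<Longrightarrow> conj_tuple G c x ! i = inv x \<otimes> c ! i \<otimes> x"
  by (simp add: conj_tuple_def)

lemma set_conj_tuple: "set c \<subseteq> carrier G \<Longrightarrow> x \<in> carrier G \<Longrightarrow> set (conj_tuple G c x) \<subseteq> carrier G"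
  by (auto simp: conj_tuple_def)

text \<open>Suprema are negated so that every coordinate is maximised, and the interleaving follows
  the order in which the interval bounds are chosen.\<close>

definition infsup :: "'a list \<Rightarrow> int list" where
  "infsup u = concat (map (\<lambda>x. [ginf x, - gsup x]) u)"

lemma length_infsup [simp]: "length (infsup u) = 2 * length u"
  by (induction u) (auto simp: infsup_def)

lemma nth_infsup:
  "i < length u \<Longrightarrow> infsup u ! (2 * i) = ginf (u ! i)"
  "i < length u \<Longrightarrow> infsup u ! Suc (2 * i) = - gsup (u ! i)"
proof -
  have "i < length u \<Longrightarrow> infsup u ! (2 * i) = ginf (u ! i) \<and> infsup u ! Suc (2 * i) = - gsup (u ! i)"
  proof (induction u arbitrary: i)
    case (Cons x u)
    then show ?case by (cases i) (auto simp: infsup_def)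
  qed simp
  then show "i < length u \<Longrightarrow> infsup u ! (2 * i) = ginf (u ! i)"
    "i < length u \<Longrightarrow> infsup u ! Suc (2 * i) = - gsup (u ! i)" by auto
qed

lemma infsup_le:
  assumes "length u = length w" "n \<le> length u"
    and "\<And>i. i < n \<Longrightarrow> ginf (u ! i) \<le> ginf (w ! i) \<and> gsup (w ! i) \<le> gsup (u ! i)" and "j < 2 * n"
  shows "infsup u ! j \<le> infsup w ! j"
proof -
  define i where "i = j div 2"
  have i: "i < n" using assms(4) by (auto simp: i_def)
  then have "infsup u ! (2 * i) \<le> infsup w ! (2 * i)" "infsup u ! Suc (2 * i) \<le> infsup w ! Suc (2 * i)"
    using assms(1,2,3) by (simp_all add: nth_infsup)
  moreover have "j = 2 * i \<or> j = Suc (2 * i)" unfolding i_def by presburger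
  ultimately show ?thesis by auto
qed

lemma lexless_infsup_inf:
  assumes "length u = length w" "i < length u"
    and "\<And>j. j < i \<Longrightarrow> ginf (u ! j) \<le> ginf (w ! j) \<and> gsup (w ! j) \<le> gsup (u ! j)"
    and "ginf (u ! i) < ginf (w ! i)"
  shows "lexless (infsup u) (infsup w)"
  by (rule lexless_pointwise[of "2 * i"]) (use assms infsup_le[of u w i] in \<open>auto simp: nth_infsup\<close>)

lemma lexless_infsup_sup:
  assumes "length u = length w" "i < length u"
    and "\<And>j. j < i \<Longrightarrow> ginf (u ! j) \<le> ginf (w ! j) \<and> gsup (w ! j) \<le> gsup (u ! j)"
    and "ginf (u ! i) \<le> ginf (w ! i)" "gsup (w ! i) < gsup (u ! i)"
  shows "lexless (infsup u) (infsup w)"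
proof (rule lexless_pointwise[of "Suc (2 * i)"])
  fix j assume "j < Suc (2 * i)"
  then show "infsup u ! j \<le> infsup w ! j"
    using assms infsup_le[of u w i j] by (cases "j = 2 * i") (auto simp: nth_infsup)
qed (use assms in \<open>auto simp: nth_infsup\<close>)

lemma is_maximal_such_unique: "is_maximal_such Q m \<Longrightarrow> is_maximal_such Q m' \<Longrightarrow> m = m'"
  by (auto simp: is_maximal_such_def intro: antisym)

lemma is_minimal_such_unique: "is_minimal_such Q m \<Longrightarrow> is_minimal_such Q m' \<Longrightarrow> m = m'"
  by (auto simp: is_minimal_such_def intro: antisym)

lemma is_lex_min_interval_unique:
  assumes 1: "is_lex_min_interval G S \<Delta> a p q" and 2: "is_lex_min_interval G S \<Delta> a p' q'"
  shows "p = p' \<and> q = q'"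
proof -
  have l: "length p = length a" "length q = length a" "length p' = length a" "length q' = length a"
    using assms unfolding is_lex_min_interval_def by auto
  have "p ! i = p' ! i \<and> q ! i = q' ! i" if "i < length a" for i
    using that
  proof (induction i rule: less_induct)
    case (less i)
    show ?case
    proof (cases "i = 0")
      case True
      then have "a \<noteq> []" using less by auto
      then show ?thesis using 1 2 True
        unfolding is_lex_min_interval_def is_summit_inf_def is_summit_sup_def
        by (meson is_maximal_such_unique is_minimal_such_unique)
    next
      case False
      then have i: "1 \<le> i \<and> i < length a" using less by simp
      have "take i p = take i p'" "take i q = take i q'"
        using less l by (auto intro!: nth_equalityI)
      moreover from this have p: "p ! i = p' ! i"
        using 1 2 i unfolding is_lex_min_interval_def by (metis is_maximal_such_unique)
      ultimately have "take (Suc i) p = take (Suc i) p'" using l less.prems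
        by (simp add: take_Suc_conv_app_nth)
      with \<open>take i q = take i q'\<close> have "q ! i = q' ! i"
        using 1 2 i unfolding is_lex_min_interval_def by (metis is_minimal_such_unique)
      with p show ?thesis by blast
    qed
  qed
  then show ?thesis using l by (auto intro!: nth_equalityI)
qed

lemma garside_interval_snoc:
  assumes "length p = length q"
  shows "u \<in> garside_interval G S \<Delta> (p @ [m]) (q @ [n]) \<longleftrightarrow>
    set u \<subseteq> carrier G \<and> length u = Suc (length p) \<and>
    (\<forall>j<length p. p ! j \<le> ginf (u ! j) \<and> Fin (gsup (u ! j)) \<le> q ! j) \<and>
    m \<le> ginf (u ! length p) \<and> Fin (gsup (u ! length p)) \<le> n"
  using assms by (auto simp: garside_interval_def nth_append less_Suc_eq)

text \<open>The hypothesis \<open>summit\<close> is needed because the first supremum is minimised over the whole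
  conjugacy class, not only over the elements with maximal first infimum.\<close>

lemma lex_min_interval_optimal:
  assumes a: "set a \<subseteq> carrier G" and x: "x \<in> carrier G"
    and opt: "\<And>y. y \<in> carrier G \<Longrightarrow> \<not> lexless (infsup (conj_tuple G a x)) (infsup (conj_tuple G a y))"
    and summit: "\<And>y. a \<noteq> [] \<Longrightarrow> y \<in> carrier G \<Longrightarrow>
      gsup (inv x \<otimes> a ! 0 \<otimes> x) \<le> gsup (inv y \<otimes> a ! 0 \<otimes> y)"
  shows "is_lex_min_interval G S \<Delta> a (map ginf (conj_tuple G a x)) (map gsup (conj_tuple G a x))"
    (is "is_lex_min_interval G S \<Delta> a ?p ?q")
proof -
  have sub: "take k (conj_tuple G a y) = conj_tuple G (take k a) y" for k y
    by (simp add: conj_tuple_def take_map)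
  have mem: "conj_tuple G (take k a) x \<in> conj_class G (take k a)" for k
    using x by (simp add: conj_class_def)
  have c: "set (conj_tuple G (take k a) y) \<subseteq> carrier G" if "y \<in> carrier G" for k y
    using a that set_take_subset by (intro set_conj_tuple) fast+
  have max: "is_maximal_such
         (\<lambda>m. conj_class G (take (Suc i) a) \<inter>
              garside_interval G S \<Delta> (take i ?p @ [m]) (map Fin (take i ?q) @ [\<infinity>]) \<noteq> {}) (?p ! i)"
    (is "is_maximal_such ?M _")
    if i: "i < length a" for i
    unfolding is_maximal_such_def
  proof (intro conjI allI impI)
    have "conj_tuple G (take (Suc i) a) x \<in> garside_interval G S \<Delta> (take i ?p @ [?p ! i]) (map Fin (take i ?q) @ [\<infinity>])"
      using i c[OF x, of "Suc i"] by (subst garside_interval_snoc) auto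
    with mem show "?M (?p ! i)" by blast
    fix k assume "?M k"
    then obtain w where w: "w \<in> conj_class G (take (Suc i) a)"
       "w \<in> garside_interval G S \<Delta> (take i ?p @ [k]) (map Fin (take i ?q) @ [\<infinity>])" by blast
    then obtain y where y: "y \<in> carrier G" "w = conj_tuple G (take (Suc i) a) y" by (auto simp: conj_class_def)
    \<comment> \<open>A competitor is only known to be weakly better before position
      \<open>i\<close>; together with a strict gain at \<open>i\<close> this is still a
      lexicographic improvement.\<close>
    have w2: "\<And>j. j < i \<Longrightarrow> ?p ! j \<le> ginf (w ! j) \<and> gsup (w ! j) \<le> ?q ! j" "k \<le> ginf (w ! i)"
      using w(2) i by (subst (asm) garside_interval_snoc; auto)+
    show "k \<le> ?p ! i"
    proof (rule ccontr)
      assume "\<not> k \<le> ?p ! i"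
      then have "lexless (infsup (conj_tuple G a x)) (infsup (conj_tuple G a y))"
        using w2 i y by (intro lexless_infsup_inf[of _ _ i]) auto
      with opt y show False by blast
    qed
  qed
  have min: "is_minimal_such
         (\<lambda>n. conj_class G (take (Suc i) a) \<inter>
              garside_interval G S \<Delta> (take (Suc i) ?p) (map Fin (take i ?q @ [n])) \<noteq> {}) (?q ! i)"
    (is "is_minimal_such ?M _")
    if i: "i < length a" for i
    unfolding is_minimal_such_def
  proof (intro conjI allI impI)
    have eq: "take (Suc i) ?p = take i ?p @ [?p ! i]" "map Fin (take i ?q @ [n]) = map Fin (take i ?q) @ [Fin n]" for n
      using i by (simp_all add: take_Suc_conv_app_nth)
    have "conj_tuple G (take (Suc i) a) x \<in> garside_interval G S \<Delta> (take (Suc i) ?p) (map Fin (take i ?q @ [?q ! i]))"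
      unfolding eq using i c[OF x, of "Suc i"] by (subst garside_interval_snoc) auto
    with mem show "?M (?q ! i)" by blast
    fix k assume "?M k"
    then obtain w where w: "w \<in> conj_class G (take (Suc i) a)"
       "w \<in> garside_interval G S \<Delta> (take i ?p @ [?p ! i]) (map Fin (take i ?q) @ [Fin k])" unfolding eq by blast
    then obtain y where y: "y \<in> carrier G" "w = conj_tuple G (take (Suc i) a) y" by (auto simp: conj_class_def)
    have w2: "\<And>j. j < i \<Longrightarrow> ?p ! j \<le> ginf (w ! j) \<and> gsup (w ! j) \<le> ?q ! j" "?p ! i \<le> ginf (w ! i)" "gsup (w ! i) \<le> k"
      using w(2) i by (subst (asm) garside_interval_snoc; auto)+
    show "?q ! i \<le> k"
    proof (rule ccontr)
      assume "\<not> ?q ! i \<le> k"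
      then have "lexless (infsup (conj_tuple G a x)) (infsup (conj_tuple G a y))"
        using w2 i y by (intro lexless_infsup_sup[of _ _ i]) auto
      with opt y show False by blast
    qed
  qed
  have "is_summit_inf G S \<Delta> (a ! 0) (?p ! 0)" if "a \<noteq> []"
    unfolding is_summit_inf_def is_maximal_such_def
  proof (intro conjI allI impI)
    fix k assume "\<exists>g\<in>carrier G. k = ginf (inv g \<otimes> a ! 0 \<otimes> g)"
    then obtain y where y: "y \<in> carrier G" "k = ginf (inv y \<otimes> a ! 0 \<otimes> y)" by blast
    show "k \<le> ?p ! 0"
    proof (rule ccontr)
      assume "\<not> k \<le> ?p ! 0"
      then have "lexless (infsup (conj_tuple G a x)) (infsup (conj_tuple G a y))"
        using that y by (intro lexless_infsup_inf[of _ _ 0]) auto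
      with opt y show False by blast
    qed
  qed (use that x in auto)
  moreover have "is_summit_sup G S \<Delta> (a ! 0) (?q ! 0)" if "a \<noteq> []"
    unfolding is_summit_sup_def is_minimal_such_def using that x summit by auto
  ultimately show ?thesis unfolding is_lex_min_interval_def using max min by simp
qed

text \<open>A conjugate in the minimal interval is at least as good as the optimal one in every
  coordinate. As it cannot be lexicographically better, its vector is the same.\<close>

lemma LSSS_eq_infsup:
  assumes a: "set a \<subseteq> carrier G" and x: "x \<in> carrier G"
    and opt: "\<And>y. y \<in> carrier G \<Longrightarrow> \<not> lexless (infsup (conj_tuple G a x)) (infsup (conj_tuple G a y))"
    and summit: "\<And>y. a \<noteq> [] \<Longrightarrow> y \<in> carrier G \<Longrightarrow>
      gsup (inv x \<otimes> a ! 0 \<otimes> x) \<le> gsup (inv y \<otimes> a ! 0 \<otimes> y)"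
  shows "LSSS G S \<Delta> a = {conj_tuple G a y |y. y \<in> carrier G \<and> infsup (conj_tuple G a y) = infsup (conj_tuple G a x)}"
proof -
  let ?u = "conj_tuple G a x"
  have "is_lex_min_interval G S \<Delta> a (map ginf ?u) (map gsup ?u)"
    using assms by (rule lex_min_interval_optimal)
  then have "lex_min_interval G S \<Delta> a = (map ginf ?u, map gsup ?u)"
    unfolding lex_min_interval_def by (rule_tac the_equality) (auto dest: is_lex_min_interval_unique)
  then have L: "LSSS G S \<Delta> a = conj_class G a \<inter> garside_interval G S \<Delta> (map ginf ?u) (map Fin (map gsup ?u))"
    by (simp add: LSSS_def)
  have "w \<in> garside_interval G S \<Delta> (map ginf ?u) (map Fin (map gsup ?u)) \<longleftrightarrow> infsup w = infsup ?u"
    if y: "y \<in> carrier G" and w: "w = conj_tuple G a y" for w y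
  proof
    assume "w \<in> garside_interval G S \<Delta> (map ginf ?u) (map Fin (map gsup ?u))"
    then have *: "ginf (?u ! i) \<le> ginf (w ! i) \<and> gsup (w ! i) \<le> gsup (?u ! i)" if "i < length a" for i
      using that w by (auto simp: garside_interval_def)
    have "infsup ?u = infsup w"
      using opt[OF y] w * infsup_le[of ?u w "length a"] by (intro lexless_eq_if_le) auto
    then show "infsup w = infsup ?u" by simp
  next
    assume eq: "infsup w = infsup ?u"
    have "ginf (?u ! i) = ginf (w ! i) \<and> gsup (w ! i) = gsup (?u ! i)" if "i < length a" for i
      using nth_infsup[of i w] nth_infsup[of i ?u] that w eq by auto
    then show "w \<in> garside_interval G S \<Delta> (map ginf ?u) (map Fin (map gsup ?u))"
      using w set_conj_tuple[OF a y] by (auto simp: garside_interval_def)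
  qed
  then show ?thesis unfolding L conj_class_def by blast
qed

end

section \<open>Optimal conjugators: existence, local test and connectedness\<close>

context garside_group
begin

abbreviation infs :: "'a list \<Rightarrow> int list" where "infs \<equiv> map ginf"

definition optimal :: "'a list \<Rightarrow> 'a \<Rightarrow> bool" where
  "optimal c x \<longleftrightarrow> x \<in> carrier G \<and>
    (\<forall>y\<in>carrier G. \<not> lexless (infs (conj_tuple G c x)) (infs (conj_tuple G c y)))"

text \<open>Inserting the inverses turns conditions on suprema into conditions on infima, so that
  all of them have the shape treated by \<open>lifts\<close>.\<close>

definition with_inverses :: "'a list \<Rightarrow> 'a list" where
  "with_inverses u = concat (map (\<lambda>x. [x, inv x]) u)"

lemma set_with_inverses: "set u \<subseteq> carrier G \<Longrightarrow> set (with_inverses u) \<subseteq> carrier G"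
  by (auto simp: with_inverses_def)

lemma with_inverses_conj_tuple:
  "set u \<subseteq> carrier G \<Longrightarrow> x \<in> carrier G \<Longrightarrow>
    with_inverses (conj_tuple G u x) = conj_tuple G (with_inverses u) x"
  by (induction u) (auto simp: with_inverses_def conj_tuple_def inv_mult_group m_assoc)

lemma optimal_cong:
  "optimal c x \<Longrightarrow> y \<in> carrier G \<Longrightarrow> infs (conj_tuple G c y) = infs (conj_tuple G c x) \<Longrightarrow> optimal c y"
  by (simp add: optimal_def)

lemma infs_optimal_eq:
  assumes "optimal c x" "optimal c y"
  shows "infs (conj_tuple G c x) = infs (conj_tuple G c y)"
  using assms lexless_linear[of "infs (conj_tuple G c x)" "infs (conj_tuple G c y)"]
  by (auto simp: optimal_def)

end

locale nontrivial_garside_group = garside_group +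
  assumes Delta_neq_one: "\<Delta> \<noteq> \<one>"
begin

lemma D_prec_D_iff: "D m \<preceq> D n \<longleftrightarrow> m \<le> n"
proof
  assume mn: "D m \<preceq> D n"
  show "m \<le> n"
  proof (rule ccontr)
    assume "\<not> m \<le> n"
    then have "D (n + 1) \<preceq> D m" by (intro D_mono) simp
    then have "D n \<otimes> \<Delta> \<preceq> D n \<otimes> \<one>" using mn prec_trans[of "D (n + 1)" "D m" "D n"] by (simp add: D_mult)
    then have "\<Delta> \<preceq> \<one>" by (simp only: prec_mult_left Delta_carrier one_closed int_pow_closed)
    then have "\<Delta> = \<one>" using prec_antisym Delta_pos one_prec by simp
    with Delta_neq_one show False by blast
  qed
qed (rule D_mono)

text \<open>The maximum exists because \<open>\<Delta> \<noteq> \<one>\<close> makes the order on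
  its powers that of the exponents, and an upper bound \<open>D n\<close> of \<open>a\<close> then
  bounds them. From here on the infimum is handled through this equivalence.\<close>

lemma le_ginf_iff:
  assumes a: "a \<in> carrier G"
  shows "m \<le> ginf a \<longleftrightarrow> D m \<preceq> a"
proof -
  obtain n where n: "a \<preceq> D n" using bounded_above a by blast
  obtain k where k: "D k \<preceq> a" using bounded_below a by blast
  have "\<exists>m\<in>{m. D m \<preceq> a}. \<forall>k\<in>{m. D m \<preceq> a}. k \<le> m"
  proof (rule int_bounded_max)
    fix k assume "k \<in> {m. D m \<preceq> a}"
    then show "k \<le> n" using n a prec_trans[of "D k" a "D n"] D_prec_D_iff by simp
  qed (use k in blast)
  then obtain m0 where m0: "D m0 \<preceq> a" "\<And>k. D k \<preceq> a \<Longrightarrow> k \<le> m0" by blast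
  then have "ginf a = m0"
    unfolding garside_inf_def using a by (intro Greatest_equality) (auto simp: garside_le_D_left)
  then show ?thesis using m0 a D_mono[of m m0] prec_trans[of "D m" "D m0" a] by auto
qed

lemma gsup_eq:
  assumes a: "a \<in> carrier G"
  shows "gsup a = - ginf (inv a)"
  unfolding garside_sup_def
proof (rule Least_equality)
  have *: "a \<preceq> D n \<longleftrightarrow> - n \<le> ginf (inv a)" for n
    using a D_prec_inv_iff le_ginf_iff by simp
  show "garside_le G S a (D (- ginf (inv a)))"
    using a garside_le_D_right * by simp
  show "- ginf (inv a) \<le> n" if "garside_le G S a (D n)" for n
    using that a garside_le_D_right[OF a] * by simp
qed

text \<open>If the infimum \<open>p\<close> of the conjugate exceeded \<open>n\<close>, then
  \<open>x \<preceq> a \<otimes> x \<otimes> D (- p)\<close> and \<open>a \<preceq> D n\<close>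
  would turn every bound \<open>x \<preceq> D k\<close> into \<open>x \<preceq> D (k - 1)\<close>,
  an endless descent. The bound on infima over the class is what makes optimal conjugators
  exist.\<close>

lemma ginf_conj_le:
  assumes a: "a \<in> carrier G" "a \<preceq> D n" and x: "x \<in> carrier G"
  shows "ginf (inv x \<otimes> a \<otimes> x) \<le> n"
proof (rule ccontr)
  let ?p = "ginf (inv x \<otimes> a \<otimes> x)"
  assume "\<not> ?p \<le> n"
  then have pn: "n - ?p \<le> - 1" by simp
  have "D ?p \<preceq> inv x \<otimes> a \<otimes> x" using le_ginf_iff[of "inv x \<otimes> a \<otimes> x" ?p] a x by simp
  then have xp: "x \<preceq> a \<otimes> x \<otimes> D (- ?p)"
    using D_prec_conj_iff twist_prec_iff[of x a x] a x by simp
  have step: "x \<preceq> D (k - 1)" if "x \<preceq> D k" for k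
  proof -
    have "x \<otimes> D (- ?p) \<preceq> D k \<otimes> D (- ?p)" using that x by (simp only: prec_mult_D int_pow_closed Delta_carrier)
    then have "a \<otimes> (x \<otimes> D (- ?p)) \<preceq> a \<otimes> (D k \<otimes> D (- ?p))"
      using a x by (simp only: prec_mult_left m_closed int_pow_closed Delta_carrier)
    then have 1: "a \<otimes> x \<otimes> D (- ?p) \<preceq> a \<otimes> D (k - ?p)" using a x D_mult[of k "- ?p"] by (simp add: m_assoc)
    have "a \<otimes> D (k - ?p) \<preceq> D n \<otimes> D (k - ?p)" using a by (simp only: prec_mult_D int_pow_closed Delta_carrier)
    then have 2: "a \<otimes> D (k - ?p) \<preceq> D (n + (k - ?p))" by (simp only: D_mult)
    have 3: "D (n + (k - ?p)) \<preceq> D (k - 1)" using pn by (intro D_mono) simp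
    have "x \<preceq> a \<otimes> D (k - ?p)" using prec_trans[OF xp 1] a x by simp
    then have "x \<preceq> D (n + (k - ?p))" using prec_trans[OF _ 2] a x by simp
    then show ?thesis using prec_trans[OF _ 3] x by simp
  qed
  obtain m where m: "D m \<preceq> x" using bounded_below x by blast
  obtain k where k: "x \<preceq> D k" using bounded_above x by blast
  have "x \<preceq> D (k - int t)" for t
  proof (induction t)
    case (Suc t)
    from step[OF this] show ?case by (simp add: algebra_simps)
  qed (use k in simp)
  then have "D m \<preceq> D (k - int t)" for t using m x prec_trans[of "D m" x "D (k - int t)"] by simp
  then have "m \<le> k - int t" for t using D_prec_D_iff by blast
  \<comment> \<open>The instance at \<open>0\<close> gives \<open>m \<le> k\<close>, so that
    \<open>nat\<close> does not truncate in the other one.\<close>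
  from this[of "nat (k - m + 1)"] this[of 0] show False by simp
qed

lemma mem_lifts_iff:
  "Q \<subseteq> carrier G \<times> UNIV \<Longrightarrow> x \<in> lifts Q \<longleftrightarrow> x \<in> carrier G \<and> (\<forall>(a, p)\<in>Q. p \<le> ginf (inv x \<otimes> a \<otimes> x))"
  unfolding lifts_def by (fastforce simp: le_ginf_iff)

lemma optimal_ex:
  assumes c: "set c \<subseteq> carrier G"
  shows "\<exists>x. optimal c x"
proof -
  have "\<exists>n. \<forall>a\<in>set c. a \<preceq> D n"
    using c
  proof (induction c)
    case (Cons a c)
    then obtain n where n: "\<forall>a\<in>set c. a \<preceq> D n" by auto
    have "a \<in> carrier G" using Cons(2) by simp
    then obtain k where k: "a \<preceq> D k" using bounded_above by blast
    have "\<forall>b\<in>set (a # c). b \<preceq> D (max k n)"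
      using n k Cons(2) prec_trans[OF _ D_mono[of k "max k n"]] prec_trans[OF _ D_mono[of n "max k n"]] by auto
    then show ?case by blast
  qed simp
  then obtain n where n: "\<And>a. a \<in> set c \<Longrightarrow> a \<preceq> D n" by blast
  let ?V = "(\<lambda>x. infs (conj_tuple G c x)) ` carrier G"
  have "\<exists>v\<in>?V. \<forall>w\<in>?V. \<not> lexless v w"
  proof (rule lexless_maximal_ex[where n = "length c"])
    fix v i assume "v \<in> ?V" "i < length c"
    moreover from this have "c ! i \<in> carrier G" "c ! i \<preceq> D n" using n c by (auto simp: subset_iff)
    ultimately show "v ! i \<le> n" using ginf_conj_le by auto
  qed (auto intro: one_closed)
  then show ?thesis unfolding optimal_def by blast
qed

text \<open>An improvement by an arbitrary conjugator is expressed as demands on the present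
  conjugate: keep the infima before the first change and raise the one that changes.
  \<open>lifts_bounded_witness\<close> then replaces the conjugator by a divisor of
  \<open>D (int N)\<close>.\<close>

lemma optimal_if_locally_optimal:
  assumes c: "set c \<subseteq> carrier G" and x: "x \<in> carrier G" and N: "chain_bound \<Delta> N"
    and loc: "\<And>d. d \<in> P \<Longrightarrow> d \<preceq> D (int N) \<Longrightarrow>
      \<not> lexless (infs (conj_tuple G c x)) (infs (conj_tuple G c (x \<otimes> d)))"
  shows "optimal c x"
  unfolding optimal_def
proof (intro conjI ballI notI)
  let ?b = "conj_tuple G c x"
  have b: "set ?b \<subseteq> carrier G" using set_conj_tuple c x by blast
  fix y assume y: "y \<in> carrier G" and less: "lexless (infs ?b) (infs (conj_tuple G c y))"
  define z where "z = inv x \<otimes> y"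
  have z: "z \<in> carrier G" "conj_tuple G c y = conj_tuple G ?b z"
    using x y c by (simp_all add: z_def conj_tuple_mult)
  obtain i where i: "i < length c" "ginf (?b ! i) < ginf (conj_tuple G ?b z ! i)"
    "\<And>j. j < i \<Longrightarrow> ginf (?b ! j) = ginf (conj_tuple G ?b z ! j)"
    using less unfolding lexless_def z(2) by auto
  define Q where "Q = insert (?b ! i, ginf (?b ! i) + 1) {(?b ! j, ginf (?b ! j)) |j. j < i}"
  have bc: "?b ! j \<in> carrier G" if "j \<le> i" for j
    using b i(1) that by (metis length_conj_tuple nth_mem order_le_less_trans subsetD)
  have Q: "Q \<subseteq> carrier G \<times> UNIV" using bc by (auto simp: Q_def simp del: nth_conj_tuple)
  \<comment> \<open>Raising one demand by \<open>1\<close> uses up exactly the slack that smallness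
    allows.\<close>
  have small: "D (p - 1) \<preceq> a" if "(a, p) \<in> Q" for a p
  proof -
    have "p - 1 \<le> ginf a" using that by (auto simp: Q_def simp del: nth_conj_tuple)
    then show ?thesis using le_ginf_iff that Q by blast
  qed
  have "z \<in> lifts Q" unfolding mem_lifts_iff[OF Q]
    using z(1) i by (auto simp: Q_def)
  from lifts_bounded_witness[OF Q small N this]
  obtain d where d: "d \<in> lifts Q" "d \<in> P" "d \<preceq> D (int N)" by blast
  have "ginf (?b ! j) \<le> ginf (inv d \<otimes> ?b ! j \<otimes> d)" if "j < i" for j
    using d(1) that unfolding mem_lifts_iff[OF Q] by (auto simp: Q_def simp del: nth_conj_tuple)
  moreover have "ginf (?b ! i) + 1 \<le> ginf (inv d \<otimes> ?b ! i \<otimes> d)"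
    using d(1) unfolding mem_lifts_iff[OF Q] by (simp add: Q_def del: nth_conj_tuple)
  ultimately have "lexless (infs ?b) (infs (conj_tuple G ?b d))"
    using i(1) by (intro lexless_pointwise[of i]) auto
  with loc[OF d(2,3)] show False using conj_tuple_mult[OF c x, of d] d by simp
qed (use x in simp)

lemma ginf_conj_D:
  assumes a: "a \<in> carrier G"
  shows "ginf (inv (D k) \<otimes> a \<otimes> D k) = ginf a"
proof -
  have "m \<le> ginf (inv (D k) \<otimes> a \<otimes> D k) \<longleftrightarrow> m \<le> ginf a" for m
  proof -
    have "m \<le> ginf (inv (D k) \<otimes> a \<otimes> D k) \<longleftrightarrow> inv (D k) \<otimes> D m \<otimes> D k \<preceq> inv (D k) \<otimes> a \<otimes> D k"
      using a le_ginf_iff D_commute[of m k] by (simp add: m_assoc)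
    also have "\<dots> \<longleftrightarrow> D m \<preceq> a" using a by (simp add: m_assoc)
    finally show ?thesis using a le_ginf_iff by simp
  qed
  then show ?thesis by (meson order.refl order_antisym)
qed

lemma optimal_mult_D:
  assumes c: "set c \<subseteq> carrier G" and x: "optimal c x"
  shows "optimal c (x \<otimes> D k)"
proof (rule optimal_cong[OF x])
  have xc: "x \<in> carrier G" using x by (simp add: optimal_def)
  show "infs (conj_tuple G c (x \<otimes> D k)) = infs (conj_tuple G c x)"
    using set_conj_tuple[OF c xc] ginf_conj_D
    by (simp flip: conj_tuple_mult[OF c xc] add: conj_tuple_def[of G "conj_tuple G c x"] subset_iff)
qed (use x in \<open>simp add: optimal_def\<close>)

lemma conj_tuple_inj:
  assumes "set u \<subseteq> carrier G" "set v \<subseteq> carrier G" "x \<in> carrier G" "conj_tuple G u x = conj_tuple G v x"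
  shows "u = v"
proof -
  have "conj_tuple G (conj_tuple G w x) (inv x) = w" if "set w \<subseteq> carrier G" for w
    using that assms(3) by (simp add: conj_tuple_mult conj_tuple_one)
  from this[OF assms(1)] this[OF assms(2)] show ?thesis unfolding assms(4) by (rule trans[OF sym])
qed

text \<open>Simple factors are peeled off the quotient of two optimal conjugators, and
  \<open>closed\<close> keeps each intermediate tuple in the image. The quotient need not be
  positive, so \<open>y\<close> is first shifted by some \<open>D j\<close>. The shift can be undone
  because conjugation by \<open>D j\<close> maps the finite set of tuples injectively into itself,
  hence onto itself.\<close>

lemma optimal_connected:
  assumes c: "set c \<subseteq> carrier G" and X: "\<And>x. x \<in> X \<Longrightarrow> optimal c x" "X \<noteq> {}"
    and fin: "finite (conj_tuple G c ` X)"
    and closed: "\<And>x s. x \<in> X \<Longrightarrow> s \<in> S \<Longrightarrow> optimal c (x \<otimes> s) \<Longrightarrow> conj_tuple G c (x \<otimes> s) \<in> conj_tuple G c ` X"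
    and y: "optimal c y"
  shows "conj_tuple G c y \<in> conj_tuple G c ` X"
proof -
  have Xc: "x \<in> carrier G" if "x \<in> X" for x using X that by (simp add: optimal_def)
  have *: "conj_tuple G c (x \<otimes> p) \<in> conj_tuple G c ` X"
    if "x \<in> X" "p \<in> P" "p \<preceq> D (int k)" "optimal c (x \<otimes> p)" for x p k
    using that
  proof (induction k arbitrary: x p)
    case 0
    then have "p = \<one>" using prec_antisym[of p \<one>] one_prec by simp
    then show ?case using 0 Xc by simp
  next
    case (Suc k)
    let ?b = "conj_tuple G c x"
    have xc: "x \<in> carrier G" using Xc Suc by blast
    have b: "set ?b \<subseteq> carrier G" using set_conj_tuple[OF c xc] .
    \<comment> \<open>The demands forbid any infimum of the present conjugate to drop;
      \<open>\<one>\<close> meets them, as \<open>lifts_split\<close> requires.\<close>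
    define Q where "Q = {(?b ! j, ginf (?b ! j)) |j. j < length c}"
    have Q: "Q \<subseteq> carrier G \<times> UNIV"
      using b by (auto simp: Q_def simp del: nth_conj_tuple)
    have mem: "z \<in> lifts Q \<longleftrightarrow> z \<in> carrier G \<and>
        (\<forall>j<length c. ginf (?b ! j) \<le> ginf (inv z \<otimes> ?b ! j \<otimes> z))" for z
      unfolding mem_lifts_iff[OF Q] by (auto simp: Q_def simp del: nth_conj_tuple)
    have "?b ! j \<in> carrier G" if "j < length c" for j
      using b that by (metis length_conj_tuple nth_mem subsetD)
    then have one: "\<one> \<in> lifts Q" by (simp add: mem del: nth_conj_tuple)
    have eq: "infs (conj_tuple G c (x \<otimes> p)) = infs ?b" using infs_optimal_eq[OF Suc(5) X(1)[OF Suc(2)]] .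
    have p: "p \<in> lifts Q"
      unfolding mem
    proof (intro conjI allI impI)
      fix j assume j: "j < length c"
      then have "infs (conj_tuple G ?b p) ! j = infs ?b ! j"
        using eq Suc(3) conj_tuple_mult[OF c xc, of p] by simp
      then show "ginf (?b ! j) \<le> ginf (inv p \<otimes> ?b ! j \<otimes> p)" using j by simp
    qed (use Suc in simp)
    have "p \<preceq> D (int k + 1)" using Suc(4) by (simp add: add.commute)
    from lifts_split[OF Q one p Suc(3) this] obtain s p' where
      s: "s \<in> S" "s \<in> lifts Q" "p' \<in> P" "p = s \<otimes> p'" "p' \<preceq> D (int k)" by auto
    have sc: "s \<in> carrier G" using s by (simp add: simple_pos)
    \<comment> \<open>The simple factor lowers no coordinate and \<open>x\<close> is optimal, so no
      coordinate changes.\<close>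
    have "infs ?b = infs (conj_tuple G ?b s)"
    proof (rule lexless_eq_if_le)
      show "\<not> lexless (infs ?b) (infs (conj_tuple G ?b s))"
        using X(1)[OF Suc(2)] sc xc conj_tuple_mult[OF c xc sc] by (simp add: optimal_def)
    qed (use s(2) in \<open>auto simp: mem\<close>)
    then have os: "optimal c (x \<otimes> s)"
      using optimal_cong[OF X(1)[OF Suc(2)], of "x \<otimes> s"] conj_tuple_mult[OF c xc sc] sc xc by simp
    obtain x' where x': "x' \<in> X" "conj_tuple G c (x \<otimes> s) = conj_tuple G c x'"
      using closed[OF Suc(2) s(1) os] by blast
    have x'c: "x' \<in> carrier G" using Xc x' by blast
    have e: "conj_tuple G c (x' \<otimes> p') = conj_tuple G c (x \<otimes> p)"
      using x'(2) conj_tuple_mult[OF c x'c, of p'] conj_tuple_mult[OF c, of "x \<otimes> s" p'] xc sc s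
      by (simp add: m_assoc)
    then have "optimal c (x' \<otimes> p')"
      using optimal_cong[OF Suc(5), of "x' \<otimes> p'"] x'c s by simp
    from Suc(1)[OF x'(1) s(3,5) this] show ?case using e by simp
  qed
  obtain x where x: "x \<in> X" using X by blast
  have xc: "x \<in> carrier G" and yc: "y \<in> carrier G" using Xc x y by (auto simp: optimal_def)
  obtain j where j: "j \<ge> 0" "x \<preceq> y \<otimes> D j" using prec_D_shift xc yc by blast
  let ?f = "\<lambda>u. conj_tuple G u (D j)" and ?U = "conj_tuple G c ` X"
  have "?f ` ?U \<subseteq> ?U"
  proof safe
    fix x assume x: "x \<in> X"
    have "D j \<preceq> D (int (nat j))" using j by simp
    then show "?f (conj_tuple G c x) \<in> ?U"
      using *[OF x D_pos[OF j(1)], of "nat j"] optimal_mult_D[OF c X(1)[OF x]] conj_tuple_mult[OF c Xc[OF x]] by simp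
  qed
  moreover have "inj_on ?f ?U"
    using conj_tuple_inj[of _ _ "D j"] set_conj_tuple[OF c] Xc by (auto intro!: inj_onI)
  ultimately have surj: "?f ` ?U = ?U" by (intro endo_inj_surj fin)
  define p where "p = inv x \<otimes> (y \<otimes> D j)"
  have p: "p \<in> P" "x \<otimes> p = y \<otimes> D j" using j xc yc by (simp_all add: p_def prec_def)
  obtain k where k: "p \<preceq> D k" using bounded_above p by force
  then have "p \<preceq> D (int (nat k))" using p prec_trans[OF _ D_mono[of k "int (nat k)"]] by simp
  from *[OF x p(1) this] have "conj_tuple G c (y \<otimes> D j) \<in> ?U"
    using p(2) optimal_mult_D[OF c y] by simp
  then have "?f (conj_tuple G c y) \<in> ?f ` ?U" unfolding surj using conj_tuple_mult[OF c yc] by simp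
  then obtain u where u: "u \<in> X" "?f (conj_tuple G c y) = ?f (conj_tuple G c u)" by blast
  then have "conj_tuple G c y = conj_tuple G c u"
    using conj_tuple_inj[of "conj_tuple G c y" "conj_tuple G c u" "D j"] set_conj_tuple[OF c] Xc yc by simp
  then show ?thesis using u by blast
qed

lemma infsup_eq_infs: "set u \<subseteq> carrier G \<Longrightarrow> infsup u = infs (with_inverses u)"
  by (induction u) (auto simp: infsup_def with_inverses_def gsup_eq)

lemma LSSS_eq:
  assumes a: "set a \<subseteq> carrier G"
  shows "LSSS G S \<Delta> a = conj_tuple G a ` Collect (optimal (with_inverses a))"
proof -
  let ?c = "with_inverses a"
  have c: "set ?c \<subseteq> carrier G" using set_with_inverses[OF a] .
  obtain x where x: "optimal ?c x" using optimal_ex[OF c] by blast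
  have xc: "x \<in> carrier G" using x by (simp add: optimal_def)
  have eq: "infsup (conj_tuple G a y) = infs (conj_tuple G ?c y)" if "y \<in> carrier G" for y
    using infsup_eq_infs[OF set_conj_tuple[OF a that]] with_inverses_conj_tuple[OF a that] by simp
  have L: "LSSS G S \<Delta> a = {conj_tuple G a y |y. y \<in> carrier G \<and> infsup (conj_tuple G a y) = infsup (conj_tuple G a x)}"
  proof (rule LSSS_eq_infsup[OF a xc])
    show "\<not> lexless (infsup (conj_tuple G a x)) (infsup (conj_tuple G a y))" if "y \<in> carrier G" for y
      using x that eq xc by (simp add: optimal_def)
    \<comment> \<open>A conjugator with smaller first supremum could be combined with
      \<open>x\<close> by \<open>lifts_inv_meet\<close>. The result would have no smaller first
      infimum and a smaller first supremum than \<open>x\<close>, against optimality.\<close>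
    show "gsup (inv x \<otimes> a ! 0 \<otimes> x) \<le> gsup (inv y \<otimes> a ! 0 \<otimes> y)" if ne: "a \<noteq> []" and y: "y \<in> carrier G" for y
    proof (rule ccontr)
      assume less: "\<not> ?thesis"
      let ?a = "a ! 0" and ?p = "ginf (inv x \<otimes> a ! 0 \<otimes> x)" and ?r = "ginf (inv y \<otimes> inv (a ! 0) \<otimes> y)"
      have ac: "?a \<in> carrier G" using a ne by (cases a) auto
      have Q: "{(?a, ?p)} \<subseteq> carrier G \<times> UNIV" "{(inv ?a, ?r)} \<subseteq> carrier G \<times> UNIV"
        "{(?a, ?p), (inv ?a, ?r)} \<subseteq> carrier G \<times> UNIV" using ac by auto
      have "x \<in> lifts {(?a, ?p)}" "y \<in> lifts {(inv ?a, ?r)}"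
        unfolding mem_lifts_iff[OF Q(1)] mem_lifts_iff[OF Q(2)] using xc y by auto
      from lifts_inv_meet[OF ac this] obtain z where "z \<in> lifts {(?a, ?p), (inv ?a, ?r)}" by blast
      then have z: "z \<in> carrier G" "?p \<le> ginf (inv z \<otimes> ?a \<otimes> z)" "?r \<le> ginf (inv z \<otimes> inv ?a \<otimes> z)"
        unfolding mem_lifts_iff[OF Q(3)] by auto
      have inv: "gsup (inv w \<otimes> ?a \<otimes> w) = - ginf (inv w \<otimes> inv ?a \<otimes> w)" if "w \<in> carrier G" for w
        using gsup_eq[of "inv w \<otimes> ?a \<otimes> w"] ac that by (simp add: inv_mult_group m_assoc)
      have "gsup (inv z \<otimes> ?a \<otimes> z) < gsup (inv x \<otimes> ?a \<otimes> x)"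
        using z less inv y by simp
      then have "lexless (infsup (conj_tuple G a x)) (infsup (conj_tuple G a z))"
        using z ne by (intro lexless_infsup_sup[of _ _ 0]) auto
      then show False using x eq xc z(1) by (simp add: optimal_def)
    qed
  qed
  have "infsup (conj_tuple G a y) = infsup (conj_tuple G a x) \<longleftrightarrow> optimal ?c y" if "y \<in> carrier G" for y
    using infs_optimal_eq[OF x, of y] optimal_cong[OF x that] eq that xc by auto
  then show ?thesis unfolding L by (auto simp: optimal_def)
qed

text \<open>All members share one vector of infima and suprema, which confines each entry to a
  finite interval between two powers of \<open>\<Delta>\<close>.\<close>

lemma finite_LSSS:
  assumes a: "set a \<subseteq> carrier G"
  shows "finite (LSSS G S \<Delta> a)"
proof -
  let ?c = "with_inverses a"
  have c: "set ?c \<subseteq> carrier G" using set_with_inverses[OF a] .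
  obtain x where x: "optimal ?c x" using optimal_ex[OF c] by blast
  have xc: "x \<in> carrier G" using x by (simp add: optimal_def)
  have eq: "infsup (conj_tuple G a y) = infs (conj_tuple G ?c y)" if "y \<in> carrier G" for y
    using infsup_eq_infs[OF set_conj_tuple[OF a that]] with_inverses_conj_tuple[OF a that] by simp
  let ?v = "infsup (conj_tuple G a x)"
  let ?F = "\<Union>i<length a. {g \<in> carrier G. D (?v ! (2 * i)) \<preceq> g \<and> g \<preceq> D (- ?v ! Suc (2 * i))}"
  have "LSSS G S \<Delta> a \<subseteq> {u. set u \<subseteq> ?F \<and> length u = length a}"
  proof
    fix u assume "u \<in> LSSS G S \<Delta> a"
    then obtain y where y: "optimal ?c y" "u = conj_tuple G a y" using LSSS_eq[OF a] by auto
    then have yc: "y \<in> carrier G" by (simp add: optimal_def)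
    have u: "infsup u = ?v" using infs_optimal_eq[OF y(1) x] eq yc xc y by simp
    have uc: "set u \<subseteq> carrier G" using set_conj_tuple[OF a yc] y by simp
    have "u ! i \<in> {g \<in> carrier G. D (?v ! (2 * i)) \<preceq> g \<and> g \<preceq> D (- ?v ! Suc (2 * i))}" if "i < length u" for i
    proof -
      have ui: "u ! i \<in> carrier G" using uc that by auto
      have "D (ginf (u ! i)) \<preceq> u ! i" using le_ginf_iff[OF ui] by blast
      moreover have "u ! i \<preceq> D (gsup (u ! i))"
        using D_prec_inv_iff[OF ui] le_ginf_iff[of "inv (u ! i)"] ui gsup_eq[OF ui] by (metis inv_closed minus_minus order.refl)
      ultimately show ?thesis using ui that nth_infsup[of i u] u by simp
    qed
    moreover have "length u = length a" using y by simp
    ultimately show "u \<in> {u. set u \<subseteq> ?F \<and> length u = length a}"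
      by (auto simp: in_set_conv_nth) blast
  qed
  moreover have "finite ?F" using finite_interval by auto
  then have "finite {u. set u \<subseteq> ?F \<and> length u = length a}" by (rule finite_lists_length_eq)
  ultimately show ?thesis using finite_subset by blast
qed

end

section \<open>Computable functions on encoded types\<close>

text \<open>The program is quantified away, so that later arguments use closure properties of
  functions instead of program syntax.\<close>

definition recfn :: "nat \<Rightarrow> (nat list \<Rightarrow> nat) \<Rightarrow> bool" where
  "recfn n f \<longleftrightarrow> (\<exists>p. \<forall>xs. length xs = n \<longrightarrow> recf_eval p xs (f xs))"

lemma recfn_cong: "recfn n f \<Longrightarrow> (\<And>xs. length xs = n \<Longrightarrow> f xs = g xs) \<Longrightarrow> recfn n g"
  unfolding recfn_def by metis

lemma recfn_proj: "i < n \<Longrightarrow> recfn n (\<lambda>xs. xs ! i)"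
  unfolding recfn_def by (metis recf_eval.proj)

lemma recfn_zero: "recfn n (\<lambda>xs. 0)"
  unfolding recfn_def by (metis recf_eval.zero)

lemma recfn_comp:
  assumes h: "recfn (length fs) h" and fs: "\<And>f. f \<in> set fs \<Longrightarrow> recfn n f"
  shows "recfn n (\<lambda>xs. h (map (\<lambda>f. f xs) fs))"
proof -
  obtain p where p: "\<And>xs. length xs = length fs \<Longrightarrow> recf_eval p xs (h xs)"
    using h unfolding recfn_def by blast
  obtain c where c: "\<And>f xs. f \<in> set fs \<Longrightarrow> length xs = n \<Longrightarrow> recf_eval (c f) xs (f xs)"
    using fs unfolding recfn_def by metis
  have "recf_eval (Comp p (map c fs)) xs (h (map (\<lambda>f. f xs) fs))" if "length xs = n" for xs
    by (rule recf_eval.comp[OF _ p]) (auto simp: list_all2_conv_all_nth c that)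
  then show ?thesis unfolding recfn_def by blast
qed

lemma recfn_comp1: "recfn (Suc 0) h \<Longrightarrow> recfn n f \<Longrightarrow> recfn n (\<lambda>xs. h [f xs])"
  using recfn_comp[of "[f]" h n] by simp

lemma recfn_comp2:
  "recfn (Suc (Suc 0)) h \<Longrightarrow> recfn n f \<Longrightarrow> recfn n g \<Longrightarrow> recfn n (\<lambda>xs. h [f xs, g xs])"
  using recfn_comp[of "[f, g]" h n] by auto

lemma recfn_Suc: "recfn n f \<Longrightarrow> recfn n (\<lambda>xs. Suc (f xs))"
proof -
  have "recf_eval Succ xs (Suc (xs ! 0))" if "length xs = Suc 0" for xs
    using that recf_eval.succ by (cases xs) auto
  then have "recfn (Suc 0) (\<lambda>xs. Suc (xs ! 0))"
    unfolding recfn_def by blast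
  from recfn_comp1[OF this] show "recfn n f \<Longrightarrow> recfn n (\<lambda>xs. Suc (f xs))" by simp
qed

lemma recfn_rec_nat:
  assumes f: "recfn n f" and g: "recfn (Suc (Suc n)) g"
  shows "recfn (Suc n) (\<lambda>xs. rec_nat (f (tl xs)) (\<lambda>k y. g (k # y # tl xs)) (hd xs))"
proof -
  obtain p q where p: "\<And>xs. length xs = n \<Longrightarrow> recf_eval p xs (f xs)"
    and q: "\<And>xs. length xs = Suc (Suc n) \<Longrightarrow> recf_eval q xs (g xs)"
    using f g unfolding recfn_def by blast
  have "recf_eval (PrimRec p q) (k # xs) (rec_nat (f xs) (\<lambda>k y. g (k # y # xs)) k)"
    if "length xs = n" for k xs
    by (induction k) (auto intro!: recf_eval.intros p q simp: that)
  then have "recf_eval (PrimRec p q) xs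
      (rec_nat (f (tl xs)) (\<lambda>k y. g (k # y # tl xs)) (hd xs))" if "length xs = Suc n" for xs
    using that by (cases xs) auto
  then show ?thesis unfolding recfn_def by blast
qed

lemma recfn_mu:
  assumes f: "recfn (Suc n) f" and ex: "\<And>xs. length xs = n \<Longrightarrow> \<exists>k. f (k # xs) = 0"
  shows "recfn n (\<lambda>xs. LEAST k. f (k # xs) = 0)"
proof -
  obtain p where p: "\<And>xs. length xs = Suc n \<Longrightarrow> recf_eval p xs (f xs)"
    using f unfolding recfn_def by blast
  have "recf_eval (Mu p) xs (LEAST k. f (k # xs) = 0)" if l: "length xs = n" for xs
  proof (rule recf_eval.mu)
    show "recf_eval p ((LEAST k. f (k # xs) = 0) # xs) 0"
      using p[of "(LEAST k. f (k # xs) = 0) # xs"] LeastI_ex[OF ex[OF l]] l by simp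
    show "\<forall>m<LEAST k. f (k # xs) = 0. \<exists>y. recf_eval p (m # xs) (Suc y)"
    proof (intro allI impI)
      fix m assume "m < (LEAST k. f (k # xs) = 0)"
      then have "f (m # xs) \<noteq> 0" by (rule not_less_Least)
      then obtain y where "f (m # xs) = Suc y" using not0_implies_Suc by blast
      with p[of "m # xs"] l show "\<exists>y. recf_eval p (m # xs) (Suc y)" by auto
    qed
  qed
  then show ?thesis unfolding recfn_def by blast
qed

lemma recfn_add: "recfn n f \<Longrightarrow> recfn n g \<Longrightarrow> recfn n (\<lambda>xs. f xs + g xs)"
proof -
  have "rec_nat (m::nat) (\<lambda>k y. Suc y) j = m + j" for m j
    by (induction j) auto
  then have "recfn (Suc (Suc 0)) (\<lambda>xs. xs ! 1 + xs ! 0)"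
    using recfn_rec_nat[OF recfn_proj[of 0 "Suc 0"] recfn_Suc[OF recfn_proj[of 1 "Suc (Suc (Suc 0))"]]]
    by (auto elim!: recfn_cong simp: numeral_eq_Suc length_Suc_conv)
  from recfn_comp2[OF this, of n g f]
  show "recfn n f \<Longrightarrow> recfn n g \<Longrightarrow> recfn n (\<lambda>xs. f xs + g xs)" by simp
qed

lemma recfn_pred: "recfn n f \<Longrightarrow> recfn n (\<lambda>xs. f xs - 1)"
proof -
  have "rec_nat 0 (\<lambda>k y. k) j = j - 1" for j
    by (cases j) auto
  then have "recfn (Suc 0) (\<lambda>xs. xs ! 0 - 1)"
    using recfn_rec_nat[OF recfn_zero[of 0] recfn_proj[of 0 "Suc (Suc 0)"]]
    by (auto elim!: recfn_cong simp: numeral_eq_Suc length_Suc_conv)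
  from recfn_comp1[OF this, of n f]
  show "recfn n f \<Longrightarrow> recfn n (\<lambda>xs. f xs - 1)" by simp
qed

lemma recfn_diff: "recfn n f \<Longrightarrow> recfn n g \<Longrightarrow> recfn n (\<lambda>xs. f xs - g xs)"
proof -
  have "rec_nat (m::nat) (\<lambda>k y. y - Suc 0) j = m - j" for m j
    by (induction j) auto
  \<comment> \<open>\<open>PrimRec\<close> recurses on the head of the argument list, so the
    subtrahend is placed first.\<close>
  then have "recfn (Suc (Suc 0)) (\<lambda>xs. xs ! 1 - xs ! 0)"
    using recfn_rec_nat[OF recfn_proj[of 0 "Suc 0"] recfn_pred[OF recfn_proj[of 1 "Suc (Suc (Suc 0))"]]]
    by (auto elim!: recfn_cong simp: numeral_eq_Suc length_Suc_conv)
  from recfn_comp2[OF this, of n g f]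
  show "recfn n f \<Longrightarrow> recfn n g \<Longrightarrow> recfn n (\<lambda>xs. f xs - g xs)" by simp
qed

lemma recfn_triangle: "recfn n f \<Longrightarrow> recfn n (\<lambda>xs. triangle (f xs))"
proof -
  have "rec_nat 0 (\<lambda>k y. y + Suc k) j = triangle j" for j
    by (induction j) auto
  then have "recfn (Suc 0) (\<lambda>xs. triangle (xs ! 0))"
    using recfn_rec_nat[OF recfn_zero[of 0] recfn_add[OF recfn_proj[of 1 "Suc (Suc 0)"] recfn_Suc[OF recfn_proj[of 0 "Suc (Suc 0)"]]]]
    by (auto elim!: recfn_cong simp: numeral_eq_Suc length_Suc_conv)
  from recfn_comp1[OF this, of n f]
  show "recfn n f \<Longrightarrow> recfn n (\<lambda>xs. triangle (f xs))" by simp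
qed

lemma recfn_prod_encode:
  "recfn n f \<Longrightarrow> recfn n g \<Longrightarrow> recfn n (\<lambda>xs. prod_encode (f xs, g xs))"
  unfolding prod_encode_def by (simp add: recfn_add recfn_triangle)

lemma triangle_mono: "i \<le> j \<Longrightarrow> triangle i \<le> triangle j"
  by (induction rule: dec_induct) auto

text \<open>The code of \<open>(i, j)\<close> is \<open>triangle (i + j) + i\<close>, so
  \<open>i + j\<close> is the least \<open>s\<close> for which the code is below
  \<open>triangle (Suc s)\<close>. Truncated subtraction puts this comparison into the form searched
  by \<open>Mu\<close>.\<close>

lemma Least_triangle_prod_encode:
  "(LEAST s. Suc (prod_encode (i, j)) - triangle (Suc s) = 0) = i + j"
proof (rule Least_equality)
  fix s assume *: "Suc (prod_encode (i, j)) - triangle (Suc s) = 0"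
  show "i + j \<le> s"
  proof (rule ccontr)
    assume "\<not> i + j \<le> s"
    then have "triangle (Suc s) \<le> triangle (i + j)" by (intro triangle_mono) simp
    with * show False by (simp add: prod_encode_def)
  qed
qed (simp add: prod_encode_def)

lemma recfn_prod_decode:
  "recfn (Suc 0) (\<lambda>xs. fst (prod_decode (xs ! 0)))" (is ?fst)
  "recfn (Suc 0) (\<lambda>xs. snd (prod_decode (xs ! 0)))" (is ?snd)
proof -
  let ?s = "\<lambda>z. LEAST s. Suc z - triangle (Suc s) = 0"
  have ex: "\<exists>s. Suc z - triangle (Suc s) = 0" for z
    by (rule exI[of _ z]) simp
  have "recfn (Suc (Suc 0)) (\<lambda>xs. Suc (xs ! 1) - triangle (Suc (xs ! 0)))"
    by (intro recfn_diff recfn_Suc recfn_triangle recfn_proj) auto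
  from recfn_mu[OF this] ex have "recfn (Suc 0) (\<lambda>xs. LEAST k. Suc ((k # xs) ! 1) - triangle (Suc ((k # xs) ! 0)) = 0)"
    by (auto simp: length_Suc_conv)
  then have s: "recfn (Suc 0) (\<lambda>xs. ?s (xs ! 0))" by simp
  have dec: "fst (prod_decode z) = z - triangle (?s z) \<and> snd (prod_decode z) = ?s z - (z - triangle (?s z))" for z
  proof -
    obtain i j where z: "z = prod_encode (i, j)" by (metis prod_decode_inverse surj_pair)
    have t: "triangle (i + j) = z - i" "i \<le> z" unfolding z by (simp_all add: prod_encode_def)
    show ?thesis unfolding z Least_triangle_prod_encode t(1)[unfolded z]
      using t(2) unfolding z by simp
  qed
  show ?fst ?snd unfolding dec[THEN conjunct1] dec[THEN conjunct2]
    by (intro recfn_diff recfn_triangle recfn_proj s; simp)+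
qed

section \<open>Bijective encodings of data and computable functions between them\<close>

class encodable =
  fixes enc :: "'a \<Rightarrow> nat" and dec :: "nat \<Rightarrow> 'a"
  assumes dec_enc [simp]: "dec (enc x) = x" and enc_dec [simp]: "enc (dec n) = n"
begin

lemma enc_inject [simp]: "enc x = enc y \<longleftrightarrow> x = y"
  by (metis dec_enc)

end

instantiation nat :: encodable
begin
definition "enc n = (n::nat)"
definition "dec n = (n::nat)"
instance by standard (auto simp: enc_nat_def dec_nat_def)
end

instantiation prod :: (encodable, encodable) encodable
begin
definition "enc z = prod_encode (map_prod enc enc z)"
definition "dec n = map_prod dec dec (prod_decode n)"
instance by standard (auto simp: enc_prod_def dec_prod_def prod.map_comp o_def map_prod.identity[unfolded id_def])
end

instantiation sum :: (encodable, encodable) encodable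
begin
definition "enc z = sum_encode (map_sum enc enc z)"
definition "dec n = map_sum dec dec (sum_decode n)"
instance by standard (auto simp: enc_sum_def dec_sum_def sum.map_comp o_def map_sum.identity[unfolded id_def])
end

instantiation list :: (encodable) encodable
begin
definition "enc xs = list_encode (map enc xs)"
definition "dec n = map dec (list_decode n)"
instance by standard (auto simp: enc_list_def dec_list_def o_def)
end

text \<open>As encodings are bijections with \<open>nat\<close>, computability is total
  recursiveness of the corresponding function on numbers, and both \<open>enc\<close> and
  \<open>dec\<close> are the identity on codes.\<close>

definition computable :: "('a::encodable \<Rightarrow> 'b::encodable) \<Rightarrow> bool" where
  "computable f \<longleftrightarrow> (\<exists>p. \<forall>x. recf_eval p [enc x] (enc (f x)))"

lemma computable_iff_recfn: "computable f \<longleftrightarrow> recfn (Suc 0) (\<lambda>xs. enc (f (dec (xs ! 0))))"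
proof -
  have "(\<forall>x. recf_eval p [enc x] (enc (f x))) \<longleftrightarrow> (\<forall>k. recf_eval p [k] (enc (f (dec k))))" for p
    by (metis dec_enc enc_dec)
  moreover have "(\<forall>xs. length xs = Suc 0 \<longrightarrow> P xs) \<longleftrightarrow> (\<forall>k. P [k])" for P :: "nat list \<Rightarrow> bool"
    by (auto simp: length_Suc_conv)
  ultimately show ?thesis unfolding computable_def recfn_def by simp
qed

lemma computable_comp: "computable f \<Longrightarrow> computable g \<Longrightarrow> computable (\<lambda>x. f (g x))"
  unfolding computable_iff_recfn using recfn_comp1[of _ "Suc 0" "\<lambda>xs. enc (g (dec (xs ! 0)))"] by fastforce

lemma computable_id [intro!]: "computable (\<lambda>x. x)"
  unfolding computable_iff_recfn by (simp add: recfn_proj)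

lemma computable_const [intro!]: "computable (\<lambda>x. c)"
proof -
  have "recfn n (\<lambda>xs. k)" for n k
    by (induction k) (auto intro: recfn_zero recfn_Suc)
  then show ?thesis unfolding computable_iff_recfn .
qed

lemma computable_Suc [intro!]: "computable f \<Longrightarrow> computable (\<lambda>x. Suc (f x))"
  unfolding computable_iff_recfn enc_nat_def by (rule recfn_Suc)

lemma computable_Pair [intro!]: "computable f \<Longrightarrow> computable g \<Longrightarrow> computable (\<lambda>x. (f x, g x))"
  unfolding computable_iff_recfn enc_prod_def by (simp add: recfn_prod_encode)

lemma computable_fst [intro!]: "computable f \<Longrightarrow> computable (\<lambda>x. fst (f x))"
  and computable_snd [intro!]: "computable f \<Longrightarrow> computable (\<lambda>x. snd (f x))"
proof -
  have "computable (fst :: 'b \<times> 'c \<Rightarrow> 'b)" "computable (snd :: 'b \<times> 'c \<Rightarrow> 'c)"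
    unfolding computable_iff_recfn using recfn_prod_decode by (auto simp: dec_prod_def)
  then show "computable f \<Longrightarrow> computable (\<lambda>x. fst (f x))" "computable f \<Longrightarrow> computable (\<lambda>x. snd (f x))"
    by (auto intro: computable_comp)
qed

lemma computable_comp_Pair:
  "computable (\<lambda>z. h (fst z) (snd z)) \<Longrightarrow> computable f \<Longrightarrow> computable g \<Longrightarrow> computable (\<lambda>x. h (f x) (g x))"
  using computable_comp[of "\<lambda>z. h (fst z) (snd z)" "\<lambda>x. (f x, g x)"] by auto

lemma computable_enc [intro!]: "computable f \<Longrightarrow> computable (\<lambda>x. enc (f x))"
  unfolding computable_iff_recfn enc_nat_def .

lemma computable_rec_nat:
  assumes h: "computable h" and g: "computable (\<lambda>z. g (fst z) (fst (snd z)) (snd (snd z)))" and t: "computable t"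
  shows "computable (\<lambda>x. rec_nat (h x) (g x) (t x))"
proof -
  let ?h = "\<lambda>xs. enc (h (dec (xs ! 0)))"
  let ?g = "\<lambda>xs. enc ((\<lambda>z. g (fst z) (fst (snd z)) (snd (snd z))) (dec (xs ! 0)))"
  \<comment> \<open>\<open>PrimRec\<close> passes counter, accumulator and parameter in this order;
    \<open>g\<close> expects the parameter first.\<close>
  let ?G = "\<lambda>xs. ?g [prod_encode (xs ! 2, prod_encode (xs ! 0, xs ! 1))]"
  have "recfn (Suc (Suc (Suc 0))) ?G"
    using g unfolding computable_iff_recfn
    by (rule recfn_comp1) (intro recfn_prod_encode recfn_proj; simp)
  with h have *: "recfn (Suc (Suc 0)) (\<lambda>xs. rec_nat (?h (tl xs)) (\<lambda>k y. ?G (k # y # tl xs)) (hd xs))"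
    unfolding computable_iff_recfn by (rule recfn_rec_nat)
  have eq: "rec_nat (?h [enc x]) (\<lambda>k y. ?G [k, y, enc x]) j = enc (rec_nat (h x) (g x) j)" for x j
    by (induction j) (auto simp: dec_prod_def dec_nat_def)
  let ?R = "\<lambda>xs. rec_nat (?h (tl xs)) (\<lambda>k y. ?G (k # y # tl xs)) (hd xs)"
  have "recfn (Suc 0) (\<lambda>xs. ?R [enc (t (dec (xs ! 0))), xs ! 0])"
    by (rule recfn_comp2[OF *]) (use t in \<open>simp_all add: computable_iff_recfn recfn_proj\<close>)
  moreover have "?R [enc (t (dec (xs ! 0))), xs ! 0] = enc (rec_nat (h (dec (xs ! 0))) (g (dec (xs ! 0))) (t (dec (xs ! 0))))" for xs
    using eq[of "dec (xs ! 0)" "t (dec (xs ! 0))"] by (simp add: enc_nat_def)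
  ultimately show ?thesis unfolding computable_iff_recfn by simp
qed

text \<open>Unbounded search through the codes of candidates: totality is exactly the existence
  hypothesis, and no bound on a witness has to be known.\<close>

lemma computable_choice:
  fixes q :: "'a::encodable \<times> 'b::encodable \<Rightarrow> nat"
  assumes q: "computable q" and ex: "\<And>x. \<exists>y. q (x, y) = 0"
  shows "\<exists>f. computable f \<and> (\<forall>x. q (x, f x) = 0)"
proof -
  let ?q = "\<lambda>xs. enc (q (dec (xs ! 0)))"
  let ?Q = "\<lambda>xs. ?q [prod_encode (xs ! 1, xs ! 0)]"
  have "recfn (Suc (Suc 0)) ?Q"
    using q unfolding computable_iff_recfn
    by (rule recfn_comp1) (intro recfn_prod_encode recfn_proj; simp)
  moreover have ex': "\<exists>k. q (x, dec k) = 0" for x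
    using ex[of x] by (metis dec_enc)
  ultimately have *: "recfn (Suc 0) (\<lambda>xs. LEAST k. ?Q (k # xs) = 0)"
    by (intro recfn_mu[of "Suc 0" ?Q]) (auto simp: dec_prod_def enc_nat_def ex')
  define f where "f x = (dec (LEAST k. q (x, dec k) = 0) :: 'b)" for x
  have "computable f"
    unfolding computable_iff_recfn f_def using * by (simp add: dec_prod_def enc_nat_def)
  moreover have "q (x, f x) = 0" for x
    unfolding f_def using LeastI_ex[OF ex'[of x]] by simp
  ultimately show ?thesis by blast
qed

lemma computable_Least:
  fixes q :: "'a::encodable \<Rightarrow> nat \<Rightarrow> nat"
  assumes q: "computable (\<lambda>z. q (fst z) (snd z))" and ex: "\<And>x. \<exists>n. q x n = 0"
  shows "computable (\<lambda>x. LEAST n. q x n = 0)"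
proof -
  let ?q = "\<lambda>xs. enc ((\<lambda>z. q (fst z) (snd z)) (dec (xs ! 0)))"
  let ?Q = "\<lambda>xs. ?q [prod_encode (xs ! 1, xs ! 0)]"
  have "recfn (Suc (Suc 0)) ?Q"
    using q unfolding computable_iff_recfn
    by (rule recfn_comp1) (intro recfn_prod_encode recfn_proj; simp)
  then have "recfn (Suc 0) (\<lambda>xs. LEAST k. ?Q (k # xs) = 0)"
    by (intro recfn_mu[of "Suc 0" ?Q]) (auto simp: dec_prod_def enc_nat_def dec_nat_def ex)
  then show ?thesis
    unfolding computable_iff_recfn by (simp add: dec_prod_def enc_nat_def dec_nat_def)
qed

lemma computable_dec [intro!]: "computable f \<Longrightarrow> computable (\<lambda>x. dec (f x))"
  unfolding computable_iff_recfn by (simp add: enc_nat_def)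

lemma computable_fst_snd [intro!]: "computable fst" "computable snd"
  using computable_fst[OF computable_id] computable_snd[OF computable_id] by simp_all

lemma computable_cong: "computable f \<Longrightarrow> (\<And>x. f x = g x) \<Longrightarrow> computable g"
  using ext[of f g] by simp

lemma computable_add [intro!]:
  fixes f g :: "'a::encodable \<Rightarrow> nat"
  assumes "computable f" "computable g"
  shows "computable (\<lambda>x. f x + g x)"
proof (rule computable_cong)
  show "computable (\<lambda>x. rec_nat (f x) (\<lambda>_. Suc) (g x))"
    using assms by (intro computable_rec_nat) auto
  have "rec_nat m (\<lambda>_. Suc) n = m + n" for m n by (induction n) auto
  then show "rec_nat (f x) (\<lambda>_. Suc) (g x) = f x + g x" for x .
qed

lemma computable_diff [intro!]:
  fixes f g :: "'a::encodable \<Rightarrow> nat"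
  assumes "computable f" "computable g"
  shows "computable (\<lambda>x. f x - g x)"
proof (rule computable_cong)
  let ?pred = "rec_nat 0 (\<lambda>k _. k)"
  show "computable (\<lambda>x. rec_nat (f x) (\<lambda>_ y. ?pred y) (g x))"
    using assms by (intro computable_rec_nat) auto
  have "rec_nat m (\<lambda>_ y. ?pred y) n = m - n" for m n
  proof (induction n)
    case (Suc n)
    have "?pred j = j - 1" for j by (cases j) auto
    with Suc show ?case by simp
  qed simp
  then show "rec_nat (f x) (\<lambda>_ y. ?pred y) (g x) = f x - g x" for x .
qed

section \<open>Decidable predicates, and functions given by finite tables\<close>

definition decidable :: "('a::encodable \<Rightarrow> bool) \<Rightarrow> bool" where
  "decidable P \<longleftrightarrow> computable (\<lambda>x. of_bool (P x) :: nat)"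

lemma computable_If [intro!]:
  assumes "decidable P" "computable f" "computable g"
  shows "computable (\<lambda>x. if P x then f x else g x)"
proof (rule computable_cong)
  show "computable (\<lambda>x. rec_nat (g x) (\<lambda>_ _. f x) (of_bool (P x)))"
    using assms unfolding decidable_def by (intro computable_rec_nat) (auto intro: computable_comp[of f])
qed auto

lemma decidable_const [intro!]: "decidable (\<lambda>x. b)"
  unfolding decidable_def by auto

lemma decidable_eq_0 [intro!]: "computable f \<Longrightarrow> decidable (\<lambda>x. f x = (0::nat))"
  unfolding decidable_def
  by (rule computable_cong[where f = "\<lambda>x. 1 - f x"]) (auto intro!: computable_diff)

lemma decidable_not [intro!]: "decidable P \<Longrightarrow> decidable (\<lambda>x. \<not> P x)"
  unfolding decidable_def
  by (rule computable_cong[where f = "\<lambda>x. 1 - of_bool (P x)"]) (auto intro!: computable_diff)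

lemma decidable_conj [intro!]:
  assumes "decidable P" "decidable Q"
  shows "decidable (\<lambda>x. P x \<and> Q x)"
proof -
  have "computable (\<lambda>x. if P x then of_bool (Q x) else 0 :: nat)"
    using assms by (intro computable_If) (auto simp: decidable_def)
  then show ?thesis
    unfolding decidable_def by (rule computable_cong) auto
qed

lemma decidable_disj [intro!]:
  assumes "decidable P" "decidable Q"
  shows "decidable (\<lambda>x. P x \<or> Q x)"
  using decidable_not[OF decidable_conj[OF decidable_not[OF assms(1)] decidable_not[OF assms(2)]]]
  by simp

lemma decidable_le [intro!]:
  "computable f \<Longrightarrow> computable g \<Longrightarrow> decidable (\<lambda>x. f x \<le> (g x :: nat))"
  using decidable_eq_0[of "\<lambda>x. f x - g x"] by (auto intro: computable_diff)

lemma decidable_less [intro!]: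
  "computable f \<Longrightarrow> computable g \<Longrightarrow> decidable (\<lambda>x. f x < (g x :: nat))"
  using decidable_not[OF decidable_le[of g f]] by (simp add: not_le)

lemma decidable_eq [intro!]:
  assumes "computable f" "computable g"
  shows "decidable (\<lambda>x. f x = g x)"
proof -
  have "decidable (\<lambda>x. enc (f x) \<le> enc (g x) \<and> enc (g x) \<le> enc (f x))"
    using assms by auto
  then show ?thesis by (simp add: eq_iff[symmetric])
qed

text \<open>A nested case distinction, with no assumption on \<open>f\<close>. Through it, data
  chosen nonconstructively from the finite Garside structure enter the programs.\<close>

lemma computable_finite_table:
  "finite A \<Longrightarrow> computable (\<lambda>x. if x \<in> A then f x else c)"
proof (induction A rule: finite_induct)
  case (insert a A)
  have "computable (\<lambda>x. if x = a then f a else if x \<in> A then f x else c)"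
    using insert.IH by auto
  then show ?case by (rule computable_cong) auto
qed auto

lemma decidable_mem_finite: "finite A \<Longrightarrow> computable f \<Longrightarrow> decidable (\<lambda>x. f x \<in> A)"
proof -
  assume A: "finite A" and f: "computable f"
  have "computable (\<lambda>x. if x \<in> A then 1 else 0 :: nat)" using A by (rule computable_finite_table)
  from computable_comp[OF this f] show ?thesis unfolding decidable_def by (simp add: of_bool_def)
qed

section \<open>Recursion over encoded lists\<close>

lemma enc_Cons: "enc (x # xs) = Suc (enc (enc x, enc xs))"
  by (simp add: enc_list_def enc_prod_def enc_nat_def)

lemma enc_Nil [simp]: "enc [] = 0"
  by (simp add: enc_list_def)

lemma computable_Cons [intro!]:
  assumes "computable f" "computable g"
  shows "computable (\<lambda>x. f x # g x)"
proof -
  have "computable (\<lambda>x. dec (Suc (enc (enc (f x), enc (g x)))) :: 'b list)"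
    using assms by auto
  then show ?thesis by (simp flip: enc_Cons)
qed

lemma computable_hd: "computable f \<Longrightarrow> computable (\<lambda>x. hd (f x))"
  and computable_tl: "computable f \<Longrightarrow> computable (\<lambda>x. tl (f x))"
proof -
  let ?d = "\<lambda>xs :: 'b list. dec (enc xs - 1) :: nat \<times> nat"
  have "computable (\<lambda>xs :: 'b list. if xs = [] then hd [] else dec (fst (?d xs)))"
    by auto
  then have hd: "computable (hd :: 'b list \<Rightarrow> 'b)"
  proof (rule computable_cong)
    show "(if xs = [] then hd [] else dec (fst (?d xs))) = hd xs" for xs
      by (cases xs) (auto simp: enc_Cons)
  qed
  have "computable (\<lambda>xs :: 'b list. if xs = [] then [] else dec (snd (?d xs)))"
    by auto
  then have tl: "computable (tl :: 'b list \<Rightarrow> 'b list)"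
  proof (rule computable_cong)
    show "(if xs = [] then [] else dec (snd (?d xs))) = tl xs" for xs
      by (cases xs) (auto simp: enc_Cons)
  qed
  show "computable f \<Longrightarrow> computable (\<lambda>x. hd (f x))" "computable f \<Longrightarrow> computable (\<lambda>x. tl (f x))"
    using hd tl by (auto intro: computable_comp)
qed

lemma length_le_enc: "length xs \<le> enc xs"
proof (induction xs)
  case (Cons x xs)
  have "enc xs \<le> enc (enc x, enc xs)"
    by (simp add: enc_prod_def enc_nat_def le_prod_encode_2)
  with Cons show ?case by (simp add: enc_Cons)
qed simp

lemma computable_funpow:
  fixes f :: "'a::encodable \<Rightarrow> 'b::encodable \<Rightarrow> 'b"
  assumes "computable (\<lambda>z. f (fst z) (snd z))" "computable n" "computable s"
  shows "computable (\<lambda>x. (f x ^^ n x) (s x))"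
proof (rule computable_cong)
  show "computable (\<lambda>x. rec_nat (s x) (\<lambda>_. f x) (n x))"
    using assms(2,3)
    by (intro computable_rec_nat) (auto intro: computable_comp_Pair[OF assms(1)])
  have "rec_nat t (\<lambda>_. h) j = (h ^^ j) t" for t :: 'b and h and j :: nat
    by (induction j) auto
  then show "rec_nat (s x) (\<lambda>_. f x) (n x) = (f x ^^ n x) (s x)" for x by simp
qed

text \<open>Recursion is available only over numbers, so a step on the pair of remaining list and
  accumulator is iterated \<open>enc (xs x)\<close> times. The code of a list bounds its length, and
  surplus steps do nothing on the empty list.\<close>

lemma computable_fold:
  assumes f: "computable (\<lambda>z. f (fst z) (fst (snd z)) (snd (snd z)))"
    and xs: "computable xs" and s: "computable s"
  shows "computable (\<lambda>x. fold (f x) (xs x) (s x))"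
proof (rule computable_cong)
  define step where
    "step x z = (if fst z = [] then z else (tl (fst z), f x (hd (fst z)) (snd z)))" for x z
  have "computable (\<lambda>z. f (fst z) (hd (fst (snd z))) (snd (snd z)))"
    by (rule computable_comp[OF f, of "\<lambda>z. (fst z, hd (fst (snd z)), snd (snd z))", simplified])
       (auto intro!: computable_hd)
  then have "computable (\<lambda>z. step (fst z) (snd z))"
    unfolding step_def by (auto intro!: computable_tl)
  then show "computable (\<lambda>x. snd ((step x ^^ enc (xs x)) (xs x, s x)))"
    using xs s by (auto intro!: computable_funpow)
  have Nil: "(step x ^^ n) ([], t) = ([], t)" for x n t
    by (induction n) (auto simp: step_def)
  have "(step x ^^ n) (ys, t) = ([], fold (f x) ys t)" if "length ys \<le> n" for x n ys t
    using that
  proof (induction n arbitrary: ys t)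
    case (Suc n)
    show ?case
    proof (cases ys)
      case Cons
      then show ?thesis using Suc by (simp add: funpow_Suc_right step_def del: funpow.simps)
    qed (simp add: Nil del: funpow.simps)
  qed simp
  then show "snd ((step x ^^ enc (xs x)) (xs x, s x)) = fold (f x) (xs x) (s x)" for x
    by (simp add: length_le_enc)
qed

lemma computable_rev [intro!]:
  assumes "computable f"
  shows "computable (\<lambda>x. rev (f x))"
proof (rule computable_cong)
  show "computable (\<lambda>x. fold Cons (f x) [])"
    using assms by (auto intro!: computable_fold)
qed (simp add: fold_Cons_rev)

lemma computable_append [intro!]:
  assumes "computable f" "computable g"
  shows "computable (\<lambda>x. f x @ g x)"
proof (rule computable_cong)
  show "computable (\<lambda>x. fold Cons (rev (f x)) (g x))"
    using assms by (auto intro!: computable_fold)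
qed (simp add: fold_Cons_rev)

lemma computable_map:
  fixes g :: "'a::encodable \<Rightarrow> 'b::encodable \<Rightarrow> 'c::encodable"
  assumes g: "computable (\<lambda>z. g (fst z) (snd z))" and xs: "computable xs"
  shows "computable (\<lambda>x. map (g x) (xs x))"
proof (rule computable_cong)
  have "computable (\<lambda>z. g (fst z) (fst (snd z)))"
    by (rule computable_comp_Pair[OF g]) auto
  then show "computable (\<lambda>x. rev (fold (\<lambda>a s. g x a # s) (xs x) []))"
    using xs by (auto intro!: computable_fold)
  have "fold (\<lambda>a s. h a # s) ys s = rev (map h ys) @ s" for h and ys :: "'b list" and s :: "'c list"
    by (induction ys arbitrary: s) auto
  then show "rev (fold (\<lambda>a s. g x a # s) (xs x) []) = map (g x) (xs x)" for x
    by simp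
qed

lemma computable_concat [intro!]:
  assumes "computable f"
  shows "computable (\<lambda>x. concat (f x))"
proof (rule computable_cong)
  show "computable (\<lambda>x. fold (\<lambda>a s. s @ a) (f x) [])"
    using assms by (auto intro!: computable_fold)
  have "fold (\<lambda>a s. s @ a) ys s = s @ concat ys" for ys and s :: "'b list"
    by (induction ys arbitrary: s) auto
  then show "fold (\<lambda>a s. s @ a) (f x) [] = concat (f x)" for x by simp
qed

lemma decidable_Ball_set:
  fixes P :: "'a::encodable \<Rightarrow> 'b::encodable \<Rightarrow> bool"
  assumes P: "decidable (\<lambda>z. P (fst z) (snd z))" and xs: "computable xs"
  shows "decidable (\<lambda>x. \<forall>y\<in>set (xs x). P x y)"
  unfolding decidable_def
proof (rule computable_cong)
  have "decidable (\<lambda>z. P (fst z) (fst (snd z)))"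
    unfolding decidable_def by (rule computable_comp_Pair[OF P[unfolded decidable_def]]) auto
  then show "computable (\<lambda>x. fold (\<lambda>y s. if P x y then s else 0) (xs x) (1::nat))"
    using xs by (auto intro!: computable_fold)
  have "fold (\<lambda>y s. if Q y then s else 0) ys s = (if \<forall>y\<in>set ys. Q y then s else 0)"
    for Q and ys :: "'b list" and s :: nat
    by (induction ys arbitrary: s) auto
  then show "fold (\<lambda>y s. if P x y then s else 0) (xs x) (1::nat) = of_bool (\<forall>y\<in>set (xs x). P x y)" for x
    by (simp only: of_bool_def)
qed

lemma decidable_Bex_set:
  assumes P: "decidable (\<lambda>z. P (fst z) (snd z))" and xs: "computable xs"
  shows "decidable (\<lambda>x. \<exists>y\<in>set (xs x). P x y)"
  using decidable_not[OF decidable_Ball_set[of "\<lambda>x y. \<not> P x y", OF decidable_not[OF P] xs]]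
  by simp

section \<open>Words and an algorithm for the infimum\<close>

context garside_group
begin

text \<open>Pasting of lcm squares: the join of \<open>a\<close> with a product is found one factor
  at a time, continuing with the complement \<open>c\<close> that is left of \<open>a\<close> after
  the factor \<open>b\<close>.\<close>

lemma is_lub_comp:
  assumes ab: "is_lub a b (b \<otimes> c)" and cd: "is_lub c d e"
    and carr: "a \<in> carrier G" "b \<in> carrier G" "c \<in> carrier G" and d: "d \<in> P"
  shows "is_lub a (b \<otimes> d) (b \<otimes> e)"
  unfolding is_lub_def
proof (intro conjI ballI impI)
  have e: "e \<in> carrier G" "c \<preceq> e" "d \<preceq> e" using cd by (auto simp: is_lub_def)
  show "b \<otimes> e \<in> carrier G" "b \<otimes> d \<preceq> b \<otimes> e" using e carr d by simp_all
  have "a \<preceq> b \<otimes> c" using ab by (simp add: is_lub_def)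
  then show "a \<preceq> b \<otimes> e" using e carr prec_trans[of a "b \<otimes> c" "b \<otimes> e"] by simp
  fix u assume u: "u \<in> carrier G" "a \<preceq> u" "b \<otimes> d \<preceq> u"
  have shift: "b \<otimes> v \<preceq> u \<longleftrightarrow> v \<preceq> inv b \<otimes> u" if "v \<in> carrier G" for v
    using prec_mult_left[of v "inv b \<otimes> u" b] that u carr by simp
  have "b \<preceq> u" using u carr d prec_mult_pos[of b d] prec_trans[of b "b \<otimes> d" u] by simp
  then have "b \<otimes> c \<preceq> u" using ab u by (simp add: is_lub_def)
  then have "e \<preceq> inv b \<otimes> u" using lub_prec[OF cd] u carr d shift by simp
  then show "b \<otimes> e \<preceq> u" using shift e by simp
qed

lemma is_lub_unique: "is_lub x y z \<Longrightarrow> is_lub x y z' \<Longrightarrow> z = z'"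
  using prec_antisym by (auto simp: is_lub_def)

lemma is_lub_commute: "is_lub x y z \<longleftrightarrow> is_lub y x z"
  by (auto simp: is_lub_def)

text \<open>Since \<open>\<Delta> \<preceq> s \<otimes> \<Delta>\<close>, both \<open>s\<close> and
  \<open>t\<close> lie below \<open>s \<otimes> \<Delta>\<close>. So does their join
  \<open>s \<otimes> u\<close>, and cancelling \<open>s\<close> leaves
  \<open>u \<preceq> \<Delta>\<close>.\<close>

lemma simple_complement:
  assumes "s \<in> S" "t \<in> S"
  shows "\<exists>u\<in>S. is_lub s t (s \<otimes> u)"
proof -
  have c: "s \<in> carrier G" "t \<in> carrier G" using assms simples_subset by auto
  obtain z where z: "is_lub s t z" using lub_ex c by blast
  then have zc: "z \<in> carrier G" "s \<preceq> z" by (auto simp: is_lub_def)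
  then obtain u where u: "u \<in> P" "z = s \<otimes> u" using c by (auto elim: prec_obtain)
  have "s \<preceq> \<Delta>" "t \<preceq> \<Delta>" "\<one> \<preceq> s" using assms c simple_iff_prec by auto
  have "inv \<Delta> \<otimes> s \<otimes> \<Delta> \<in> P" using simple_conj_Delta assms simple_pos by blast
  then have "\<Delta> \<preceq> s \<otimes> \<Delta>" using c by (simp add: prec_def m_assoc)
  then have "s \<preceq> s \<otimes> \<Delta>" "t \<preceq> s \<otimes> \<Delta>"
    using \<open>t \<preceq> \<Delta>\<close> c Delta_pos prec_mult_pos prec_trans[of t \<Delta> "s \<otimes> \<Delta>"] by simp_all
  then have "s \<otimes> u \<preceq> s \<otimes> \<Delta>" using lub_prec[OF z, of "s \<otimes> \<Delta>"] c u by simp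
  then have "u \<preceq> \<Delta>" using c u by simp
  then have "u \<in> S" using u simple_iff_prec one_prec by simp
  with z u show ?thesis by blast
qed

text \<open>Conjugation by powers of \<open>\<Delta>\<close> gives self-maps of the finite set
  \<open>S\<close>, so two different exponents act alike; the power with their difference as
  exponent commutes with \<open>S\<close>, hence with \<open>P\<close> and with all
  fractions.\<close>

lemma central_power_ex: "\<exists>e>0. \<forall>x\<in>carrier G. D (int e) \<otimes> x = x \<otimes> D (int e)"
proof -
  define f where "f k = restrict (\<lambda>s. inv (D (int k)) \<otimes> s \<otimes> D (int k)) S" for k :: nat
  have "range f \<subseteq> S \<rightarrow>\<^sub>E S" using simple_conj_D by (auto simp: f_def)
  moreover have "finite (S \<rightarrow>\<^sub>E S)" using simples_finite by (intro finite_PiE) auto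
  ultimately have "\<not> inj f" using finite_subset finite_imageD infinite_UNIV_nat by blast
  then obtain i j where ij: "i < j" "f i = f j" unfolding inj_def by (metis linorder_neqE_nat)
  define e where "e = j - i"
  have ej: "D (int j) = D (int i) \<otimes> D (int e)" using ij D_mult[of "int i" "int e"] by (simp add: e_def)
  have S: "D (int e) \<otimes> s = s \<otimes> D (int e)" if "s \<in> S" for s
  proof -
    have s: "s \<in> carrier G" using that simples_subset by blast
    define t where "t = inv (D (int i)) \<otimes> s \<otimes> D (int i)"
    have t: "t \<in> carrier G" "s \<otimes> D (int i) = D (int i) \<otimes> t" using s by (simp_all add: t_def m_assoc)
    have "inv (D (int j)) \<otimes> s \<otimes> D (int j) = t"
      using fun_cong[OF ij(2), of s] that by (simp add: f_def t_def)
    then have "s \<otimes> D (int j) = D (int j) \<otimes> t"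
      using s by (metis Delta_carrier int_pow_closed inv_closed inv_mult_cancel(2) m_assoc m_closed)
    then have "s \<otimes> (D (int e) \<otimes> D (int i)) = D (int e) \<otimes> (D (int i) \<otimes> t)"
      unfolding ej D_commute[of "int i"] using t s by (simp add: m_assoc)
    then have "(s \<otimes> D (int e)) \<otimes> D (int i) = (D (int e) \<otimes> s) \<otimes> D (int i)"
      using s t by (simp add: m_assoc)
    then show ?thesis using s by simp
  qed
  have P: "D (int e) \<otimes> x = x \<otimes> D (int e)" if "x \<in> P" for x
    using that
  proof (induction rule: submonoid_gen.induct)
    case (mult s x)
    have s: "s \<in> carrier G" using mult simple_pos by simp
    have "D (int e) \<otimes> (s \<otimes> x) = (s \<otimes> D (int e)) \<otimes> x" using s mult S by (simp flip: m_assoc)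
    also have "\<dots> = s \<otimes> (D (int e) \<otimes> x)" using s mult by (simp add: m_assoc)
    finally show ?case using s mult by (simp add: m_assoc)
  qed simp
  have "D (int e) \<otimes> x = x \<otimes> D (int e)" if x: "x \<in> carrier G" for x
  proof -
    obtain a b where ab: "a \<in> P" "b \<in> P" "x = a \<otimes> inv b" using x fractions by auto
    have "b \<otimes> D (int e) = D (int e) \<otimes> b" using P ab by simp
    then have b: "inv b \<otimes> D (int e) = D (int e) \<otimes> inv b"
      using ab by (metis Delta_carrier int_pow_closed inv_closed inv_mult_cancel(1) m_assoc pos_carrier r_inv r_one m_closed)
    have "D (int e) \<otimes> x = (a \<otimes> D (int e)) \<otimes> inv b" using ab P by (simp flip: m_assoc)
    also have "\<dots> = a \<otimes> (inv b \<otimes> D (int e))" using ab b by (simp add: m_assoc)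
    finally show ?thesis using ab by (simp add: m_assoc)
  qed
  moreover have "e > 0" using ij by (simp add: e_def)
  ultimately show ?thesis by blast
qed

end

section \<open>Words over a numbering of the simple elements\<close>

definition word_inv :: "gword \<Rightarrow> gword" where
  "word_inv w = map (case_sum Inr Inl) (rev w)"

definition conj_word :: "gword \<Rightarrow> gword \<Rightarrow> gword" where
  "conj_word x w = word_inv x @ w @ x"

locale numbered_garside_group = garside_group +
  fixes ss :: "'a list"
  assumes set_ss: "set ss = S"
begin

abbreviation letters :: "(nat + nat) set" where
  "letters \<equiv> {..<length ss} <+> {..<length ss}"

abbreviation val :: "gword \<Rightarrow> 'a" where "val \<equiv> word_val G ss"

definition pos_val :: "nat list \<Rightarrow> 'a" where
  "pos_val U = foldr (\<lambda>i x. ss ! i \<otimes> x) U \<one>"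

lemma pos_val_simps [simp]: "pos_val [] = \<one>" "pos_val (i # U) = ss ! i \<otimes> pos_val U"
  by (simp_all add: pos_val_def)

lemma val_simps [simp]: "val [] = \<one>" "val (l # w) = letter_val G ss l \<otimes> val w"
  by (simp_all add: word_val_def)

lemma nth_simple: "i < length ss \<Longrightarrow> ss ! i \<in> S"
  using set_ss by auto

lemma nth_carrier [simp]: "i < length ss \<Longrightarrow> ss ! i \<in> carrier G"
  using nth_simple simples_subset by blast

lemma simple_index: "s \<in> S \<Longrightarrow> \<exists>i<length ss. ss ! i = s"
  using set_ss by (metis in_set_conv_nth)

lemma pos_val_pos: "set U \<subseteq> {..<length ss} \<Longrightarrow> pos_val U \<in> P"
  by (induction U) (auto simp: simple_pos nth_simple)

lemma pos_val_carrier [simp]: "set U \<subseteq> {..<length ss} \<Longrightarrow> pos_val U \<in> carrier G"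
  using pos_val_pos by simp

lemma pos_word_ex: "p \<in> P \<Longrightarrow> \<exists>U. set U \<subseteq> {..<length ss} \<and> pos_val U = p"
proof (induction rule: submonoid_gen.induct)
  case one
  show ?case by (rule exI[of _ "[]"]) simp
next
  case (mult s x)
  then obtain i U where "i < length ss" "ss ! i = s" "set U \<subseteq> {..<length ss}" "pos_val U = x"
    using simple_index by blast
  then show ?case by (intro exI[of _ "i # U"]) simp
qed

lemma pos_val_append:
  "set U \<subseteq> {..<length ss} \<Longrightarrow> set V \<subseteq> {..<length ss} \<Longrightarrow> pos_val (U @ V) = pos_val U \<otimes> pos_val V"
  by (induction U) (auto simp: m_assoc)

lemma letter_val_carrier [simp]: "l \<in> letters \<Longrightarrow> letter_val G ss l \<in> carrier G"
  by (auto simp: letter_val_def)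

lemma val_carrier [simp]: "set w \<subseteq> letters \<Longrightarrow> val w \<in> carrier G"
  by (induction w) auto

lemma val_append:
  "set w \<subseteq> letters \<Longrightarrow> set w' \<subseteq> letters \<Longrightarrow> val (w @ w') = val w \<otimes> val w'"
  by (induction w) (auto simp: m_assoc)

lemma set_word_inv: "set w \<subseteq> letters \<Longrightarrow> set (word_inv w) \<subseteq> letters"
  by (auto simp: word_inv_def)

lemma val_word_inv: "set w \<subseteq> letters \<Longrightarrow> val (word_inv w) = inv (val w)"
proof (induction w)
  case (Cons l w)
  have l: "case_sum Inr Inl l \<in> letters" using Cons by auto
  have "val (word_inv (l # w)) = val (word_inv w) \<otimes> val [case_sum Inr Inl l]"
    using Cons set_word_inv[of w] l val_append[of "word_inv w" "[case_sum Inr Inl l]"] by (simp add: word_inv_def)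
  also have "val [case_sum Inr Inl l] = inv (letter_val G ss l)"
    using Cons by (auto simp: letter_val_def)
  finally show ?case using Cons by (simp add: inv_mult_group)
qed (simp add: word_inv_def)

lemma set_conj_word: "set x \<subseteq> letters \<Longrightarrow> set w \<subseteq> letters \<Longrightarrow> set (conj_word x w) \<subseteq> letters"
  using set_word_inv by (auto simp: conj_word_def)

lemma val_conj_word:
  "set x \<subseteq> letters \<Longrightarrow> set w \<subseteq> letters \<Longrightarrow> val (conj_word x w) = inv (val x) \<otimes> val w \<otimes> val x"
  using set_word_inv[of x] by (simp add: conj_word_def val_append val_word_inv m_assoc)

lemma val_map_Inl: "set U \<subseteq> {..<length ss} \<Longrightarrow> set (map Inl U) \<subseteq> letters \<and> val (map Inl U) = pos_val U"
  by (induction U) (auto simp: letter_val_def)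

lemma word_ex:
  assumes "x \<in> carrier G"
  shows "\<exists>w. set w \<subseteq> letters \<and> val w = x"
proof -
  obtain a b where ab: "a \<in> P" "b \<in> P" "x = a \<otimes> inv b" using assms fractions by auto
  obtain U V where UV: "set U \<subseteq> {..<length ss}" "pos_val U = a" "set V \<subseteq> {..<length ss}" "pos_val V = b"
    using pos_word_ex ab by meson
  let ?w = "map Inl U @ word_inv (map Inl V)"
  have "set ?w \<subseteq> letters" "val ?w = x"
    using UV ab val_map_Inl[of U] val_map_Inl[of V] set_word_inv[of "map Inl V"]
    by (auto simp: val_append val_word_inv)
  then show ?thesis by blast
qed

end

text \<open>The complement of \<open>x\<close> in \<open>y\<close> is the element \<open>u\<close> for which \<open>x \<otimes> u\<close> is the join of \<open>x\<close> and \<open>y\<close>.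
  Complements of simple elements are simple, so the two complements of a simple element and a positive
  word are found letter by letter from a finite table; \<open>\<Delta>\<close> divides the word iff the
  complement of the word in \<open>\<Delta>\<close> is trivial. Negative letters are first removed by multiplying with
  powers of a central power of \<open>\<Delta>\<close>.\<close>

context numbered_garside_group
begin

definition complement :: "nat \<times> nat \<Rightarrow> nat" where
  "complement z = (if z \<in> {..<length ss} \<times> {..<length ss}
     then SOME k. k < length ss \<and> is_lub (ss ! fst z) (ss ! snd z) (ss ! fst z \<otimes> ss ! k) else 0)"

definition complement_word :: "nat \<Rightarrow> nat list \<Rightarrow> nat \<times> nat list" where
  "complement_word i U =
    fold (\<lambda>j z. (complement (j, fst z), snd z @ [complement (fst z, j)])) U (i, [])"

lemma complement:
  assumes "i < length ss" "j < length ss"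
  shows "complement (i, j) < length ss" "is_lub (ss ! i) (ss ! j) (ss ! i \<otimes> ss ! complement (i, j))"
proof -
  obtain u where "u \<in> S" "is_lub (ss ! i) (ss ! j) (ss ! i \<otimes> u)"
    using simple_complement assms nth_simple by blast
  then have "\<exists>k. k < length ss \<and> is_lub (ss ! i) (ss ! j) (ss ! i \<otimes> ss ! k)"
    using simple_index by blast
  from someI_ex[OF this] show "complement (i, j) < length ss"
      "is_lub (ss ! i) (ss ! j) (ss ! i \<otimes> ss ! complement (i, j))"
    using assms by (simp_all add: complement_def)
qed

text \<open>Induction by pasting: at a letter \<open>j\<close>, the simple element
  \<open>ss ! i\<close> is replaced by what is left of it, \<open>complement (j, i)\<close>, while
  \<open>complement (i, j)\<close> is appended to the output word. The accumulator \<open>W\<close>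
  is generalised for this.\<close>

lemma complement_word_aux:
  assumes "i < length ss" "set U \<subseteq> {..<length ss}"
  shows "\<exists>k V. fold (\<lambda>j z. (complement (j, fst z), snd z @ [complement (fst z, j)])) U (i, W) = (k, W @ V) \<and>
    k < length ss \<and> set V \<subseteq> {..<length ss} \<and>
    is_lub (ss ! i) (pos_val U) (ss ! i \<otimes> pos_val V) \<and> ss ! i \<otimes> pos_val V = pos_val U \<otimes> ss ! k"
  using assms
proof (induction U arbitrary: i W)
  case Nil
  have "is_lub (ss ! i) \<one> (ss ! i)"
    using Nil nth_simple[of i] simple_pos by (simp add: is_lub_def one_prec)
  with Nil show ?case by simp
next
  case (Cons j U)
  let ?a = "complement (i, j)" and ?b = "complement (j, i)"
  have ij: "i < length ss" "j < length ss" "set U \<subseteq> {..<length ss}" using Cons by auto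
  note a = complement[OF ij(1,2)] and b = complement[OF ij(2,1)]
  have ab: "ss ! i \<otimes> ss ! ?a = ss ! j \<otimes> ss ! ?b"
    using a(2) b(2) is_lub_unique is_lub_commute by blast
  obtain k V where kV: "fold (\<lambda>j z. (complement (j, fst z), snd z @ [complement (fst z, j)])) U (?b, W @ [?a])
      = (k, (W @ [?a]) @ V)" "k < length ss" "set V \<subseteq> {..<length ss}"
      "is_lub (ss ! ?b) (pos_val U) (ss ! ?b \<otimes> pos_val V)" "ss ! ?b \<otimes> pos_val V = pos_val U \<otimes> ss ! k"
    using Cons.IH[OF b(1) ij(3)] by blast
  have "is_lub (ss ! i) (ss ! j \<otimes> pos_val U) (ss ! j \<otimes> (ss ! ?b \<otimes> pos_val V))"
    using a(2) kV(4) ij b(1) pos_val_pos unfolding ab by (intro is_lub_comp) auto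
  moreover have "ss ! j \<otimes> (ss ! ?b \<otimes> pos_val V) = ss ! i \<otimes> (ss ! ?a \<otimes> pos_val V)"
    using ab ij a(1) b(1) kV(3) by (simp flip: m_assoc)
  moreover have "ss ! j \<otimes> (ss ! ?b \<otimes> pos_val V) = ss ! j \<otimes> pos_val U \<otimes> ss ! k"
    using kV ij by (simp add: m_assoc)
  ultimately show ?case using kV a(1) by (intro exI[of _ k] exI[of _ "?a # V"]) auto
qed

lemma complement_word:
  assumes "i < length ss" "set U \<subseteq> {..<length ss}"
  shows "fst (complement_word i U) < length ss" "set (snd (complement_word i U)) \<subseteq> {..<length ss}"
    "is_lub (ss ! i) (pos_val U) (ss ! i \<otimes> pos_val (snd (complement_word i U)))"
    "ss ! i \<otimes> pos_val (snd (complement_word i U)) = pos_val U \<otimes> ss ! fst (complement_word i U)"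
  using complement_word_aux[OF assms, of "[]"] unfolding complement_word_def by auto

definition Delta_index :: nat where "Delta_index = (SOME i. i < length ss \<and> ss ! i = \<Delta>)"

lemma Delta_index: "Delta_index < length ss" "ss ! Delta_index = \<Delta>"
  using someI_ex[of "\<lambda>i. i < length ss \<and> ss ! i = \<Delta>"] simple_index[OF Delta_simple]
  unfolding Delta_index_def by auto

text \<open>Membership of an index in a finite set is decidable. The numbering is not assumed
  injective here, so \<open>\<one>\<close> may have several indices.\<close>

definition Delta_divides :: "nat list \<Rightarrow> bool" where
  "Delta_divides U \<longleftrightarrow> fst (complement_word Delta_index U) \<in> {i. i < length ss \<and> ss ! i = \<one>}"

definition Delta_quotient :: "nat list \<Rightarrow> nat list" where
  "Delta_quotient U = snd (complement_word Delta_index U)"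

lemma set_Delta_quotient: "set U \<subseteq> {..<length ss} \<Longrightarrow> set (Delta_quotient U) \<subseteq> {..<length ss}"
  unfolding Delta_quotient_def using complement_word(2) Delta_index by blast

lemma Delta_divides_iff:
  assumes U: "set U \<subseteq> {..<length ss}"
  shows "Delta_divides U \<longleftrightarrow> \<Delta> \<preceq> pos_val U"
    and "Delta_divides U \<Longrightarrow> pos_val U = \<Delta> \<otimes> pos_val (Delta_quotient U)"
proof -
  note c = complement_word[OF Delta_index(1) U, unfolded Delta_index(2)]
  let ?t = "ss ! fst (complement_word Delta_index U)"
  have d: "Delta_divides U \<longleftrightarrow> ?t = \<one>" using c(1) by (simp add: Delta_divides_def)
  have t: "?t \<in> carrier G" "?t \<in> S" using c(1) nth_simple by simp_all
  show "Delta_divides U \<longleftrightarrow> \<Delta> \<preceq> pos_val U"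
  proof
    assume "Delta_divides U"
    then have "\<Delta> \<otimes> pos_val (snd (complement_word Delta_index U)) = pos_val U" using d c(4) U by simp
    then show "\<Delta> \<preceq> pos_val U" using c(3) by (simp add: is_lub_def)
  next
    assume "\<Delta> \<preceq> pos_val U"
    then have "pos_val U \<otimes> ?t \<preceq> pos_val U \<otimes> \<one>" using lub_prec[OF c(3), of "pos_val U"] c(4) U by simp
    then have "?t \<preceq> \<one>" using U t by (simp only: prec_mult_left one_closed pos_val_carrier)
    then have "?t = \<one>" using prec_antisym[of ?t \<one>] t simple_pos one_prec by simp
    then show "Delta_divides U" using d by simp
  qed
  show "Delta_divides U \<Longrightarrow> pos_val U = \<Delta> \<otimes> pos_val (Delta_quotient U)"
    using d c(4) U by (simp add: Delta_quotient_def)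
qed

text \<open>On valid words this counts how often \<open>\<Delta>\<close> can be divided out; on
  invalid ones the validity test ends the search at once, so that it is total. The
  \<open>of_bool\<close> form is the one required by \<open>computable_Least\<close>.\<close>

definition pos_inf :: "nat list \<Rightarrow> nat" where
  "pos_inf U = (LEAST k. of_bool (set U \<subseteq> {..<length ss} \<and> Delta_divides ((Delta_quotient ^^ k) U)) = (0::nat))"

definition central_exp :: nat where
  "central_exp = (SOME e. e > 0 \<and> (\<forall>x\<in>carrier G. D (int e) \<otimes> x = x \<otimes> D (int e)))"

lemma central_exp: "central_exp > 0" "x \<in> carrier G \<Longrightarrow> D (int central_exp) \<otimes> x = x \<otimes> D (int central_exp)"
  using someI_ex[OF central_power_ex] unfolding central_exp_def by blast+

definition letter_exp :: "nat + nat \<Rightarrow> nat" where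
  "letter_exp l = (if l \<in> letters then case_sum (\<lambda>_. 0) (\<lambda>_. central_exp) l else 0)"

definition letter_word :: "nat + nat \<Rightarrow> nat list" where
  "letter_word l = (if l \<in> letters
    then SOME U. set U \<subseteq> {..<length ss} \<and> pos_val U = letter_val G ss l \<otimes> D (int (letter_exp l)) else [])"

definition word_exp :: "gword \<Rightarrow> nat" where
  "word_exp w = fold (\<lambda>l k. letter_exp l + k) w 0"

definition pos_word :: "gword \<Rightarrow> nat list" where
  "pos_word w = concat (map letter_word w)"

lemma letter_word:
  assumes "l \<in> letters"
  shows "set (letter_word l) \<subseteq> {..<length ss} \<and> pos_val (letter_word l) = letter_val G ss l \<otimes> D (int (letter_exp l))"
proof -
  have "letter_val G ss l \<otimes> D (int (letter_exp l)) \<in> P"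
    using assms
  proof (rule PlusE)
    fix i assume i: "i \<in> {..<length ss}" "l = Inl i"
    then show ?thesis using assms nth_simple simple_pos by (simp add: letter_val_def letter_exp_def)
  next
    fix i assume i: "i \<in> {..<length ss}" "l = Inr i"
    then have "ss ! i \<preceq> \<Delta>" using nth_simple[of i] simple_iff_prec by auto
    then have "inv (ss ! i) \<otimes> \<Delta> \<otimes> D (int central_exp - 1) \<in> P"
      using central_exp(1) by (intro pos_mult[OF _ D_pos]) (simp_all add: prec_def)
    moreover have "D (int central_exp) = \<Delta> \<otimes> D (int central_exp - 1)"
      using D_mult[of 1 "int central_exp - 1"] by simp
    ultimately show ?thesis using i assms by (simp add: letter_val_def letter_exp_def m_assoc)
  qed
  from someI_ex[OF pos_word_ex[OF this]] show ?thesis using assms by (simp add: letter_word_def)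
qed

lemma word_exp_Cons: "word_exp (l # w) = letter_exp l + word_exp w"
proof -
  have "fold (\<lambda>l k. letter_exp l + k) w n = n + fold (\<lambda>l k. letter_exp l + k) w 0" for n
  proof (induction w arbitrary: n)
    case (Cons l w)
    from Cons[of "letter_exp l + n"] Cons[of "letter_exp l"] show ?case by simp
  qed simp
  from this[of "letter_exp l"] show ?thesis by (simp add: word_exp_def)
qed

lemma pos_word:
  assumes "set w \<subseteq> letters"
  shows "set (pos_word w) \<subseteq> {..<length ss} \<and> pos_val (pos_word w) = val w \<otimes> D (int (word_exp w))"
  using assms
proof (induction w)
  case (Cons l w)
  then have l: "l \<in> letters" and w: "set w \<subseteq> letters" by auto
  \<comment> \<open>\<open>letter_exp l\<close> is \<open>0\<close> or the central exponent, so its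
    power of \<open>\<Delta>\<close> can be collected at the right end of the word.\<close>
  have cent: "D (int (letter_exp l)) \<otimes> val w = val w \<otimes> D (int (letter_exp l))"
    using central_exp(2) w by (auto simp: letter_exp_def split: sum.splits)
  have "pos_val (pos_word (l # w)) = (letter_val G ss l \<otimes> D (int (letter_exp l))) \<otimes> (val w \<otimes> D (int (word_exp w)))"
    using Cons(1)[OF w] letter_word[OF l] by (simp add: pos_word_def pos_val_append)
  also have "\<dots> = letter_val G ss l \<otimes> (D (int (letter_exp l)) \<otimes> val w) \<otimes> D (int (word_exp w))"
    using l w by (simp add: m_assoc)
  also have "\<dots> = val (l # w) \<otimes> D (int (word_exp (l # w)))"
    unfolding cent using l w by (simp add: m_assoc word_exp_Cons D_mult)
  finally show ?case using Cons(1)[OF w] letter_word[OF l] by (simp add: pos_word_def)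
qed (simp add: pos_word_def word_exp_def)

end

section \<open>Deciding infima, divisibility and equality on words\<close>

locale nontrivial_numbered_garside_group = numbered_garside_group + nontrivial_garside_group
begin

lemma pos_val_Delta_quotient:
  assumes "set U \<subseteq> {..<length ss}" "\<And>m. m < k \<Longrightarrow> Delta_divides ((Delta_quotient ^^ m) U)"
  shows "set ((Delta_quotient ^^ k) U) \<subseteq> {..<length ss} \<and>
    pos_val U = D (int k) \<otimes> pos_val ((Delta_quotient ^^ k) U)"
  using assms(2)
proof (induction k)
  case (Suc k)
  let ?V = "(Delta_quotient ^^ k) U"
  have V: "set ?V \<subseteq> {..<length ss}" "pos_val U = D (int k) \<otimes> pos_val ?V" using Suc by simp_all
  have "pos_val ?V = \<Delta> \<otimes> pos_val (Delta_quotient ?V)" using Delta_divides_iff(2)[OF V(1)] Suc(2) by simp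
  moreover have "D (int (Suc k)) = D (int k) \<otimes> \<Delta>" using D_mult[of "int k" 1] by (simp add: add.commute)
  ultimately show ?case using V set_Delta_quotient[OF V(1)] by (simp add: m_assoc)
qed (use assms in simp)

lemma pos_inf_terminates:
  "\<exists>k. of_bool (set U \<subseteq> {..<length ss} \<and> Delta_divides ((Delta_quotient ^^ k) U)) = (0::nat)"
proof (rule ccontr)
  assume "\<not> ?thesis"
  then have *: "set U \<subseteq> {..<length ss}" "\<And>k. Delta_divides ((Delta_quotient ^^ k) U)" by auto
  \<comment> \<open>Endless division by \<open>\<Delta>\<close> would push the infimum above every
    integer.\<close>
  have "int k \<le> ginf (pos_val U)" for k
  proof -
    have "pos_val U = D (int k) \<otimes> pos_val ((Delta_quotient ^^ k) U)" "pos_val ((Delta_quotient ^^ k) U) \<in> P"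
      using pos_val_Delta_quotient[of U k] * pos_val_pos by auto
    then have "D (int k) \<preceq> pos_val U" using prec_mult_pos[of "D (int k)" "pos_val ((Delta_quotient ^^ k) U)"] by simp
    then show ?thesis using le_ginf_iff * by simp
  qed
  from this[of "nat (ginf (pos_val U) + 1)"] this[of 0] show False by simp
qed

lemma ginf_pos_val:
  assumes U: "set U \<subseteq> {..<length ss}"
  shows "ginf (pos_val U) = int (pos_inf U)"
proof -
  let ?k = "pos_inf U"
  have nd: "\<not> Delta_divides ((Delta_quotient ^^ ?k) U)"
    using LeastI_ex[OF pos_inf_terminates[of U]] U unfolding pos_inf_def by simp
  have "Delta_divides ((Delta_quotient ^^ m) U)" if "m < ?k" for m
    using not_less_Least[OF that[unfolded pos_inf_def]] by simp
  then have V: "set ((Delta_quotient ^^ ?k) U) \<subseteq> {..<length ss}"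
      "pos_val U = D (int ?k) \<otimes> pos_val ((Delta_quotient ^^ ?k) U)"
    using pos_val_Delta_quotient[OF U, of ?k] by simp_all
  have "D (int ?k) \<preceq> pos_val U"
    using V pos_val_pos[OF V(1)] prec_mult_pos[of "D (int ?k)"] by simp
  then have 1: "int ?k \<le> ginf (pos_val U)" using le_ginf_iff U by simp
  have "\<not> int ?k + 1 \<le> ginf (pos_val U)"
  proof
    assume "int ?k + 1 \<le> ginf (pos_val U)"
    then have "D (int ?k + 1) \<preceq> pos_val U" using le_ginf_iff[of "pos_val U"] U by simp
    then have "D (int ?k) \<otimes> D 1 \<preceq> D (int ?k) \<otimes> pos_val ((Delta_quotient ^^ ?k) U)"
      unfolding V(2)[symmetric] D_mult[symmetric] .
    then have "D 1 \<preceq> pos_val ((Delta_quotient ^^ ?k) U)"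
      using V(1) by (simp only: prec_mult_left pos_val_carrier int_pow_closed Delta_carrier)
    then show False using nd Delta_divides_iff(1)[OF V(1)] by simp
  qed
  with 1 show ?thesis by simp
qed

lemma ginf_mult_D:
  assumes "x \<in> carrier G"
  shows "ginf (x \<otimes> D k) = ginf x + k"
proof -
  have "m \<le> ginf (x \<otimes> D k) \<longleftrightarrow> m \<le> ginf x + k" for m
  proof -
    have "m \<le> ginf (x \<otimes> D k) \<longleftrightarrow> D (m - k) \<otimes> D k \<preceq> x \<otimes> D k"
      using le_ginf_iff assms by (simp flip: D_mult)
    also have "\<dots> \<longleftrightarrow> m - k \<le> ginf x" using le_ginf_iff assms by (simp only: prec_mult_D int_pow_closed Delta_carrier)
    finally show ?thesis by auto
  qed
  then show ?thesis by (meson order.refl order_antisym)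
qed

lemma ginf_val:
  assumes w: "set w \<subseteq> letters"
  shows "ginf (val w) = int (pos_inf (pos_word w)) - int (word_exp w)"
  using ginf_pos_val[of "pos_word w"] pos_word[OF w] ginf_mult_D[of "val w"] w by simp

text \<open>Terms are moved across the inequality so that the comparison of two differences stays
  within \<open>nat\<close>.\<close>

definition inf_less :: "gword \<Rightarrow> gword \<Rightarrow> bool" where
  "inf_less w w' \<longleftrightarrow> pos_inf (pos_word w) + word_exp w' < pos_inf (pos_word w') + word_exp w"

lemma inf_less_iff:
  "set w \<subseteq> letters \<Longrightarrow> set w' \<subseteq> letters \<Longrightarrow> inf_less w w' \<longleftrightarrow> ginf (val w) < ginf (val w')"
  by (auto simp: inf_less_def ginf_val)

text \<open>Divisibility means that the infimum of the quotient is nonnegative; by antisymmetry this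
  also solves the word problem.\<close>

definition word_prec :: "gword \<Rightarrow> gword \<Rightarrow> bool" where
  "word_prec w w' \<longleftrightarrow> word_exp (word_inv w @ w') \<le> pos_inf (pos_word (word_inv w @ w'))"

lemma word_prec_iff:
  assumes "set w \<subseteq> letters" "set w' \<subseteq> letters"
  shows "word_prec w w' \<longleftrightarrow> val w \<preceq> val w'"
proof -
  have l: "set (word_inv w @ w') \<subseteq> letters" using assms set_word_inv by simp
  have "word_prec w w' \<longleftrightarrow> 0 \<le> ginf (val (word_inv w @ w'))"
    unfolding word_prec_def ginf_val[OF l] by auto
  also have "\<dots> \<longleftrightarrow> val w \<preceq> val w'"
    using le_ginf_iff[of "val (word_inv w @ w')" 0] val_carrier[OF l] assms set_word_inv
    by (simp add: val_append val_word_inv prec_def)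
  finally show ?thesis .
qed

definition word_eq :: "gword \<Rightarrow> gword \<Rightarrow> bool" where
  "word_eq w w' \<longleftrightarrow> word_prec w w' \<and> word_prec w' w"

lemma word_eq_iff:
  "set w \<subseteq> letters \<Longrightarrow> set w' \<subseteq> letters \<Longrightarrow> word_eq w w' \<longleftrightarrow> val w = val w'"
  unfolding word_eq_def using prec_antisym by (auto simp: word_prec_iff)

text \<open>Result \<open>0\<close> is a tie, \<open>1\<close> means that \<open>y\<close> is better
  and \<open>2\<close> that \<open>x\<close> is better; the rest of the fold keeps the first
  difference found.\<close>

definition lex_compare :: "gword \<Rightarrow> gword \<Rightarrow> gword list \<Rightarrow> nat" where
  "lex_compare x y ws = fold (\<lambda>w st. if st = 0
     then (if inf_less (conj_word x w) (conj_word y w) then 1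
       else if inf_less (conj_word y w) (conj_word x w) then 2 else 0)
     else st) ws 0"

lemma lex_compare:
  assumes "set x \<subseteq> letters" "set y \<subseteq> letters" "\<And>w. w \<in> set ws \<Longrightarrow> set w \<subseteq> letters"
  defines "v \<equiv> \<lambda>x. infs (conj_tuple G (map val ws) (val x))"
  shows "lex_compare x y ws = (if lexless (v x) (v y) then 1 else if lexless (v y) (v x) then 2 else 0)"
proof -
  let ?f = "\<lambda>w st::nat. if st = 0
     then (if inf_less (conj_word x w) (conj_word y w) then 1
       else if inf_less (conj_word y w) (conj_word x w) then 2 else 0)
     else st"
  have nz: "fold ?f ws st = st" if "st \<noteq> 0" for ws st
    using that by (induction ws) auto
  have "fold ?f ws 0 = (if lexless (v x) (v y) then 1 else if lexless (v y) (v x) then 2 else 0)"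
    using assms(3) unfolding v_def
  proof (induction ws)
    case Nil
    then show ?case by (simp add: lexless_def conj_tuple_def)
  next
    case (Cons w ws)
    have w: "set w \<subseteq> letters" using Cons by simp
    have less: "inf_less (conj_word x w) (conj_word y w) \<longleftrightarrow> ginf (inv (val x) \<otimes> val w \<otimes> val x) < ginf (inv (val y) \<otimes> val w \<otimes> val y)"
      "inf_less (conj_word y w) (conj_word x w) \<longleftrightarrow> ginf (inv (val y) \<otimes> val w \<otimes> val y) < ginf (inv (val x) \<otimes> val w \<otimes> val x)"
      using inf_less_iff set_conj_word val_conj_word assms w by simp_all
    have IH: "fold ?f ws 0 = (if lexless (infs (conj_tuple G (map val ws) (val x))) (infs (conj_tuple G (map val ws) (val y))) then 1
      else if lexless (infs (conj_tuple G (map val ws) (val y))) (infs (conj_tuple G (map val ws) (val x))) then 2 else 0)"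
      using Cons by simp
    show ?case
      unfolding fold_simps o_apply
      by (auto simp: nz less IH lexless_Cons conj_tuple_def)
  qed
  then show ?thesis by (simp add: lex_compare_def)
qed

section \<open>Certificates that a finite list of conjugators is complete\<close>

definition words_with_inverses :: "gword list \<Rightarrow> gword list" where
  "words_with_inverses ws = concat (map (\<lambda>w. [w, word_inv w]) ws)"

lemma words_with_inverses:
  assumes "\<And>w. w \<in> set ws \<Longrightarrow> set w \<subseteq> letters"
  shows "map val (words_with_inverses ws) = with_inverses (map val ws)"
    "w \<in> set (words_with_inverses ws) \<Longrightarrow> set w \<subseteq> letters"
proof -
  show "map val (words_with_inverses ws) = with_inverses (map val ws)"
    using assms by (induction ws) (auto simp: words_with_inverses_def with_inverses_def val_word_inv)
  assume "w \<in> set (words_with_inverses ws)"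
  then obtain w' where "w' \<in> set ws" "w = w' \<or> w = word_inv w'"
    by (auto simp: words_with_inverses_def)
  then show "set w \<subseteq> letters" using assms set_word_inv by blast
qed

text \<open>With words for all divisors of \<open>D (int N)\<close> as \<open>ds\<close>, one
  condition serves twice: no \<open>d\<close> improves a listed conjugator, which is local
  optimality, and every tie is represented, which for \<open>0 < N\<close> includes closure under
  simple elements. Ties are compared as tuples, since infinitely many conjugators yield the same
  tuple.\<close>

definition certificate :: "gword list \<Rightarrow> gword list \<Rightarrow> gword list \<Rightarrow> bool" where
  "certificate ds ws xs \<longleftrightarrow> xs \<noteq> [] \<and> (\<forall>x\<in>set xs. \<forall>l\<in>set x. l \<in> letters) \<and>
    (\<forall>x\<in>set xs. \<forall>d\<in>set ds.
      lex_compare x (x @ d) (words_with_inverses ws) = 2 \<or>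
      lex_compare x (x @ d) (words_with_inverses ws) = 0 \<and>
      (\<exists>x'\<in>set xs. \<forall>w\<in>set ws. word_eq (conj_word (x @ d) w) (conj_word x' w)))"

lemma with_inverses_inj: "with_inverses u = with_inverses v \<Longrightarrow> u = v"
proof (induction u arbitrary: v)
  case Nil
  then show ?case by (cases v) (auto simp: with_inverses_def)
next
  case (Cons x u)
  then show ?case by (cases v) (auto simp: with_inverses_def)
qed

lemma certificate_iff:
  assumes ws: "\<And>w. w \<in> set ws \<Longrightarrow> set w \<subseteq> letters" and ds: "\<And>d. d \<in> set ds \<Longrightarrow> set d \<subseteq> letters"
  defines "a \<equiv> map val ws"
  defines "c \<equiv> with_inverses a"
  shows "certificate ds ws xs \<longleftrightarrow> xs \<noteq> [] \<and> (\<forall>x\<in>set xs. set x \<subseteq> letters) \<and>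
    (\<forall>x\<in>set xs. \<forall>d\<in>set ds.
      \<not> lexless (infs (conj_tuple G c (val x))) (infs (conj_tuple G c (val x \<otimes> val d))) \<and>
      (\<not> lexless (infs (conj_tuple G c (val x \<otimes> val d))) (infs (conj_tuple G c (val x))) \<longrightarrow>
       conj_tuple G a (val x \<otimes> val d) \<in> conj_tuple G a ` val ` set xs))"
proof -
  have c: "map val (words_with_inverses ws) = c" using words_with_inverses(1)[OF ws] by (simp add: c_def a_def)
  have L: "lex_compare x (x @ d) (words_with_inverses ws) =
      (if lexless (infs (conj_tuple G c (val x))) (infs (conj_tuple G c (val x \<otimes> val d))) then 1
       else if lexless (infs (conj_tuple G c (val x \<otimes> val d))) (infs (conj_tuple G c (val x))) then 2 else 0)"
    if "set x \<subseteq> letters" "d \<in> set ds" for x d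
    using lex_compare[of x "x @ d" "words_with_inverses ws"] words_with_inverses(2)[OF ws] that ds[OF that(2)]
    unfolding c by (simp add: val_append)
  have E: "(\<forall>w\<in>set ws. word_eq (conj_word (x @ d) w) (conj_word x' w)) \<longleftrightarrow>
      conj_tuple G a (val x \<otimes> val d) = conj_tuple G a (val x')"
    if "set x \<subseteq> letters" "d \<in> set ds" "set x' \<subseteq> letters" for x d x'
  proof -
    have xd: "set (x @ d) \<subseteq> letters" using that ds by simp
    have "word_eq (conj_word (x @ d) w) (conj_word x' w) \<longleftrightarrow>
        inv (val x \<otimes> val d) \<otimes> val w \<otimes> (val x \<otimes> val d) = inv (val x') \<otimes> val w \<otimes> val x'" if w: "w \<in> set ws" for w
      using word_eq_iff[OF set_conj_word[OF xd ws[OF w]] set_conj_word[OF \<open>set x' \<subseteq> letters\<close> ws[OF w]]]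
        val_conj_word[OF xd ws[OF w]] val_conj_word[OF \<open>set x' \<subseteq> letters\<close> ws[OF w]] val_append[OF \<open>set x \<subseteq> letters\<close> ds[OF \<open>d \<in> set ds\<close>]]
      by simp
    then show ?thesis by (simp add: a_def conj_tuple_def)
  qed
  show ?thesis
  proof (cases "\<forall>x\<in>set xs. set x \<subseteq> letters")
    case True
    have "(lex_compare x (x @ d) (words_with_inverses ws) = 2 \<or>
      lex_compare x (x @ d) (words_with_inverses ws) = 0 \<and>
      (\<exists>x'\<in>set xs. \<forall>w\<in>set ws. word_eq (conj_word (x @ d) w) (conj_word x' w))) \<longleftrightarrow>
      \<not> lexless (infs (conj_tuple G c (val x))) (infs (conj_tuple G c (val x \<otimes> val d))) \<and>
      (\<not> lexless (infs (conj_tuple G c (val x \<otimes> val d))) (infs (conj_tuple G c (val x))) \<longrightarrow>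
       conj_tuple G a (val x \<otimes> val d) \<in> conj_tuple G a ` val ` set xs)"
      if "x \<in> set xs" "d \<in> set ds" for x d
    proof -
      have x: "set x \<subseteq> letters" using True that by blast
      have "(\<exists>x'\<in>set xs. \<forall>w\<in>set ws. word_eq (conj_word (x @ d) w) (conj_word x' w)) \<longleftrightarrow>
          conj_tuple G a (val x \<otimes> val d) \<in> conj_tuple G a ` val ` set xs"
        using E[OF x that(2)] True by (auto simp: image_iff)
      then show ?thesis using L[OF x that(2)] by simp
    qed
    then show ?thesis using True unfolding certificate_def by (simp add: subset_iff)
  next
    case False
    then have "\<not> (\<forall>x\<in>set xs. \<forall>l\<in>set x. l \<in> letters)" by blast
    with False show ?thesis unfolding certificate_def by blast
  qed
qed

text \<open>Local optimality makes every listed conjugator optimal, and closure under simple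
  elements then reaches all optimal tuples by \<open>optimal_connected\<close>. Positivity of
  \<open>N\<close> puts the simple elements among the values of \<open>ds\<close>.\<close>

lemma certificate_sound:
  assumes ws: "\<And>w. w \<in> set ws \<Longrightarrow> set w \<subseteq> letters" and ds: "\<And>d. d \<in> set ds \<Longrightarrow> set d \<subseteq> letters"
    and N: "chain_bound \<Delta> N" "0 < N" and dval: "val ` set ds = {d \<in> P. d \<preceq> D (int N)}"
    and cert: "certificate ds ws xs"
  shows "conj_tuple G (map val ws) ` val ` set xs = LSSS G S \<Delta> (map val ws)"
proof -
  let ?a = "map val ws" and ?X = "val ` set xs"
  let ?c = "with_inverses ?a"
  have a: "set ?a \<subseteq> carrier G" using ws by auto
  have c: "set ?c \<subseteq> carrier G" using set_with_inverses[OF a] .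
  have cert': "xs \<noteq> []" "\<forall>x\<in>set xs. set x \<subseteq> letters"
    "\<forall>x\<in>set xs. \<forall>d\<in>set ds.
      \<not> lexless (infs (conj_tuple G ?c (val x))) (infs (conj_tuple G ?c (val x \<otimes> val d))) \<and>
      (\<not> lexless (infs (conj_tuple G ?c (val x \<otimes> val d))) (infs (conj_tuple G ?c (val x))) \<longrightarrow>
       conj_tuple G ?a (val x \<otimes> val d) \<in> conj_tuple G ?a ` ?X)"
    using cert certificate_iff[of ws ds xs, OF ws ds] by auto
  have Xc: "?X \<subseteq> carrier G" using cert' by auto
  have opt: "optimal ?c x" if "x \<in> ?X" for x
  proof (rule optimal_if_locally_optimal[OF c _ N(1)])
    fix d assume "d \<in> P" "d \<preceq> D (int N)"
    then have "d \<in> val ` set ds" using dval by simp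
    then show "\<not> lexless (infs (conj_tuple G ?c x)) (infs (conj_tuple G ?c (x \<otimes> d)))"
      using that cert' by auto
  qed (use that Xc in blast)
  \<comment> \<open>Optimality concerns the tuple with inverses, whereas the certificate compares
    the tuple itself; equality of conjugates means the same for both.\<close>
  have conj: "conj_tuple G ?c x = conj_tuple G ?c y \<longleftrightarrow> conj_tuple G ?a x = conj_tuple G ?a y"
    if "x \<in> carrier G" "y \<in> carrier G" for x y
    using that with_inverses_inj by (metis with_inverses_conj_tuple[OF a])
  have *: "conj_tuple G ?c y \<in> conj_tuple G ?c ` ?X" if y: "optimal ?c y" for y
  proof (rule optimal_connected[OF c opt])
    fix x s assume x: "x \<in> ?X" and s: "s \<in> S" and os: "optimal ?c (x \<otimes> s)"
    have sP: "s \<in> P" using s simple_pos by blast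
    have "s \<preceq> \<Delta>" using s sP simple_iff_prec by simp
    moreover have "\<Delta> \<preceq> D (int N)" using D_mono[of 1 "int N"] N by simp
    ultimately have "s \<preceq> D (int N)" using prec_trans[of s \<Delta>] sP by simp
    then have "s \<in> val ` set ds" using dval sP by simp
    then obtain d w where d: "d \<in> set ds" "s = val d" and w: "w \<in> set xs" "x = val w" using x by blast
    have "\<not> lexless (infs (conj_tuple G ?c (x \<otimes> s))) (infs (conj_tuple G ?c x))"
      using os x Xc unfolding optimal_def by blast
    then have "conj_tuple G ?a (x \<otimes> s) \<in> conj_tuple G ?a ` ?X"
      using cert'(3) d w by blast
    then obtain x' where x': "x' \<in> ?X" "conj_tuple G ?a (x \<otimes> s) = conj_tuple G ?a x'" by blast
    have "x \<otimes> s \<in> carrier G" "x' \<in> carrier G" using x x' Xc sP pos_carrier by blast+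
    then have "conj_tuple G ?c (x \<otimes> s) = conj_tuple G ?c x'" using conj x' by blast
    then show "conj_tuple G ?c (x \<otimes> s) \<in> conj_tuple G ?c ` ?X" using x' by blast
  qed (use cert' y in auto)
  have "conj_tuple G ?a y \<in> conj_tuple G ?a ` ?X" if "optimal ?c y" for y
  proof -
    from *[OF that] obtain x where x: "conj_tuple G ?c y = conj_tuple G ?c x" "x \<in> ?X" by (rule imageE)
    have "y \<in> carrier G" "x \<in> carrier G" using that x Xc by (auto simp: optimal_def)
    then have "conj_tuple G ?a y = conj_tuple G ?a x" using conj x(1) by simp
    then show ?thesis using x(2) by (rule image_eqI)
  qed
  then show ?thesis unfolding LSSS_eq[OF a] using opt by (intro subset_antisym image_subsetI) (simp_all add: image_mono subsetI)
qed

text \<open>Finitely many optimal conjugators yield the whole set, because it is finite. No move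
  improves them, and a tie is again optimal, so its tuple is already represented.\<close>

lemma certificate_ex:
  assumes ws: "\<And>w. w \<in> set ws \<Longrightarrow> set w \<subseteq> letters" and ds: "\<And>d. d \<in> set ds \<Longrightarrow> set d \<subseteq> letters"
  shows "\<exists>xs. certificate ds ws xs"
proof -
  let ?a = "map val ws"
  let ?c = "with_inverses ?a"
  have a: "set ?a \<subseteq> carrier G" using ws by auto
  have c: "set ?c \<subseteq> carrier G" using set_with_inverses[OF a] .
  obtain X where X: "X \<subseteq> Collect (optimal ?c)" "finite X" "LSSS G S \<Delta> ?a = conj_tuple G ?a ` X"
    using finite_LSSS[OF a] LSSS_eq[OF a] finite_subset_image[of "LSSS G S \<Delta> ?a" "conj_tuple G ?a" "Collect (optimal ?c)"]
    by (metis order.refl)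
  have "X \<noteq> {}" using X LSSS_eq[OF a] optimal_ex[OF c] by auto
  obtain h where h: "\<And>x. x \<in> carrier G \<Longrightarrow> set (h x) \<subseteq> letters \<and> val (h x) = x" using word_ex by metis
  obtain X' where X': "set X' = X" using X(2) finite_list by blast
  let ?xs = "map h X'"
  have Xc: "x \<in> carrier G" if "x \<in> X" for x using X that by (auto simp: optimal_def)
  have "(\<lambda>x. val (h x)) ` X = (\<lambda>x. x) ` X" using h Xc by (intro image_cong) auto
  then have vX: "val ` set ?xs = X" using X' by (simp add: image_image)
  have "certificate ds ws ?xs"
  proof (subst certificate_iff, goal_cases)
    case 3
    show ?case
  proof (intro conjI ballI impI)
    fix w d assume w: "w \<in> set ?xs" and d: "d \<in> set ds"
    have "val w \<in> X" using w vX by blast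
    then have o: "optimal ?c (val w)" "val w \<in> carrier G" using X Xc by auto
    have dc: "val d \<in> carrier G" using ds d by simp
    then show n: "\<not> lexless (infs (conj_tuple G ?c (val w))) (infs (conj_tuple G ?c (val w \<otimes> val d)))"
      using o by (simp add: optimal_def)
    assume "\<not> lexless (infs (conj_tuple G ?c (val w \<otimes> val d))) (infs (conj_tuple G ?c (val w)))"
    then have "infs (conj_tuple G ?c (val w \<otimes> val d)) = infs (conj_tuple G ?c (val w))"
      using n lexless_linear[of "infs (conj_tuple G ?c (val w \<otimes> val d))" "infs (conj_tuple G ?c (val w))"] by auto
    then have "optimal ?c (val w \<otimes> val d)" using optimal_cong[OF o(1)] o dc by simp
    then show "conj_tuple G ?a (val w \<otimes> val d) \<in> conj_tuple G ?a ` val ` set ?xs"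
      unfolding vX X(3)[symmetric] LSSS_eq[OF a] by blast
  qed (use \<open>X \<noteq> {}\<close> X' h Xc in auto)
  qed (use ws ds in auto)
  then show ?thesis by blast
qed

end

section \<open>Computing the lexicographic super summit set\<close>

lemma even_iff_rec_nat: "rec_nat 0 (\<lambda>_ y. 1 - y) n = (0::nat) \<longleftrightarrow> even n"
proof -
  have "rec_nat 0 (\<lambda>_ y. 1 - y) n = (if even n then 0 else 1 :: nat)" by (induction n) auto
  then show ?thesis by auto
qed

text \<open>\<open>sum_encode\<close> places \<open>Inl\<close> on even and \<open>Inr\<close> on
  odd numbers, so exchanging them moves a code one up or one down.\<close>

lemma computable_swap: "computable (case_sum Inr Inl :: nat + nat \<Rightarrow> nat + nat)"
proof (rule computable_cong)
  let ?e = "\<lambda>l :: nat + nat. enc l"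
  show "computable (\<lambda>l. if rec_nat 0 (\<lambda>_ y. 1 - y) (?e l) = (0::nat)
      then dec (Suc (?e l)) else dec (?e l - 1) :: nat + nat)"
    by (intro computable_If decidable_eq_0 computable_rec_nat) auto
  have e: "?e l = sum_encode l" for l
    by (cases l) (simp_all add: enc_sum_def enc_nat_def)
  have d: "(dec n :: nat + nat) = sum_decode n" for n
    using dec_enc[of "sum_decode n"] e[of "sum_decode n"] by simp
  show "(if rec_nat 0 (\<lambda>_ y. 1 - y) (?e l) = (0::nat)
      then dec (Suc (?e l)) else dec (?e l - 1)) = case_sum Inr Inl l" for l
    unfolding even_iff_rec_nat e d
    by (cases l) (simp_all add: sum_encode_def sum_decode_def)
qed

lemma computable_word_inv [intro!]: "computable f \<Longrightarrow> computable (\<lambda>x. word_inv (f x))"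
  unfolding word_inv_def
  by (intro computable_map computable_rev computable_comp[OF computable_swap]) auto

lemma computable_conj_word [intro!]:
  "computable f \<Longrightarrow> computable g \<Longrightarrow> computable (\<lambda>x. conj_word (f x) (g x))"
  unfolding conj_word_def by auto

section \<open>Computability of the functions on words\<close>

context numbered_garside_group
begin

lemma computable_complement [intro!]: "computable f \<Longrightarrow> computable (\<lambda>x. complement (f x))"
proof (rule computable_comp[of complement])
  show "computable complement"
    unfolding complement_def by (rule computable_finite_table) simp
qed

lemma computable_complement_word: "computable f \<Longrightarrow> computable (\<lambda>x. complement_word i (f x))"
  unfolding complement_word_def by (intro computable_fold) auto

lemma computable_Delta_quotient [intro!]: "computable f \<Longrightarrow> computable (\<lambda>x. Delta_quotient (f x))"
  unfolding Delta_quotient_def by (intro computable_snd computable_complement_word)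

lemma decidable_Delta_divides: "computable f \<Longrightarrow> decidable (\<lambda>x. Delta_divides (f x))"
  unfolding Delta_divides_def by (intro decidable_mem_finite computable_fst computable_complement_word) auto

lemma computable_word_exp [intro!]: "computable f \<Longrightarrow> computable (\<lambda>x. word_exp (f x))"
proof -
  have 1: "computable letter_exp"
    unfolding letter_exp_def by (rule computable_finite_table) simp
  show "computable f \<Longrightarrow> computable (\<lambda>x. word_exp (f x))"
    unfolding word_exp_def by (intro computable_fold computable_add computable_comp[OF 1]) auto
qed

lemma computable_pos_word [intro!]: "computable f \<Longrightarrow> computable (\<lambda>x. pos_word (f x))"
proof -
  have 1: "computable letter_word"
    unfolding letter_word_def by (rule computable_finite_table) simp
  show "computable f \<Longrightarrow> computable (\<lambda>x. pos_word (f x))"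
    unfolding pos_word_def by (intro computable_concat computable_map computable_comp[OF 1]) auto
qed

end

context nontrivial_numbered_garside_group
begin

lemma computable_pos_inf [intro!]: "computable f \<Longrightarrow> computable (\<lambda>x. pos_inf (f x))"
proof (rule computable_comp[of pos_inf])
  have "decidable (\<lambda>z. (\<forall>i\<in>set (fst z). i \<in> {..<length ss}) \<and> Delta_divides ((Delta_quotient ^^ snd z) (fst z)))"
    by (intro decidable_conj decidable_Ball_set decidable_mem_finite decidable_Delta_divides computable_funpow) auto
  then have "computable (\<lambda>z. of_bool (set (fst z) \<subseteq> {..<length ss} \<and> Delta_divides ((Delta_quotient ^^ snd z) (fst z))) :: nat)"
    unfolding decidable_def subset_eq .
  then show "computable pos_inf"
    unfolding pos_inf_def using pos_inf_terminates by (rule computable_Least)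
qed

lemma decidable_inf_less [intro!]:
  "computable f \<Longrightarrow> computable g \<Longrightarrow> decidable (\<lambda>x. inf_less (f x) (g x))"
  unfolding inf_less_def by (intro decidable_less computable_add computable_pos_inf computable_pos_word computable_word_exp)

lemma decidable_word_eq [intro!]:
  "computable f \<Longrightarrow> computable g \<Longrightarrow> decidable (\<lambda>x. word_eq (f x) (g x))"
  unfolding word_eq_def word_prec_def by auto

lemma computable_lex_compare [intro!]:
  assumes "computable f" "computable g" "computable h"
  shows "computable (\<lambda>z. lex_compare (f z) (g z) (h z))"
proof -
  have "computable (\<lambda>z. lex_compare (fst z) (fst (snd z)) (snd (snd z)))"
    unfolding lex_compare_def by (intro computable_fold computable_If decidable_eq_0) auto
  from computable_comp[OF this computable_Pair[OF assms(1) computable_Pair[OF assms(2,3)]]]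
  show ?thesis by simp
qed

lemma computable_words_with_inverses [intro!]:
  "computable f \<Longrightarrow> computable (\<lambda>x. words_with_inverses (f x))"
  unfolding words_with_inverses_def by (intro computable_concat computable_map) auto

lemma decidable_certificate: "decidable (\<lambda>z. certificate ds (fst z) (snd z))"
  unfolding certificate_def
  by (intro decidable_conj decidable_disj decidable_not decidable_Ball_set decidable_Bex_set decidable_eq
      decidable_mem_finite decidable_word_eq computable_lex_compare computable_words_with_inverses
      computable_conj_word computable_append) auto

text \<open>Links the encoding by type classes with the codes that
  \<open>computes_finite_sets\<close> prescribes.\<close>

lemma enc_word_tuple: "enc ws = word_tuple_code ws"
proof -
  have "enc l = sum_encode l" for l :: "nat + nat" by (cases l) (simp_all add: enc_sum_def enc_nat_def)
  then have e: "enc = (sum_encode :: nat + nat \<Rightarrow> nat)" by blast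
  have "enc = (\<lambda>w :: gword. list_encode (map sum_encode w))"
    by (rule ext) (simp only: enc_list_def e)
  then show ?thesis by (simp only: word_tuple_code_def enc_list_def[of ws])
qed

lemma enc_word_tuple_list: "enc us = word_tuple_list_code us"
  unfolding word_tuple_list_code_def enc_list_def[of us] using enc_word_tuple by presburger

lemma word_tuples_iff: "ws \<in> word_tuples ss r \<longleftrightarrow> length ws = r \<and> (\<forall>w\<in>set ws. set w \<subseteq> letters)"
  by (auto simp: word_tuples_def gwords_def lists_eq_set)

lemma LSSS_computable: "\<exists>f. computes_finite_sets G ss r f (LSSS G S \<Delta>)"
proof -
  obtain N0 where N0: "chain_bound \<Delta> N0" using chain_bound_ex Delta_pos by blast
  \<comment> \<open>The successor makes the bound positive, so that the divisors of
    \<open>D (int N)\<close> include the simple elements.\<close>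
  define N where "N = Suc N0"
  have N: "chain_bound \<Delta> N" "0 < N" using N0 by (auto simp: chain_bound_def N_def le_Suc_eq)
  \<comment> \<open>These words depend only on the Garside structure and enter the program as
    constants.\<close>
  obtain ds where ds: "\<And>d. d \<in> set ds \<Longrightarrow> set d \<subseteq> letters" "val ` set ds = {d \<in> P. d \<preceq> D (int N)}"
  proof -
    obtain h where h: "\<And>x. x \<in> carrier G \<Longrightarrow> set (h x) \<subseteq> letters \<and> val (h x) = x" using word_ex by metis
    obtain dl where dl: "set dl = {d \<in> P. d \<preceq> D (int N)}" using finite_divisors finite_list by blast
    have c: "d \<in> carrier G" if "d \<in> set dl" for d using that dl by simp
    have "val ` set (map h dl) = set dl" using h c by (auto simp: image_iff)
    moreover have "set d \<subseteq> letters" if "d \<in> set (map h dl)" for d using that h c by auto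
    ultimately show ?thesis using that[of "map h dl"] dl by simp
  qed
  let ?valid = "\<lambda>ws. \<forall>w\<in>set ws. \<forall>l\<in>set w. l \<in> letters"
  \<comment> \<open>Invalid inputs are accepted with any list, so that the search is total.\<close>
  define q where "q z = (of_bool (\<not> (certificate ds (fst z) (snd z) \<or> \<not> ?valid (fst z))) :: nat)" for z
  have "decidable (\<lambda>z :: gword list \<times> gword list. ?valid (fst z))"
    by (intro decidable_Ball_set decidable_mem_finite) auto
  then have "computable q"
    using decidable_certificate unfolding q_def decidable_def[symmetric] by (intro decidable_not decidable_disj)
  moreover have "\<exists>xs. q (ws, xs) = 0" for ws
  proof (cases "?valid ws")
    case True
    then have "\<exists>xs. certificate ds ws xs" using ds by (intro certificate_ex) auto
    then show ?thesis by (simp add: q_def)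
  qed (simp add: q_def)
  ultimately obtain f where f: "computable f" "\<And>ws. q (ws, f ws) = 0"
    using computable_choice[of q] by blast
  define F where "F ws = map (\<lambda>x. map (conj_word x) ws) (f ws)" for ws
  have "computable (\<lambda>z :: gword list \<times> gword. map (conj_word (snd z)) (fst z))"
    by (intro computable_map) auto
  then have "computable F"
    unfolding F_def using f(1) by (intro computable_map) auto
  then obtain p where p: "\<And>ws. recf_eval p [word_tuple_code ws] (word_tuple_list_code (F ws))"
    unfolding computable_def enc_word_tuple enc_word_tuple_list by blast
  have "set (F ws) \<subseteq> word_tuples ss r \<and> map val ` set (F ws) = LSSS G S \<Delta> (map val ws)"
    if "ws \<in> word_tuples ss r" for ws
  proof -
    have ws: "length ws = r" "\<And>w. w \<in> set ws \<Longrightarrow> set w \<subseteq> letters" using that by (auto simp: word_tuples_iff)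
    have cert: "certificate ds ws (f ws)" using f(2)[of ws] ws(2) by (auto simp: q_def)
    then have x: "set x \<subseteq> letters" if "x \<in> set (f ws)" for x using that by (auto simp: certificate_def)
    have "map val (map (conj_word x) ws) = conj_tuple G (map val ws) (val x)" if "x \<in> set (f ws)" for x
      using val_conj_word[OF x[OF that] ws(2)] by (simp add: conj_tuple_def)
    then have "map val ` set (F ws) = conj_tuple G (map val ws) ` val ` set (f ws)"
      by (simp add: F_def image_image)
    also have "\<dots> = LSSS G S \<Delta> (map val ws)"
      using ws(2) ds N cert by (intro certificate_sound[of ws ds N]) auto
    finally show ?thesis
      using ws(1) set_conj_word[OF x ws(2)] by (auto simp: F_def word_tuples_iff)
  qed
  with p show ?thesis unfolding computes_finite_sets_def by blast
qed

end

section \<open>Conjugacy invariance and the trivial group\<close>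

context nontrivial_garside_group
begin

text \<open>Optimality is measured against the whole class, so left multiplication by
  \<open>x\<close> carries optimal conjugators of the conjugate to those of \<open>a\<close> without
  changing the resulting tuples. Conjugating back gives the other inclusion.\<close>

lemma LSSS_conj_tuple:
  assumes a: "set a \<subseteq> carrier G" and x: "x \<in> carrier G"
  shows "LSSS G S \<Delta> (conj_tuple G a x) = LSSS G S \<Delta> a"
proof -
  have sub: "LSSS G S \<Delta> (conj_tuple G a x) \<subseteq> LSSS G S \<Delta> a"
    if a: "set a \<subseteq> carrier G" and x: "x \<in> carrier G" for a x
  proof
    let ?c = "with_inverses a"
    have c: "set ?c \<subseteq> carrier G" using set_with_inverses[OF a] .
    fix u assume "u \<in> LSSS G S \<Delta> (conj_tuple G a x)"
    then obtain y where y: "optimal (conj_tuple G ?c x) y" "u = conj_tuple G (conj_tuple G a x) y"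
      using LSSS_eq[OF set_conj_tuple[OF a x]] with_inverses_conj_tuple[OF a x] by auto
    have yc: "y \<in> carrier G" using y by (simp add: optimal_def)
    have "optimal ?c (x \<otimes> y)"
      unfolding optimal_def
    proof (intro conjI ballI)
      fix z assume z: "z \<in> carrier G"
      have "\<not> lexless (infs (conj_tuple G (conj_tuple G ?c x) y)) (infs (conj_tuple G (conj_tuple G ?c x) (inv x \<otimes> z)))"
        using y(1) x z by (simp add: optimal_def)
      then show "\<not> lexless (infs (conj_tuple G ?c (x \<otimes> y))) (infs (conj_tuple G ?c z))"
        using conj_tuple_mult[OF c x] x yc z by simp
    qed (use x yc in simp)
    then show "u \<in> LSSS G S \<Delta> a" using LSSS_eq[OF a] y conj_tuple_mult[OF a x yc] by auto
  qed
  have "conj_tuple G (conj_tuple G a x) (inv x) = a" using a x by (simp add: conj_tuple_mult conj_tuple_one)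
  with sub[OF a x] sub[OF set_conj_tuple[OF a x], of "inv x"] x show ?thesis by auto
qed

end

context garside_group
begin

lemma carrier_trivial:
  assumes "\<Delta> = \<one>"
  shows "carrier G = {\<one>}"
proof -
  have S: "s = \<one>" if "s \<in> S" for s
    using that assms simple_iff_prec[of s] simples_subset prec_antisym[of s \<one>] by auto
  have P: "x = \<one>" if "x \<in> P" for x
    using that by (induction rule: submonoid_gen.induct) (auto dest: S)
  have "x = \<one>" if x: "x \<in> carrier G" for x
  proof -
    obtain a b where "a \<in> P" "b \<in> P" "x = a \<otimes> inv b" using x fractions by auto
    then show ?thesis using P[of a] P[of b] by simp
  qed
  then show ?thesis by auto
qed

text \<open>Infima and suprema are unspecified here, but the only conjugator is
  \<open>\<one>\<close>, so \<open>LSSS_eq_infsup\<close> applies whatever their values are.\<close>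

lemma LSSS_trivial:
  assumes "\<Delta> = \<one>" "a \<in> tuples G r"
  shows "a = replicate r \<one>" "LSSS G S \<Delta> a = {replicate r \<one>}"
proof -
  note triv = carrier_trivial[OF assms(1)]
  show a: "a = replicate r \<one>"
    using assms(2) triv by (auto simp: tuples_def intro!: replicate_eqI)
  have c: "set a \<subseteq> carrier G" using assms(2) by (simp add: tuples_def)
  have "LSSS G S \<Delta> a = {conj_tuple G a y |y. y \<in> carrier G \<and> infsup (conj_tuple G a y) = infsup (conj_tuple G a \<one>)}"
    using c triv by (intro LSSS_eq_infsup) (auto simp: lexless_def)
  then show "LSSS G S \<Delta> a = {replicate r \<one>}" using triv conj_tuple_one[OF c] a by auto
qed

lemma finite_nonempty_LSSS:
  assumes "a \<in> tuples G r"
  shows "finite (LSSS G S \<Delta> a) \<and> LSSS G S \<Delta> a \<noteq> {}"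
proof (cases "\<Delta> = \<one>")
  case False
  then interpret nontrivial_garside_group by unfold_locales
  have a: "set a \<subseteq> carrier G" using assms by (simp add: tuples_def)
  show ?thesis using finite_LSSS[OF a] LSSS_eq[OF a] optimal_ex[OF set_with_inverses[OF a]] by auto
qed (use LSSS_trivial(2)[OF _ assms] in simp)

lemma LSSS_eq_iff_conjugate:
  assumes a: "a \<in> tuples G r" and c: "c \<in> tuples G r"
  shows "(\<exists>x\<in>carrier G. conj_tuple G a x = c) \<longleftrightarrow> LSSS G S \<Delta> a = LSSS G S \<Delta> c"
proof
  assume "\<exists>x\<in>carrier G. conj_tuple G a x = c"
  then obtain x where x: "x \<in> carrier G" "conj_tuple G a x = c" by blast
  show "LSSS G S \<Delta> a = LSSS G S \<Delta> c"
  proof (cases "\<Delta> = \<one>")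
    case False
    then interpret nontrivial_garside_group by unfold_locales
    show ?thesis using LSSS_conj_tuple[of a x] a x by (simp add: tuples_def)
  qed (use LSSS_trivial(1)[OF _ a] LSSS_trivial(1)[OF _ c] in simp)
next
  assume eq: "LSSS G S \<Delta> a = LSSS G S \<Delta> c"
  obtain u where "u \<in> LSSS G S \<Delta> a" using finite_nonempty_LSSS[OF a] by blast
  then have "u \<in> conj_class G a" "u \<in> conj_class G c" using eq by (auto simp: LSSS_def)
  then obtain x y where xy: "x \<in> carrier G" "y \<in> carrier G" "conj_tuple G a x = conj_tuple G c y"
    by (auto simp: conj_class_def)
  have "conj_tuple G a (x \<otimes> inv y) = conj_tuple G (conj_tuple G c y) (inv y)"
    using a xy conj_tuple_mult[of a x "inv y"] by (simp add: tuples_def)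
  also have "\<dots> = c" using c xy by (simp add: tuples_def conj_tuple_mult conj_tuple_one)
  finally show "\<exists>x\<in>carrier G. conj_tuple G a x = c" using xy by blast
qed

lemma LSSS_computes_finite_sets:
  assumes "set ss = S"
  shows "\<exists>f. computes_finite_sets G ss r f (LSSS G S \<Delta>)"
proof (cases "\<Delta> = \<one>")
  case False
  interpret nontrivial_numbered_garside_group G S \<Delta> ss
    by unfold_locales (use assms False in auto)
  show ?thesis by (rule LSSS_computable)
next
  case True
  interpret numbered_garside_group G S \<Delta> ss
    by unfold_locales (rule assms)
  \<comment> \<open>Empty words represent the only tuple there is, so a constant program
    suffices.\<close>
  let ?us = "[replicate r []] :: gword list list"
  have "computable (\<lambda>_ :: nat. word_tuple_list_code ?us)" by (rule computable_const)
  then obtain p where p: "\<And>n. recf_eval p [n] (word_tuple_list_code ?us)"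
    unfolding computable_def enc_nat_def by blast
  have "set ?us \<subseteq> word_tuples ss r \<and> map val ` set ?us = LSSS G S \<Delta> (map val ws)"
    if "ws \<in> word_tuples ss r" for ws
  proof -
    have "map val ws \<in> tuples G r"
      using that val_carrier by (auto simp: tuples_def word_tuples_def gwords_def lists_eq_set subset_iff)
    then have "LSSS G S \<Delta> (map val ws) = {replicate r \<one>}" by (rule LSSS_trivial(2)[OF True])
    moreover have "replicate r [] \<in> word_tuples ss r"
      by (simp add: word_tuples_def gwords_def set_replicate_conv_if)
    ultimately show ?thesis by (simp only: list.set image_insert image_empty map_replicate val_simps) simp
  qed
  then show ?thesis unfolding computes_finite_sets_def using p by (intro exI[of _ p] ballI exI[of _ ?us]) simp
qed

end

theorem mainTheorem3:
  fixes G (structure) and S :: "'a set" and \<Delta> :: 'a and r :: nat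
  assumes "garside_group G S \<Delta>"
  shows "(\<forall>a\<in>tuples G r. finite (LSSS G S \<Delta> a) \<and> LSSS G S \<Delta> a \<noteq> {}) \<and>
    (\<forall>a\<in>tuples G r. \<forall>c\<in>tuples G r.
       (\<exists>x\<in>carrier G. conj_tuple G a x = c) \<longleftrightarrow> LSSS G S \<Delta> a = LSSS G S \<Delta> c) \<and>
    (\<forall>ss. distinct ss \<and> set ss = S \<longrightarrow>
       (\<exists>f. computes_finite_sets G ss r f (LSSS G S \<Delta>)))"
proof -
  interpret garside_group G S \<Delta> by (rule assms)
  show ?thesis
    using finite_nonempty_LSSS LSSS_eq_iff_conjugate LSSS_computes_finite_sets by blast
qed

end
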